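(* Let $0<\alpha\le 1$, $1<\alpha+\beta\le 2$, $c>0$, $D>0$. Let $Q(x,t)$, $x\in\mathbb{R}^3$, $t>0$, be the fundamental solution of the initial-value problem $$\frac{1}{c^{2}}\frac{\partial^{\alpha+\beta}}{\partial t^{\alpha+\beta}}q(x,t)+\frac{1}{D}\frac{\partial^{\alpha}}{\partial t^{\alpha}}q(x,t)=\Delta q(x,t),\qquad q(x,t)\big|_{t=0}=\delta(x),\qquad \frac{\partial}{\partial t}q(x,t)\Big|_{t=0}=0,$$ and let $H(\kappa,t)=\int_{\mathbb{R}^3}e^{\mathrm{i}\langle\kappa,x\rangle}Q(x,t)\,dx$ be its spatial Fourier transform. Then for all $\kappa\in\mathbb{R}^3$ and $t\ge 0$, $$H(\kappa,t)=1+\sum_{n=0}^{\infty}\left(-\|\kappa\|^{2}c^{2}t^{\alpha+\beta}\right)^{n+1}\mathrm{E}_{\beta,(\alpha+\beta)(n+1)+1}^{\,n+1}\left(-\frac{c^{2}}{D}t^{\beta}\right)$$ $$=1-\|\kappa\|^{2}c^{2}t^{\alpha+\beta}\sum_{m=0}^{\infty}\sum_{n=0}^{\infty}\binom{m}{n}\frac{\left(-\frac{c^{2}}{D}t^{\beta}\right)^{m}\left(\|\kappa\|^{2}Dt^{\alpha}\right)^{n}}{\Gamma(\beta m+\alpha n+\alpha+\beta+1)}.$$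
   Context: For $n-1<\gamma<n$, $n\in\mathbb{N}$, the Caputo fractional derivative in time is $$\frac{\partial^{\gamma}}{\partial t^{\gamma}}q(x,t)=\frac{1}{\Gamma(n-\gamma)}\int_0^t\frac{q^{(n)}(x,\tau)}{(t-\tau)^{\gamma+1-n}}\,d\tau,$$ where $q^{(n)}$ is the $n$-th partial derivative of $q$ in time; for integer $\gamma$ it is the ordinary partial derivative of order $\gamma$. $\Delta$ is the Laplacian in $\mathbb{R}^3$ acting on $x$, and $\delta$ is the Dirac delta. The fundamental solution $Q$ is the solution (Green's function) of the stated initial-value problem, understood in general in the sense of distributions in $x$, with the Fourier transform in $x$ understood accordingly. The three-parameter Mittag-Leffler (Prabhakar) function is $$\mathrm{E}_{a,b}^{\zeta}(z)=\sum_{k=0}^{\infty}\frac{(\zeta)_k\,z^k}{k!\,\Gamma(ak+b)},\qquad \zeta>0,\ \mathrm{Re}(a)>0,\ \mathrm{Re}(b)>0,$$ where $(\zeta)_k=\Gamma(\zeta+k)/\Gamma(\zeta)$. The convention $\binom{m}{n}=0$ for $n>m$ is used; for each $m$ the inner sum (over $n$) is thus finite. *)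

theory Defs
  imports "HOL-Analysis.Analysis"
begin

section \<open>Schwartz functions and tempered distributions on three-dimensional space\<close>

definition partial_deriv :: "3 \<Rightarrow> (real^3 \<Rightarrow> complex) \<Rightarrow> real^3 \<Rightarrow> complex" where
  "partial_deriv i \<phi> x = frechet_derivative \<phi> (at x) (axis i 1)"

definition iter_partial :: "3 list \<Rightarrow> (real^3 \<Rightarrow> complex) \<Rightarrow> real^3 \<Rightarrow> complex" where
  "iter_partial ds \<phi> = foldr partial_deriv ds \<phi>"

definition laplacian :: "(real^3 \<Rightarrow> complex) \<Rightarrow> real^3 \<Rightarrow> complex" where
  "laplacian \<phi> x = (\<Sum>i\<in>UNIV. partial_deriv i (partial_deriv i \<phi>) x)"

text \<open>A function is smooth iff all of its iterated partial derivatives are (totally)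
  differentiable everywhere.\<close>

definition schwartz :: "(real^3 \<Rightarrow> complex) \<Rightarrow> bool" where
  "schwartz \<phi> \<longleftrightarrow>
     (\<forall>ds x. iter_partial ds \<phi> differentiable (at x)) \<and>
     (\<forall>ds k. bounded (range (\<lambda>x. (1 + norm x) ^ k *\<^sub>R iter_partial ds \<phi> x)))"

definition schwartz_norm :: "nat \<Rightarrow> (real^3 \<Rightarrow> complex) \<Rightarrow> real" where
  "schwartz_norm N \<phi> =
     (SUP (ds, x) \<in> {ds. length ds \<le> N} \<times> UNIV. (1 + norm x) ^ N * norm (iter_partial ds \<phi> x))"

text \<open>Distributions are functionals on all functions, of which only the values on Schwartz
  functions matter. The pairing is complex bilinear (no conjugation).\<close>

type_synonym distr = "(real^3 \<Rightarrow> complex) \<Rightarrow> complex"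

definition tempered_distribution :: "distr \<Rightarrow> bool" where
  "tempered_distribution T \<longleftrightarrow>
     (\<forall>\<phi> \<psi> a b. schwartz \<phi> \<longrightarrow> schwartz \<psi> \<longrightarrow>
        T (\<lambda>x. a * \<phi> x + b * \<psi> x) = a * T \<phi> + b * T \<psi>) \<and>
     (\<exists>C N. \<forall>\<phi>. schwartz \<phi> \<longrightarrow> norm (T \<phi>) \<le> C * schwartz_norm N \<phi>)"

definition dirac :: distr where
  "dirac \<phi> = \<phi> 0"

definition distr_laplacian :: "distr \<Rightarrow> distr" where
  "distr_laplacian T \<phi> = T (laplacian \<phi>)"

definition fourier :: "(real^3 \<Rightarrow> complex) \<Rightarrow> real^3 \<Rightarrow> complex" where
  "fourier \<psi> x = (LINT \<kappa>|lborel. exp (\<i> * complex_of_real (\<kappa> \<bullet> x)) * \<psi> \<kappa>)"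

definition distr_fourier :: "distr \<Rightarrow> distr" where
  "distr_fourier T \<psi> = T (fourier \<psi>)"

text \<open>The distribution \<open>T\<close> is given by the continuous function \<open>h\<close>. Continuity
  singles out one representative of the density, so that its pointwise values make sense.\<close>

definition is_continuous_density :: "distr \<Rightarrow> (real^3 \<Rightarrow> complex) \<Rightarrow> bool" where
  "is_continuous_density T h \<longleftrightarrow>
     continuous_on UNIV h \<and>
     (\<forall>\<psi>. schwartz \<psi> \<longrightarrow>
        integrable lborel (\<lambda>\<kappa>. h \<kappa> * \<psi> \<kappa>) \<and> T \<psi> = (LINT \<kappa>|lborel. h \<kappa> * \<psi> \<kappa>))"


section \<open>The Caputo derivative\<close>

definition time_deriv :: "nat \<Rightarrow> (real \<Rightarrow> complex) \<Rightarrow> real \<Rightarrow> complex" where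
  "time_deriv n = (\<lambda>u s. vector_derivative u (at s)) ^^ n"

text \<open>For \<open>n - 1 < \<gamma> < n\<close> the integer \<open>n\<close> is the ceiling of \<open>\<gamma>\<close>.\<close>

definition caputo_integrand :: "real \<Rightarrow> (real \<Rightarrow> complex) \<Rightarrow> real \<Rightarrow> real \<Rightarrow> complex" where
  "caputo_integrand \<gamma> u t \<tau> =
     time_deriv (nat \<lceil>\<gamma>\<rceil>) u \<tau> / complex_of_real ((t - \<tau>) powr (\<gamma> + 1 - real (nat \<lceil>\<gamma>\<rceil>)))"

definition caputo :: "real \<Rightarrow> (real \<Rightarrow> complex) \<Rightarrow> real \<Rightarrow> complex" where
  "caputo \<gamma> u t =
     (if \<gamma> \<in> \<nat> then time_deriv (nat \<lceil>\<gamma>\<rceil>) u t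
      else 1 / complex_of_real (Gamma (real (nat \<lceil>\<gamma>\<rceil>) - \<gamma>)) *
             (LINT \<tau>:{0<..<t}|lborel. caputo_integrand \<gamma> u t \<tau>))"

text \<open>The derivatives are only required at positive times: the highest one may have an integrable
  singularity at \<open>0\<close>, as it does for the fundamental solution of order \<open>1 < \<gamma> < 2\<close>.\<close>

definition caputo_differentiable :: "real \<Rightarrow> (real \<Rightarrow> complex) \<Rightarrow> bool" where
  "caputo_differentiable \<gamma> u \<longleftrightarrow>
     (\<forall>k<nat \<lceil>\<gamma>\<rceil>. \<forall>s>0. time_deriv k u differentiable (at s)) \<and>
     (\<gamma> \<notin> \<nat> \<longrightarrow> (\<forall>t>0. set_integrable lborel {0<..<t} (caputo_integrand \<gamma> u t)))"


section \<open>The fundamental solution\<close>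

text \<open>\<open>Q t\<close> is the distribution \<open>Q(\<cdot>,t)\<close>. Time derivatives of a distribution-valued
  function are taken weakly, that is, after pairing with a fixed test function. The one-sided
  derivative at \<open>0\<close> also makes the pairing continuous there, so the initial value is attained as
  a limit.\<close>

definition fundamental_solution ::
    "real \<Rightarrow> real \<Rightarrow> real \<Rightarrow> real \<Rightarrow> (real \<Rightarrow> distr) \<Rightarrow> bool" where
  "fundamental_solution \<alpha> \<beta> c D Q \<longleftrightarrow>
     (\<forall>t\<ge>0. tempered_distribution (Q t)) \<and>
     (\<forall>\<phi>. schwartz \<phi> \<longrightarrow>
        caputo_differentiable (\<alpha> + \<beta>) (\<lambda>t. Q t \<phi>) \<and>
        caputo_differentiable \<alpha> (\<lambda>t. Q t \<phi>) \<and>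
        (\<forall>t>0. complex_of_real (1 / c\<^sup>2) * caputo (\<alpha> + \<beta>) (\<lambda>s. Q s \<phi>) t
               + complex_of_real (1 / D) * caputo \<alpha> (\<lambda>s. Q s \<phi>) t
             = distr_laplacian (Q t) \<phi>) \<and>
        Q 0 \<phi> = dirac \<phi> \<and>
        ((\<lambda>t. Q t \<phi>) has_vector_derivative 0) (at 0 within {0..}))"


section \<open>The three-parameter Mittag-Leffler (Prabhakar) function\<close>

definition prabhakar :: "complex \<Rightarrow> complex \<Rightarrow> real \<Rightarrow> complex \<Rightarrow> complex" where
  "prabhakar a b \<zeta> z =
     (\<Sum>k. complex_of_real (pochhammer \<zeta> k) * z ^ k / (fact k * Gamma (a * of_nat k + b)))"

end

theory Submission
  imports Defs
begin

text \<open>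
  Write \<open>\<gamma> = \<alpha> + \<beta>\<close>, \<open>A = c\<^sup>2 / D\<close>, \<open>\<zeta> = c\<^sup>2 \<parallel>\<kappa>\<parallel>\<^sup>2\<close>, and let \<open>I\<^sup>\<sigma>\<close> be the
  Riemann--Liouville integral of order \<open>\<sigma>\<close> over \<open>(0, t)\<close>.

  \<^bold>\<open>Where the series comes from.\<close> On the Fourier side the Laplacian is multiplication by
  \<open>- \<parallel>\<kappa>\<parallel>\<^sup>2\<close>, so for each \<open>\<kappa>\<close> the transform \<open>f\<close> ought to solve a scalar Caputo equation with
  \<open>f(0) = 1\<close> and \<open>f'(0) = 0\<close>. The operator \<open>c\<^sup>2 I\<^sup>\<gamma>\<close> cancels the derivative of order \<open>\<gamma>\<close> and leaves
  \<open>I\<^sup>\<beta>\<close> of the one of order \<open>\<alpha>\<close>, which turns the equation into the Volterra equation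
  \<open>(f - 1) + A I\<^sup>\<beta> (f - 1) = - \<zeta> I\<^sup>\<gamma> f\<close>. Since \<open>I\<^sup>\<sigma>\<close> only shifts the index \<open>x\<close> of the monomial
  \<open>t\<^sup>x / \<Gamma>(x + 1)\<close>, the Neumann series \<open>\<Sum>\<^sub>m (- (A I\<^sup>\<beta> + \<zeta> I\<^sup>\<gamma>))\<^sup>m\<close> can be written down: the
  binomial theorem for the \<open>m\<close>-th power gives the second formula of the theorem, and collecting
  the terms with equal powers of \<open>\<zeta>\<close> gives the first one, because \<open>(n+1)\<^sub>k / k!\<close> is the binomial
  coefficient \<open>(n + k choose n)\<close>. The resulting function is \<open>relaxation\<close>.

  \<^bold>\<open>Why it is the transform of the distribution.\<close> The evolution equation is known only after pairing
  with a fixed test function, and nothing is assumed about how the pairings depend on the test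
  function uniformly in time. Three ideas bridge this gap.

  First, \<open>\<bar>f\<bar> \<le> 1\<close> (\<open>relaxation_bounded\<close>). The series by itself bounds \<open>f\<close> only by something that
  grows exponentially in a power of \<open>\<parallel>\<kappa>\<parallel>\<close>, which cannot be paired with a Schwartz function. The
  bound is an energy estimate: multiply the equation by \<open>f'\<close>, integrate, and use that \<open>I\<^sup>\<sigma>\<close> is
  positive semidefinite for \<open>0 < \<sigma> \<le> 1\<close> (\<open>rl_integral_positive\<close>).

  Second, uniqueness on test functions damped by a Gaussian. Let \<open>w\<^sub>n(t)\<close> be the difference between
  the pairings of the transform of \<open>Q t\<close> and of \<open>f\<close> with \<open>\<parallel>\<kappa>\<parallel>\<^sup>2\<^sup>n exp (- \<epsilon> \<parallel>\<kappa>\<parallel>\<^sup>2) \<psi>(\<kappa>)\<close>. These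
  differences satisfy \<open>w\<^sub>n = - A I\<^sup>\<beta> w\<^sub>n - c\<^sup>2 I\<^sup>\<gamma> w\<^sub>n\<^sub>+\<^sub>1\<close>. Passing from \<open>n\<close> to \<open>n + 1\<close> costs a factor
  of about \<open>n / \<epsilon>\<close> in the moments and gains one integral of order \<open>\<gamma> > 1\<close>, so that iteration forces
  \<open>w\<^sub>0 = 0\<close> (\<open>rl_hierarchy_zero\<close>). The moment bound has to hold uniformly for \<open>t\<close> in a compact
  interval. It follows from the Banach--Steinhaus theorem on the Banach space of bounded sequences
  \<open>a\<close>, applied to the functionals that pair with the mean of \<open>a\<close> under the Poisson distribution of
  parameter \<open>\<epsilon> \<parallel>\<kappa>\<parallel>\<^sup>2\<close>, times \<open>\<psi>\<close>: unit sequences produce exactly the damped moments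
  (\<open>gauss_moment_bound\<close>).

  Third, the same Poisson means control the limit \<open>\<epsilon> \<rightarrow> 0\<close>, which removes the damping
  (\<open>V_eq_integral\<close>), and concentrated Gaussians show that a continuous density is determined by its
  pairings (\<open>continuous_density_unique\<close>).
\<close>

section \<open>Riemann--Liouville fractional integrals\<close>

text \<open>Derivatives of Caputo type are Lebesgue integrals over open intervals, while the fundamental theorem
  of calculus is about gauge integrals over closed ones.\<close>

lemma set_integral_Ioo_eq_integral:
  fixes f :: "real \<Rightarrow> 'a::euclidean_space"
  assumes "set_integrable lborel {0<..<t} f"
  shows "f absolutely_integrable_on {0..t}" "(LINT s:{0<..<t}|lborel. f s) = integral {0..t} f"
proof -
  have "set_integrable lebesgue {0<..<t} f"
    using assms by (simp add: set_integrable_def integrable_completion borel_measurable_integrable)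
  then show "f absolutely_integrable_on {0..t}"
    by (simp add: absolutely_integrable_on_Icc_iff_Ioo)
  show "(LINT s:{0<..<t}|lborel. f s) = integral {0..t} f"
    using set_borel_integral_eq_integral(2)[OF assms] by (simp add: integral_open_interval_real)
qed

lemma set_integral_Ioo_continuous:
  fixes f :: "real \<Rightarrow> 'a::euclidean_space"
  assumes "continuous_on {0..t} f"
  shows "set_integrable lborel {0<..<t} f" "(LINT s:{0<..<t}|lborel. f s) = integral {0..t} f"
proof -
  show i: "set_integrable lborel {0<..<t} f"
    by (rule set_integrable_subset[OF borel_integrable_atLeastAtMost'[OF assms]]) auto
  show "(LINT s:{0<..<t}|lborel. f s) = integral {0..t} f"
    by (rule set_integral_Ioo_eq_integral(2)[OF i])
qed

text \<open>Vanishing outside \<open>0 < s < t\<close> lets all integrals run over the whole line, so that Fubini's theorem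
  applies without moving integration bounds.\<close>

definition rl_kernel :: "real \<Rightarrow> real \<Rightarrow> real \<Rightarrow> real" where
  "rl_kernel \<sigma> t s = (if 0 < s \<and> s < t then (t - s) powr (\<sigma> - 1) / Gamma \<sigma> else 0)"

text \<open>Order \<open>0\<close> is the identity. With this convention a Caputo derivative of integer order obeys the same
  formula as the others.\<close>

definition rl_integral :: "real \<Rightarrow> (real \<Rightarrow> 'a::{banach, second_countable_topology}) \<Rightarrow> real \<Rightarrow> 'a" where
  "rl_integral \<sigma> f t = (if \<sigma> = 0 then f t else (LINT s|lborel. rl_kernel \<sigma> t s *\<^sub>R f s))"

text \<open>The normalisation for which fractional integration of order \<open>\<sigma>\<close> takes index \<open>x\<close> to \<open>x + \<sigma>\<close>. As
  \<open>0 powr 0 = 0\<close>, index \<open>0\<close> gives the constant \<open>1\<close> only away from \<open>t = 0\<close>.\<close>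

definition rl_monomial :: "real \<Rightarrow> real \<Rightarrow> real" where
  "rl_monomial x t = t powr x / Gamma (x + 1)"

lemma rl_kernel_nonneg: "0 < \<sigma> \<Longrightarrow> 0 \<le> rl_kernel \<sigma> t s"
  by (auto simp: rl_kernel_def less_imp_le[OF Gamma_real_pos])

lemma measurable_rl_kernel [measurable (raw)]:
  assumes "f \<in> borel_measurable M" "g \<in> borel_measurable M"
  shows "(\<lambda>x. rl_kernel \<sigma> (f x) (g x)) \<in> borel_measurable M"
  using assms unfolding rl_kernel_def by measurable

lemma rl_kernel_bound:
  assumes "1 \<le> \<sigma>"
  shows "\<bar>rl_kernel \<sigma> t s\<bar> \<le> \<bar>t\<bar> powr (\<sigma> - 1) / Gamma \<sigma>"
proof -
  have "Gamma \<sigma> > 0" using assms by (intro Gamma_real_pos) auto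
  then show ?thesis
    using assms by (auto simp: rl_kernel_def intro!: divide_right_mono powr_mono2)
qed

text \<open>An affine substitution in Euler's Beta integral. Everything about compositions of fractional integrals
  rests on this computation.\<close>

lemma has_bochner_integral_Beta_interval:
  fixes r t a b :: real
  assumes "r < t" "a > 0" "b > 0"
  shows "has_bochner_integral lborel
           (\<lambda>s. indicator {r<..<t} s * ((t - s) powr (a - 1) / Gamma a * ((s - r) powr (b - 1) / Gamma b)))
           ((t - r) powr (a + b - 1) / Gamma (a + b))"
proof -
  let ?f = "\<lambda>s. s powr (b - 1) * (1 - s) powr (a - 1)"
  let ?g = "\<lambda>s. indicator {0..1} (- r / (t - r) + (1 / (t - r)) * s) * ?f (- r / (t - r) + (1 / (t - r)) * s)"
  have pos: "Gamma a > 0" "Gamma b > 0" "Gamma (a + b) > 0"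
    using assms by (auto intro!: Gamma_real_pos)
  have int: "set_integrable lborel {0..1} ?f"
    using integrable_Beta[of b a] assms by (simp add: mult.commute)
  have "(?f has_integral Beta b a) {0..1}"
    using has_integral_Beta_real[of b a] assms by simp
  then have val: "(LINT s:{0..1}|lborel. ?f s) = Beta b a"
    using set_borel_integral_eq_integral(2)[OF int] by (simp add: integral_unique)
  have "has_bochner_integral lborel (\<lambda>s. indicator {0..1} s * ?f s) (Beta b a)"
    using int val by (simp add: has_bochner_integral_iff set_integrable_def set_lebesgue_integral_def)
  then have "has_bochner_integral lborel ?g (Beta b a /\<^sub>R \<bar>1 / (t - r)\<bar>)"
    using assms by (subst lborel_has_bochner_integral_real_affine_iff[of "1 / (t - r)" _ _ "- r / (t - r)", symmetric]) auto
  then have "has_bochner_integral lborel (\<lambda>s. (t - r) powr (a + b - 2) / (Gamma a * Gamma b) * ?g s)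
     ((t - r) powr (a + b - 2) / (Gamma a * Gamma b) * (Beta b a /\<^sub>R \<bar>1 / (t - r)\<bar>))"
    by (intro has_bochner_integral_mult_right)
  also have "(t - r) powr (a + b - 2) / (Gamma a * Gamma b) * (Beta b a /\<^sub>R \<bar>1 / (t - r)\<bar>) =
    (t - r) powr (a + b - 1) / Gamma (a + b)"
  proof -
    have "(t - r) powr (a + b - 1) = (t - r) powr (a + b - 2) * (t - r)"
      using assms powr_add[of "t - r" "a + b - 2" 1] by simp
    moreover have "Beta b a = Gamma a * Gamma b / Gamma (a + b)"
      by (simp add: Beta_def add.commute)
    moreover have "inverse \<bar>1 / (t - r)\<bar> = t - r" using assms by simp
    ultimately show ?thesis using pos by simp
  qed
  finally have *: "has_bochner_integral lborel (\<lambda>s. (t - r) powr (a + b - 2) / (Gamma a * Gamma b) * ?g s)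
     ((t - r) powr (a + b - 1) / Gamma (a + b))" .
  have eq: "(t - r) powr (a + b - 2) / (Gamma a * Gamma b) * ?g s
    = indicator {r<..<t} s * ((t - s) powr (a - 1) / Gamma a * ((s - r) powr (b - 1) / Gamma b))" for s
  proof -
    have e: "- r / (t - r) + (1 / (t - r)) * s = (s - r) / (t - r)"
      by (simp add: diff_divide_distrib)
    have e2: "1 - (s - r) / (t - r) = (t - s) / (t - r)"
      using assms by (simp add: field_simps)
    have "(t - r) powr (a + b - 2) = (t - r) powr (a - 1) * (t - r) powr (b - 1)"
      by (simp flip: powr_add)
    then show ?thesis
      using assms unfolding e e2
      by (cases "s = r"; cases "s = t")
         (auto simp: indicator_def powr_divide divide_simps)
  qed
  show ?thesis using * unfolding eq .
qed

text \<open>The semigroup law at the level of kernels; both sides vanish unless \<open>0 < r < t\<close>.\<close>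

lemma rl_kernel_convolution:
  assumes "a > 0" "b > 0"
  shows "has_bochner_integral lborel (\<lambda>s. rl_kernel a t s * rl_kernel b s r) (rl_kernel (a + b) t r)"
proof (cases "0 < r \<and> r < t")
  case True
  have "(\<lambda>s. rl_kernel a t s * rl_kernel b s r) = (\<lambda>s. indicator {r<..<t} s * ((t - s) powr (a - 1) / Gamma a * ((s - r) powr (b - 1) / Gamma b)))"
    using True by (auto simp: rl_kernel_def fun_eq_iff indicator_def)
  then show ?thesis
    using has_bochner_integral_Beta_interval[of r t a b] True assms by (simp add: rl_kernel_def)
next
  case False
  then have "(\<lambda>s. rl_kernel a t s * rl_kernel b s r) = (\<lambda>s. 0)" "rl_kernel (a + b) t r = 0"
    by (auto simp: rl_kernel_def fun_eq_iff)
  then show ?thesis by (simp add: has_bochner_integral_zero)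
qed

lemma rl_kernel_monomial:
  assumes "a > 0" "x > -1" "t \<ge> 0" "x + a \<noteq> 0"
  shows "has_bochner_integral lborel (\<lambda>s. rl_kernel a t s * rl_monomial x s) (rl_monomial (x + a) t)"
proof (cases "t = 0")
  case True
  then have "(\<lambda>s. rl_kernel a t s * rl_monomial x s) = (\<lambda>s. 0)"
    by (auto simp: rl_kernel_def fun_eq_iff)
  then show ?thesis using True by (simp only:) (simp add: rl_monomial_def has_bochner_integral_zero)
next
  case False
  have "(\<lambda>s. rl_kernel a t s * rl_monomial x s) = (\<lambda>s. indicator {0<..<t} s * ((t - s) powr (a - 1) / Gamma a * ((s - 0) powr ((x + 1) - 1) / Gamma (x + 1))))"
    by (auto simp: rl_kernel_def rl_monomial_def fun_eq_iff indicator_def)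
  then show ?thesis
    using has_bochner_integral_Beta_interval[of 0 t a "x + 1"] assms False
    by (simp add: rl_monomial_def add_ac)
qed

lemma rl_kernel_integrable:
  assumes "\<sigma> > 0" shows "integrable lborel (rl_kernel \<sigma> t)"
proof (cases "t > 0")
  case True
  have "(\<lambda>s. rl_kernel \<sigma> t s * rl_monomial 0 s) = rl_kernel \<sigma> t"
    by (auto simp: rl_kernel_def rl_monomial_def fun_eq_iff)
  then show ?thesis
    using rl_kernel_monomial[of \<sigma> 0 t] assms True by (simp add: has_bochner_integral_iff)
next
  case False
  then have "rl_kernel \<sigma> t = (\<lambda>s. 0)" by (auto simp: rl_kernel_def)
  then show ?thesis by simp
qed

lemma rl_integral_cong:
  assumes "\<And>s. 0 < s \<Longrightarrow> s < t \<Longrightarrow> f s = g s" "\<sigma> \<noteq> 0"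
  shows "rl_integral \<sigma> f t = rl_integral \<sigma> g t"
  unfolding rl_integral_def using assms
  by (auto intro!: Bochner_Integration.integral_cong simp: rl_kernel_def)

lemma rl_kernel_scaleR_integrable:
  fixes f :: "real \<Rightarrow> 'a::{banach, second_countable_topology}"
  assumes "\<sigma> > 0" "set_borel_measurable borel {0<..<t} f" "\<And>s. 0 < s \<Longrightarrow> s < t \<Longrightarrow> norm (f s) \<le> B"
  shows "integrable lborel (\<lambda>s. rl_kernel \<sigma> t s *\<^sub>R f s)"
proof (rule Bochner_Integration.integrable_bound)
  show "integrable lborel (\<lambda>s. B * rl_kernel \<sigma> t s)"
    using rl_kernel_integrable[OF assms(1)] by simp
  have "(\<lambda>s. rl_kernel \<sigma> t s *\<^sub>R f s) = (\<lambda>s. rl_kernel \<sigma> t s *\<^sub>R (indicator {0<..<t} s *\<^sub>R f s))"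
    by (auto simp: fun_eq_iff rl_kernel_def)
  also have "\<dots> \<in> borel_measurable lborel"
    using assms(2) unfolding set_borel_measurable_def by measurable
  finally show "(\<lambda>s. rl_kernel \<sigma> t s *\<^sub>R f s) \<in> borel_measurable lborel" .
  show "AE s in lborel. norm (rl_kernel \<sigma> t s *\<^sub>R f s) \<le> norm (B * rl_kernel \<sigma> t s)"
  proof (intro AE_I2)
    fix s
    show "norm (rl_kernel \<sigma> t s *\<^sub>R f s) \<le> norm (B * rl_kernel \<sigma> t s)"
    proof (cases "0 < s \<and> s < t")
      case True
      then have "norm (f s) \<le> \<bar>B\<bar>" using assms(3)[of s] by auto
      then show ?thesis by (simp add: abs_mult mult.commute mult_right_mono)
    qed (auto simp: rl_kernel_def)
  qed
qed

text \<open>Fubini on the triangle \<open>0 < r < s < t\<close>. The condition \<open>a + b \<ge> 1\<close> makes the composed kernel bounded,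
  hence the double integral absolutely convergent for every \<open>t\<close>, and not only for almost every one;
  the function \<open>f\<close> may therefore have an integrable singularity at \<open>0\<close>. The second conclusion is a
  by-product of Fubini's theorem: the outer integrand is integrable.\<close>

lemma rl_integral_semigroup:
  fixes f :: "real \<Rightarrow> 'a::{banach, second_countable_topology}"
  assumes a: "a > 0" and b: "b > 0" and ab: "a + b \<ge> 1" and f: "set_integrable lborel {0<..<t} f"
  shows "rl_integral a (rl_integral b f) t = rl_integral (a + b) f t"
    and "integrable lborel (\<lambda>s. rl_kernel a t s *\<^sub>R rl_integral b f s)"
proof -
  define f0 where "f0 = (\<lambda>r. indicator {0<..<t} r *\<^sub>R f r)"
  have f0: "integrable lborel f0"
    using f by (simp add: set_integrable_def f0_def)
  then have f0m [measurable]: "f0 \<in> borel_measurable borel"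
    using borel_measurable_integrable by force
  define G where "G = (\<lambda>(r, s). (rl_kernel a t s * rl_kernel b s r) *\<^sub>R f0 r)"
  have Gm: "G \<in> borel_measurable (lborel \<Otimes>\<^sub>M lborel)"
    unfolding G_def by measurable
  have inner: "has_bochner_integral lborel (\<lambda>s. G (r, s)) (rl_kernel (a + b) t r *\<^sub>R f0 r)" for r
    unfolding G_def using has_bochner_integral_scaleR_left[OF rl_kernel_convolution[OF a b, of t r], of "f0 r"]
    by simp
  have innern: "has_bochner_integral lborel (\<lambda>s. norm (G (r, s))) (rl_kernel (a + b) t r * norm (f0 r))" for r
  proof -
    have "(\<lambda>s. norm (G (r, s))) = (\<lambda>s. (rl_kernel a t s * rl_kernel b s r) * norm (f0 r))"
      by (auto simp: G_def fun_eq_iff abs_mult abs_of_nonneg rl_kernel_nonneg a b)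
    then show ?thesis
      using has_bochner_integral_mult_left[OF rl_kernel_convolution[OF a b, of t r], of "norm (f0 r)"]
      by auto
  qed
  have "integrable lborel (\<lambda>r. rl_kernel (a + b) t r * norm (f0 r))"
  proof (rule Bochner_Integration.integrable_bound)
    show "integrable lborel (\<lambda>r. (\<bar>t\<bar> powr (a + b - 1) / Gamma (a + b)) * norm (f0 r))"
      using f0 by simp
    show "AE x in lborel. norm (rl_kernel (a + b) t x * norm (f0 x)) \<le> norm (\<bar>t\<bar> powr (a + b - 1) / Gamma (a + b) * norm (f0 x))"
    proof (intro AE_I2)
      fix x
      have "norm (rl_kernel (a + b) t x * norm (f0 x)) \<le> \<bar>t\<bar> powr (a + b - 1) / Gamma (a + b) * norm (f0 x)"
        using mult_right_mono[OF rl_kernel_bound[OF ab, of t x], of "norm (f0 x)"] by (simp add: abs_mult)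
      then show "norm (rl_kernel (a + b) t x * norm (f0 x)) \<le> norm (\<bar>t\<bar> powr (a + b - 1) / Gamma (a + b) * norm (f0 x))"
        by (simp only: real_norm_def)
    qed
  qed auto
  then have GI: "integrable (lborel \<Otimes>\<^sub>M lborel) G"
    by (intro lborel_pair.Fubini_integrable Gm)
       (use inner innern in \<open>auto simp: has_bochner_integral_iff\<close>)
  have sw: "(LINT r|lborel. G (r, s)) = rl_kernel a t s *\<^sub>R rl_integral b f s" for s
  proof -
    have "(LINT r|lborel. G (r, s)) = (LINT r|lborel. rl_kernel a t s *\<^sub>R (rl_kernel b s r *\<^sub>R f r))"
      by (intro Bochner_Integration.integral_cong) (auto simp: G_def f0_def rl_kernel_def)
    also have "\<dots> = rl_kernel a t s *\<^sub>R (LINT r|lborel. rl_kernel b s r *\<^sub>R f r)"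
      by (rule Bochner_Integration.integral_scaleR_right)
    finally show ?thesis using b by (simp add: rl_integral_def)
  qed
  have GI': "integrable (lborel \<Otimes>\<^sub>M lborel) (case_prod (\<lambda>r s. G (r, s)))"
    using GI by simp
  show "integrable lborel (\<lambda>s. rl_kernel a t s *\<^sub>R rl_integral b f s)"
    using lborel_pair.integrable_snd[OF GI'] by (simp add: sw)
  have "rl_integral a (rl_integral b f) t = (LINT s|lborel. (LINT r|lborel. G (r, s)))"
    using a unfolding sw by (simp add: rl_integral_def)
  also have "\<dots> = (LINT r|lborel. (LINT s|lborel. G (r, s)))"
    using lborel_pair.Fubini_integral[OF GI'] by simp
  also have "\<dots> = (LINT r|lborel. rl_kernel (a + b) t r *\<^sub>R f0 r)"
    using inner by (simp add: has_bochner_integral_iff)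
  also have "\<dots> = rl_integral (a + b) f t"
    using a b by (auto simp: rl_integral_def f0_def rl_kernel_def intro!: Bochner_Integration.integral_cong)
  finally show "rl_integral a (rl_integral b f) t = rl_integral (a + b) f t" .
qed

text \<open>Enlarging the interval to \<open>(-\<infinity>, t)\<close> and substituting \<open>u = \<mu> (t - s)\<close> leaves the Gamma
  integral. In the norm with weight \<open>exp (- \<mu> t)\<close> the integral of order \<open>\<sigma>\<close> thus has norm at most
  \<open>\<mu> powr (- \<sigma>)\<close>; this is how all smallness is obtained below.\<close>

lemma rl_kernel_exp_bound:
  assumes "\<sigma> > 0" "\<mu> > 0"
  shows "integrable lborel (\<lambda>s. rl_kernel \<sigma> t s * exp (\<mu> * s))"
    and "(LINT s|lborel. rl_kernel \<sigma> t s * exp (\<mu> * s)) \<le> exp (\<mu> * t) * \<mu> powr (- \<sigma>)"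
proof -
  let ?g = "\<lambda>s. indicator {0..} (\<mu> * t + (-\<mu>) * s) * (\<mu> * t + (-\<mu>) * s) powr (\<sigma> - 1) / exp (\<mu> * t + (-\<mu>) * s)"
  let ?N = "\<integral>\<^sup>+s. ennreal (?g s) \<partial>lborel"
  let ?c = "exp (\<mu> * t) * \<mu> powr (1 - \<sigma>) / Gamma \<sigma>"
  have pos: "Gamma \<sigma> > 0" using assms by (auto intro!: Gamma_real_pos)
  show I: "integrable lborel (\<lambda>s. rl_kernel \<sigma> t s * exp (\<mu> * s))"
  proof (rule rl_kernel_scaleR_integrable[of \<sigma> t "\<lambda>s. exp (\<mu> * s)" "exp (\<mu> * t)", simplified real_scaleR_def])
    show "set_borel_measurable borel {0<..<t} (\<lambda>s. exp (\<mu> * s))"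
      unfolding set_borel_measurable_def by measurable
  qed (use assms in auto)
  have nn: "(\<integral>\<^sup>+u. ennreal (indicator {0..} u * u powr (\<sigma> - 1) / exp u) \<partial>lborel) = ennreal (Gamma \<sigma>)"
    using Gamma_conv_nn_integral_real[OF assms(1)] by simp
  have "(\<integral>\<^sup>+s. ennreal (rl_kernel \<sigma> t s * exp (\<mu> * s)) \<partial>lborel)
     \<le> (\<integral>\<^sup>+s. ennreal ?c * ennreal (?g s) \<partial>lborel)"
  proof (intro nn_integral_mono)
    fix s :: real
    have c: "?c \<ge> 0" using pos by simp
    show "ennreal (rl_kernel \<sigma> t s * exp (\<mu> * s)) \<le> ennreal ?c * ennreal (?g s)"
    proof (cases "0 < s \<and> s < t")
      case True
      have e: "\<mu> * t + (-\<mu>) * s = \<mu> * (t - s)" by (simp add: algebra_simps)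
      have "indicator {0..} (\<mu> * (t - s)) = (1::real)" using True assms by auto
      moreover have "(\<mu> * (t - s)) powr (\<sigma> - 1) = \<mu> powr (\<sigma> - 1) * (t - s) powr (\<sigma> - 1)"
        using True assms by (simp add: powr_mult)
      moreover have "\<mu> powr (1 - \<sigma>) * \<mu> powr (\<sigma> - 1) = 1"
        using assms by (simp flip: powr_add)
      moreover have "exp (\<mu> * s) = exp (\<mu> * t) / exp (\<mu> * (t - s))"
        by (simp add: algebra_simps flip: exp_diff)
      ultimately have "rl_kernel \<sigma> t s * exp (\<mu> * s) = (exp (\<mu> * t) * \<mu> powr (1 - \<sigma>) / Gamma \<sigma>) * (indicator {0..} (\<mu> * (t - s)) * (\<mu> * (t - s)) powr (\<sigma> - 1) / exp (\<mu> * (t - s)))"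
        using True by (simp add: rl_kernel_def)
      then show ?thesis unfolding e using c by (subst ennreal_mult'[symmetric]) auto
    qed (auto simp: rl_kernel_def)
  qed
  also have "\<dots> = ennreal ?c * ?N"
    by (rule nn_integral_cmult) measurable
  also have "?N = ennreal (Gamma \<sigma> / \<mu>)"
  proof -
    have "ennreal (Gamma \<sigma>) = ennreal \<bar>- \<mu>\<bar> * ?N"
      unfolding nn[symmetric] using assms by (intro nn_integral_real_affine) auto
    then have "ennreal (1 / \<mu>) * ennreal (Gamma \<sigma>) = ennreal (1 / \<mu>) * (ennreal \<mu> * ?N)"
      using assms by simp
    also have "\<dots> = ?N"
      using assms by (simp add: mult.assoc[symmetric] flip: ennreal_mult)
    finally show ?thesis using assms pos by (simp flip: ennreal_mult)
  qed
  also have "ennreal ?c * ennreal (Gamma \<sigma> / \<mu>) = ennreal (exp (\<mu> * t) * \<mu> powr (- \<sigma>))"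
  proof -
    have "\<mu> powr (1 - \<sigma>) = \<mu> powr (- \<sigma>) * \<mu>"
      using assms powr_add[of \<mu> "-\<sigma>" 1] by simp
    then show ?thesis using assms less_imp_neq[OF pos] by (simp flip: ennreal_mult)
  qed
  finally have "(\<integral>\<^sup>+s. ennreal (rl_kernel \<sigma> t s * exp (\<mu> * s)) \<partial>lborel) \<le> ennreal (exp (\<mu> * t) * \<mu> powr (- \<sigma>))" .
  moreover have "(\<integral>\<^sup>+s. ennreal (rl_kernel \<sigma> t s * exp (\<mu> * s)) \<partial>lborel) = ennreal (LINT s|lborel. rl_kernel \<sigma> t s * exp (\<mu> * s))"
    using I assms by (intro nn_integral_eq_integral) (auto simp: rl_kernel_nonneg)
  ultimately show "(LINT s|lborel. rl_kernel \<sigma> t s * exp (\<mu> * s)) \<le> exp (\<mu> * t) * \<mu> powr (- \<sigma>)"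
    using assms by (simp add: ennreal_le_iff)
qed

lemma rl_integral_exp_bound:
  fixes f :: "real \<Rightarrow> 'a::{banach, second_countable_topology}"
  assumes "\<sigma> > 0" "\<mu> > 0" "\<And>s. 0 < s \<Longrightarrow> s < t \<Longrightarrow> norm (f s) \<le> B * exp (\<mu> * s)" "0 \<le> B"
  shows "norm (rl_integral \<sigma> f t) \<le> B * \<mu> powr (- \<sigma>) * exp (\<mu> * t)"
proof -
  have "norm (rl_integral \<sigma> f t) \<le> (LINT s|lborel. B * (rl_kernel \<sigma> t s * exp (\<mu> * s)))"
  proof (cases "integrable lborel (\<lambda>s. rl_kernel \<sigma> t s *\<^sub>R f s)")
    case True
    have "norm (LINT s|lborel. rl_kernel \<sigma> t s *\<^sub>R f s) \<le> (LINT s|lborel. B * (rl_kernel \<sigma> t s * exp (\<mu> * s)))"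
    proof (intro order.trans[OF integral_norm_bound] integral_mono)
      show "integrable lborel (\<lambda>s. norm (rl_kernel \<sigma> t s *\<^sub>R f s))"
        using True by (rule integrable_norm)
      show "integrable lborel (\<lambda>s. B * (rl_kernel \<sigma> t s * exp (\<mu> * s)))"
        using rl_kernel_exp_bound(1)[of \<sigma> \<mu> t] assms by simp
      fix s
      show "norm (rl_kernel \<sigma> t s *\<^sub>R f s) \<le> B * (rl_kernel \<sigma> t s * exp (\<mu> * s))"
      proof (cases "0 < s \<and> s < t")
        case True
        then show ?thesis
          using mult_left_mono[OF assms(3)[of s] rl_kernel_nonneg[OF assms(1), of t s]] assms(1)
          by (simp add: rl_kernel_nonneg mult_ac)
      qed (auto simp: rl_kernel_def)
    qed
    then show ?thesis using assms by (simp add: rl_integral_def)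
  next
    case False
    then have "rl_integral \<sigma> f t = 0"
      using assms by (simp add: rl_integral_def not_integrable_integral_eq)
    then show ?thesis using assms by (auto intro!: Bochner_Integration.integral_nonneg mult_nonneg_nonneg rl_kernel_nonneg)
  qed
  also have "\<dots> \<le> B * (exp (\<mu> * t) * \<mu> powr (- \<sigma>))"
    using rl_kernel_exp_bound(2)[of \<sigma> \<mu> t] assms by (simp add: mult_left_mono)
  finally show ?thesis by (simp add: mult_ac)
qed

text \<open>The monomial is the fractional integral of order \<open>x\<close> of the constant \<open>1 \<le> exp (\<mu> s)\<close>. This bound
  replaces Stirling's formula in all convergence proofs.\<close>

lemma rl_monomial_bound:
  assumes "x > 0" "\<mu> > 0" "t \<ge> 0"
  shows "rl_monomial x t \<le> exp (\<mu> * t) * \<mu> powr (- x)"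
proof -
  have "rl_monomial x t = (LINT s|lborel. rl_kernel x t s * rl_monomial 0 s)"
    using rl_kernel_monomial[of x 0 t] assms by (simp add: has_bochner_integral_iff)
  also have "\<dots> \<le> (LINT s|lborel. rl_kernel x t s * exp (\<mu> * s))"
    using rl_kernel_monomial[of x 0 t] rl_kernel_exp_bound(1)[of x \<mu> t] assms
    by (intro integral_mono) (auto simp: has_bochner_integral_iff rl_kernel_def rl_monomial_def less_imp_le[OF Gamma_real_pos]
          intro!: divide_right_mono mult_left_mono)
  also have "\<dots> \<le> exp (\<mu> * t) * \<mu> powr (- x)"
    using rl_kernel_exp_bound(2)[of x \<mu> t] assms by simp
  finally show ?thesis .
qed

text \<open>In the weighted norm with rate \<open>\<mu>\<close> the term with \<open>I\<^sup>\<beta>\<close> is absorbed as soon as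
  \<open>A \<mu> powr (- \<beta>) \<le> 1/2\<close>, and each passage from \<open>w n\<close> to \<open>w (n + 1)\<close> gains a factor
  \<open>2 C \<mu> powr (- \<gamma>)\<close>. After \<open>j\<close> passages the moment bound costs \<open>j! K\<^sup>j\<close>. Choosing the rate \<open>\<mu> = j\<close>
  makes the total at most \<open>(const \<cdot> j powr (1 - \<gamma>))\<^sup>j\<close>, the weight contributing only \<open>exp (j T)\<close>, and
  this tends to \<open>0\<close> because \<open>\<gamma> > 1\<close>.\<close>

lemma rl_hierarchy_zero:
  fixes w :: "nat \<Rightarrow> real \<Rightarrow> 'a::{banach, second_countable_topology}"
  assumes \<beta>: "0 < \<beta>" and \<gamma>: "1 < \<gamma>" and nonneg: "0 \<le> A" "0 \<le> C" "0 \<le> K" "0 \<le> M"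
    and eq: "\<And>n t. 0 \<le> t \<Longrightarrow> t \<le> T \<Longrightarrow> w n t = - (A *\<^sub>R rl_integral \<beta> (w n) t) - C *\<^sub>R rl_integral \<gamma> (w (Suc n)) t"
    and bd: "\<And>n t. 0 \<le> t \<Longrightarrow> t \<le> T \<Longrightarrow> norm (w n t) \<le> M * fact n * K ^ n"
    and t: "0 \<le> t" "t \<le> T"
  shows "w 0 t = 0"
proof -
  have iter: "norm (w n t) \<le> (2 * C * \<mu> powr (- \<gamma>)) ^ j * (M * fact (n + j) * K ^ (n + j)) * exp (\<mu> * t)"
    if \<mu>: "\<mu> > 0" "A * \<mu> powr (- \<beta>) \<le> 1 / 2" and t: "0 \<le> t" "t \<le> T" for \<mu> j n t
    using t
  proof (induction j arbitrary: n t)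
    case 0
    have "norm (w n t) \<le> M * fact n * K ^ n * 1" using bd[OF 0, of n] by simp
    also have "\<dots> \<le> M * fact n * K ^ n * exp (\<mu> * t)"
      using 0 \<mu> nonneg by (intro mult_left_mono) auto
    finally show ?case by simp
  next
    case (Suc j)
    define R where "R = (2 * C * \<mu> powr (- \<gamma>)) ^ j * (M * fact (Suc n + j) * K ^ (Suc n + j))"
    have R: "R \<ge> 0" using nonneg by (simp add: R_def)
    have wR: "norm (w (Suc n) s) \<le> R * exp (\<mu> * s)" if "0 \<le> s" "s \<le> T" for s
      using Suc.IH[OF that, of "Suc n"] by (simp add: R_def)
    define X where "X = (SUP s\<in>{0..T}. norm (w n s) * exp (- (\<mu> * s)))"
    have bdd: "bdd_above ((\<lambda>s. norm (w n s) * exp (- (\<mu> * s))) ` {0..T})"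
    proof (rule bdd_aboveI2)
      fix s assume "s \<in> {0..T}"
      then show "norm (w n s) * exp (- (\<mu> * s)) \<le> M * fact n * K ^ n * 1"
        using bd[of s n] \<mu> nonneg by (intro mult_mono) auto
    qed
    have wX: "norm (w n s) \<le> X * exp (\<mu> * s)" if "0 \<le> s" "s \<le> T" for s
    proof -
      have "norm (w n s) * exp (- (\<mu> * s)) \<le> X"
        unfolding X_def using that bdd by (intro cSUP_upper) auto
      then show ?thesis by (simp add: exp_minus field_simps)
    qed
    have X0: "X \<ge> 0"
      using wX[of 0] Suc.prems by (simp, smt (verit) norm_ge_zero)
    \<comment> \<open>\<open>X\<close> is the weighted norm of \<open>w n\<close>; the equation bounds it by half of itself plus a gain.\<close>
    have "X \<le> X / 2 + C * R * \<mu> powr (- \<gamma>)"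
      unfolding X_def
    proof (rule cSUP_least)
      fix s assume s: "s \<in> {0..T}"
      have "norm (w n s) \<le> A * norm (rl_integral \<beta> (w n) s) + C * norm (rl_integral \<gamma> (w (Suc n)) s)"
        using eq[of s n] s nonneg norm_triangle_ineq4[of "- (A *\<^sub>R rl_integral \<beta> (w n) s)" "C *\<^sub>R rl_integral \<gamma> (w (Suc n)) s"]
        by simp
      also have "\<dots> \<le> A * (X * \<mu> powr (- \<beta>) * exp (\<mu> * s)) + C * (R * \<mu> powr (- \<gamma>) * exp (\<mu> * s))"
        using s X0 R \<beta> \<gamma> \<mu> nonneg wX wR
        by (intro add_mono mult_left_mono rl_integral_exp_bound) auto
      also have "\<dots> = ((A * \<mu> powr (- \<beta>)) * X + C * R * \<mu> powr (- \<gamma>)) * exp (\<mu> * s)"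
        by (simp add: algebra_simps)
      also have "\<dots> \<le> ((1 / 2) * X + C * R * \<mu> powr (- \<gamma>)) * exp (\<mu> * s)"
        using \<mu> X0 by (intro mult_right_mono add_right_mono) auto
      finally have "norm (w n s) * exp (- (\<mu> * s)) \<le> X / 2 + C * R * \<mu> powr (- \<gamma>)"
        by (simp add: exp_minus field_simps)
      then show "norm (w n s) * exp (- (\<mu> * s)) \<le> (SUP s\<in>{0..T}. norm (w n s) * exp (- (\<mu> * s))) / 2 + C * R * \<mu> powr (- \<gamma>)"
        by (simp add: X_def)
    qed (use Suc.prems in auto)
    then have "X \<le> 2 * (C * R * \<mu> powr (- \<gamma>))" by linarith
    then have "X \<le> 2 * C * \<mu> powr (- \<gamma>) * R" by (simp only: mult_ac)
    then have "norm (w n t) \<le> (2 * C * \<mu> powr (- \<gamma>) * R) * exp (\<mu> * t)"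
      using wX[OF Suc.prems] by (meson exp_ge_zero mult_right_mono order_trans)
    then show ?case by (simp add: R_def mult_ac)
  qed
  \<comment> \<open>The rate is \<open>j\<close> after \<open>j\<close> passages, and \<open>j!\<close> is at most \<open>j\<^sup>j\<close>.\<close>
  define x where "x = (\<lambda>j::nat. 2 * C * K * exp T * real j powr (1 - \<gamma>))"
  have bound: "norm (w 0 t) \<le> M * x j ^ j" if j: "j > 0" "A * real j powr (- \<beta>) \<le> 1 / 2" for j
  proof -
    have "norm (w 0 t) \<le> (2 * C * real j powr (- \<gamma>)) ^ j * (M * fact j * K ^ j) * exp (real j * t)"
      using iter[of "real j" t 0 j] j t by simp
    also have "\<dots> \<le> (2 * C * real j powr (- \<gamma>)) ^ j * (M * real j ^ j * K ^ j) * exp T ^ j"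
    proof (intro mult_mono mult_nonneg_nonneg mult_left_mono mult_right_mono)
      show "(fact j::real) \<le> real j ^ j" by (metis fact_le_power order_refl of_nat_fact of_nat_power)
      show "exp (real j * t) \<le> exp T ^ j"
        using t by (simp add: exp_of_nat_mult[symmetric] mult_left_mono)
    qed (use nonneg in auto)
    also have "\<dots> = M * (2 * C * K * exp T * (real j powr (- \<gamma>) * real j)) ^ j"
      by (simp add: power_mult_distrib mult_ac)
    also have "real j powr (- \<gamma>) * real j = real j powr (1 - \<gamma>)"
      using j powr_add[of "real j" "-\<gamma>" 1] by simp
    finally show ?thesis by (simp add: x_def)
  qed
  have lim1: "(\<lambda>j. A * real j powr (- \<beta>)) \<longlonglongrightarrow> A * 0"
    using \<beta> by (intro tendsto_intros tendsto_neg_powr filterlim_real_sequentially) auto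
  have lim2: "x \<longlonglongrightarrow> 2 * C * K * exp T * 0"
    unfolding x_def using \<gamma> by (intro tendsto_intros tendsto_neg_powr filterlim_real_sequentially) auto
  have ev1: "\<forall>\<^sub>F j in sequentially. A * real j powr (- \<beta>) < 1 / 2"
    using lim1 by (rule order_tendstoD) auto
  have ev2: "\<forall>\<^sub>F j in sequentially. x j < 1 / 2"
    using lim2 by (rule order_tendstoD) auto
  have "\<forall>\<^sub>F j in sequentially. norm (w 0 t) \<le> M * (1 / 2) ^ j"
    using ev1 ev2 eventually_gt_at_top[of 0]
  proof eventually_elim
    case (elim j)
    have "x j \<ge> 0" using nonneg by (simp add: x_def)
    then have "M * x j ^ j \<le> M * (1 / 2) ^ j"
      using elim nonneg by (intro mult_left_mono power_mono) auto
    then show ?case using bound[of j] elim by auto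
  qed
  moreover have "(\<lambda>j. M * (1 / 2) ^ j) \<longlonglongrightarrow> M * 0"
    by (intro tendsto_intros LIMSEQ_power_zero) auto
  ultimately have "norm (w 0 t) \<le> M * 0"
    by (intro tendsto_lowerbound) auto
  then show ?thesis by simp
qed

section \<open>From the Caputo equation to a Volterra equation\<close>

lemma time_deriv_simps:
  "time_deriv 0 u = u"
  "time_deriv (Suc 0) u = (\<lambda>s. vector_derivative u (at s))"
  "time_deriv 2 u = (\<lambda>s. vector_derivative (time_deriv (Suc 0) u) (at s))"
  by (simp_all add: time_deriv_def numeral_2_eq_2)

lemma nat_ceiling_not_Nats:
  assumes "\<gamma> > 0" "\<gamma> \<notin> \<nat>"
  shows "\<gamma> < real (nat \<lceil>\<gamma>\<rceil>)"
proof -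
  have "\<gamma> \<le> real (nat \<lceil>\<gamma>\<rceil>)" by (rule real_nat_ceiling_ge)
  moreover have "\<gamma> \<noteq> real (nat \<lceil>\<gamma>\<rceil>)" using assms by (metis of_nat_in_Nats)
  ultimately show ?thesis by simp
qed

text \<open>For integer order the ceiling is the order itself, and the formula holds because \<open>rl_integral 0\<close> is the
  identity.\<close>

lemma caputo_eq_rl_integral:
  assumes "\<gamma> > 0"
  shows "caputo \<gamma> u t = rl_integral (real (nat \<lceil>\<gamma>\<rceil>) - \<gamma>) (time_deriv (nat \<lceil>\<gamma>\<rceil>) u) t"
proof (cases "\<gamma> \<in> \<nat>")
  case True
  then have "real (nat \<lceil>\<gamma>\<rceil>) = \<gamma>" by (auto elim!: Nats_cases)
  then show ?thesis using True by (simp add: caputo_def rl_integral_def)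
next
  case False
  let ?n = "nat \<lceil>\<gamma>\<rceil>"
  have pos: "\<gamma> < real ?n" using nat_ceiling_not_Nats[OF assms False] .
  have k: "rl_kernel (real ?n - \<gamma>) t s *\<^sub>R time_deriv ?n u s =
      (1 / complex_of_real (Gamma (real ?n - \<gamma>))) * (indicator {0<..<t} s *\<^sub>R caputo_integrand \<gamma> u t s)" for s
  proof -
    have "(t - s) powr (real ?n - \<gamma> - 1) = 1 / (t - s) powr (\<gamma> + 1 - real ?n)"
      by (subst powr_minus_divide[symmetric]) (simp add: algebra_simps)
    then show ?thesis
      by (auto simp: rl_kernel_def caputo_integrand_def scaleR_conv_of_real)
  qed
  have "rl_integral (real ?n - \<gamma>) (time_deriv ?n u) t
    = (LINT s|lborel. (1 / complex_of_real (Gamma (real ?n - \<gamma>))) * (indicator {0<..<t} s *\<^sub>R caputo_integrand \<gamma> u t s))"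
    unfolding rl_integral_def k using pos by (simp only: diff_gt_0_iff_gt if_False split: if_split) auto
  also have "\<dots> = caputo \<gamma> u t"
    unfolding caputo_def if_not_P[OF False] set_lebesgue_integral_def
    by (rule Bochner_Integration.integral_mult_right_zero)
  finally show ?thesis by simp
qed

text \<open>Admissibility of the Caputo integrand for one \<open>t\<close> already gives integrability of the top derivative,
  because the weight \<open>(t - s) powr (\<gamma> + 1 - n)\<close> by which the integrand differs is bounded.\<close>

lemma time_deriv_integrable:
  assumes "\<gamma> > 0" "\<gamma> \<notin> \<nat>" "caputo_differentiable \<gamma> u" "t > 0"
  shows "set_integrable lborel {0<..<t} (time_deriv (nat \<lceil>\<gamma>\<rceil>) u)"
proof -
  let ?n = "nat \<lceil>\<gamma>\<rceil>"
  have le: "real ?n \<le> \<gamma> + 1" using assms(1) by linarith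
  have int: "integrable lborel (\<lambda>s. indicator {0<..<t} s *\<^sub>R caputo_integrand \<gamma> u t s)"
    using assms by (simp add: caputo_differentiable_def set_integrable_def)
  have [measurable]: "(\<lambda>s. indicator {0<..<t} s *\<^sub>R caputo_integrand \<gamma> u t s) \<in> borel_measurable borel"
    using borel_measurable_integrable[OF int] by simp
  define P where "P = (\<lambda>s. if 0 < s \<and> s < t then (t - s) powr (\<gamma> + 1 - real ?n) else 0)"
  have [measurable]: "P \<in> borel_measurable borel" unfolding P_def by measurable
  have eq: "indicator {0<..<t} s *\<^sub>R time_deriv ?n u s = P s *\<^sub>R (indicator {0<..<t} s *\<^sub>R caputo_integrand \<gamma> u t s)" for s
    by (auto simp: P_def indicator_def caputo_integrand_def scaleR_conv_of_real)
  have Pb: "\<bar>P s\<bar> \<le> t powr (\<gamma> + 1 - real ?n)" for s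
    using assms(4) le by (auto simp: P_def intro!: powr_mono2)
  show ?thesis unfolding set_integrable_def eq
  proof (rule Bochner_Integration.integrable_bound)
    show "integrable lborel (\<lambda>s. t powr (\<gamma> + 1 - real ?n) *\<^sub>R (indicator {0<..<t} s *\<^sub>R caputo_integrand \<gamma> u t s))"
      by (rule integrable_scaleR_right) (rule int)
    show "AE s in lborel. norm (P s *\<^sub>R (indicator {0<..<t} s *\<^sub>R caputo_integrand \<gamma> u t s))
      \<le> norm (t powr (\<gamma> + 1 - real ?n) *\<^sub>R (indicator {0<..<t} s *\<^sub>R caputo_integrand \<gamma> u t s))"
    proof (intro AE_I2)
      fix s
      show "norm (P s *\<^sub>R (indicator {0<..<t} s *\<^sub>R caputo_integrand \<gamma> u t s))
      \<le> norm (t powr (\<gamma> + 1 - real ?n) *\<^sub>R (indicator {0<..<t} s *\<^sub>R caputo_integrand \<gamma> u t s))"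
        using mult_right_mono[OF Pb[of s] norm_ge_zero[of "indicator {0<..<t} s *\<^sub>R caputo_integrand \<gamma> u t s"]]
        by (simp only: norm_scaleR abs_of_nonneg[OF powr_ge_zero])
    qed
  qed measurable
qed

lemma rl_kernel_1: "rl_kernel 1 t s = indicator {0<..<t} s"
  by (auto simp: rl_kernel_def)

lemma rl_integral_1:
  "rl_integral 1 f t = (LINT s:{0<..<t}|lborel. f s)"
  by (simp add: rl_integral_def rl_kernel_1 set_lebesgue_integral_def)

lemma rl_integral_1_derivative:
  fixes u :: "real \<Rightarrow> 'a::euclidean_space"
  assumes "0 \<le> t" "continuous_on {0..t} u"
    and "\<And>s. 0 < s \<Longrightarrow> s < t \<Longrightarrow> (u has_vector_derivative u1 s) (at s)"
    and "set_integrable lborel {0<..<t} u1"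
  shows "rl_integral 1 u1 t = u t - u 0"
proof -
  have "(u1 has_integral (u t - u 0)) {0..t}"
    using assms by (intro fundamental_theorem_of_calculus_interior) auto
  then show ?thesis
    using set_integral_Ioo_eq_integral(2)[OF assms(4)] by (simp add: rl_integral_1 integral_unique)
qed

text \<open>The derivative of \<open>u\<close> at \<open>0\<close> is only known as a one-sided difference quotient. Integrability of the
  second derivative gives \<open>u1\<close> a limit \<open>L\<close> at \<open>0\<close>; then \<open>L\<close> is the one-sided derivative, so \<open>L = 0\<close>
  and \<open>u1\<close> is the integral of \<open>u2\<close> from \<open>0\<close>.\<close>

lemma derivative_from_second_derivative:
  fixes u u1 u2 :: "real \<Rightarrow> 'a::euclidean_space"
  assumes u: "\<And>s. s > 0 \<Longrightarrow> (u has_vector_derivative u1 s) (at s)"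
    and u1: "\<And>s. s > 0 \<Longrightarrow> (u1 has_vector_derivative u2 s) (at s)"
    and u0: "(u has_vector_derivative 0) (at 0 within {0..})"
    and u2: "\<And>t. t > 0 \<Longrightarrow> set_integrable lborel {0<..<t} u2"
    and T: "T > 0"
  shows "rl_integral 1 u2 T = u1 T" "set_integrable lborel {0<..<T} u1"
proof -
  define V where "V = (\<lambda>t. integral {0..t} u2)"
  have intT: "u2 integrable_on {0..T}"
    using set_integral_Ioo_eq_integral(1)[OF u2[OF T]] by (rule absolutely_integrable_on_def[THEN iffD1, THEN conjunct1])
  have contV: "continuous_on {0..T} V"
    unfolding V_def by (rule indefinite_integral_continuous_1[OF intT])
  \<comment> \<open>On \<open>(0, T]\<close> the function \<open>u1\<close> differs from the primitive \<open>V\<close> of \<open>u2\<close> by this constant.\<close>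
  define L where "L = u1 T - V T"
  have u1eq: "u1 s = V s + L" if s: "0 < s" "s \<le> T" for s
  proof -
    have "(u2 has_integral (u1 T - u1 s)) {s..T}"
      using s by (intro fundamental_theorem_of_calculus) (auto intro!: has_vector_derivative_at_within u1)
    moreover have "integral {0..s} u2 + integral {s..T} u2 = integral {0..T} u2"
      using s intT by (intro Henstock_Kurzweil_Integration.integral_combine) auto
    ultimately show ?thesis by (simp add: L_def V_def integral_unique algebra_simps)
  qed
  have contu: "continuous_on {0..T} u"
  proof (rule continuous_on_eq_continuous_within[THEN iffD2], rule ballI)
    fix x assume "x \<in> {0..T}"
    show "continuous (at x within {0..T}) u"
    proof (cases "x = 0")
      case True
      then show ?thesis using has_vector_derivative_continuous[OF u0]
        by (auto intro: continuous_within_subset)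
    next
      case False
      then show ?thesis using has_vector_derivative_continuous[OF u[of x]] \<open>x \<in> {0..T}\<close>
        by (auto intro: continuous_at_imp_continuous_at_within)
    qed
  qed
  have contVL: "continuous_on {0..T} (\<lambda>s. V s + L)" using contV by (intro continuous_intros)
  have ueq: "integral {0..s} (\<lambda>s. V s + L) = u s - u 0" if s: "s \<in> {0..T}" for s
  proof (rule integral_unique, rule fundamental_theorem_of_calculus_interior)
    show "continuous_on {0..s} u" using contu by (rule continuous_on_subset) (use s in auto)
    fix x assume "x \<in> {0<..<s}"
    then show "(u has_vector_derivative V x + L) (at x)"
      using u[of x] u1eq[of x] s by simp
  qed (use s in auto)
  have "((\<lambda>s. integral {0..s} (\<lambda>s. V s + L)) has_vector_derivative (V 0 + L)) (at 0 within {0..T})"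
    using T by (intro integral_has_vector_derivative contVL) auto
  then have "((\<lambda>s. u s - u 0) has_vector_derivative (V 0 + L)) (at 0 within {0..T})"
    by (rule has_vector_derivative_transform[rotated 2]) (use T ueq in auto)
  moreover have "((\<lambda>s. u s - u 0) has_vector_derivative 0 - 0) (at 0 within {0..T})"
    by (intro has_vector_derivative_diff has_vector_derivative_const has_vector_derivative_within_subset[OF u0]) auto
  ultimately have "V 0 + L = 0"
    using vector_derivative_unique_within_closed_interval[of 0 T 0 "\<lambda>s. u s - u 0" "V 0 + L" "0 - 0"] T
    by (auto simp: box_real)
  then have L: "L = 0" by (simp add: V_def)
  show "rl_integral 1 u2 T = u1 T"
    using set_integral_Ioo_eq_integral(2)[OF u2[OF T]] L by (simp add: rl_integral_1 L_def V_def)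
  have "set_integrable lborel {0<..<T} V" by (rule set_integral_Ioo_continuous(1)[OF contV])
  then show "set_integrable lborel {0<..<T} u1"
    by (rule set_integrable_cong[THEN iffD1, rotated 3]) (use u1eq L in auto)
qed

text \<open>Integrating the equation by \<open>I\<close> of order \<open>\<alpha> + \<beta>\<close>: by the semigroup law the top Caputo derivative
  becomes the second integral of \<open>u''\<close>, that is \<open>u - u(0)\<close>, and the lower one becomes \<open>I\<close> of order
  \<open>\<beta> + 1\<close> of \<open>u'\<close>, that is \<open>I\<^sup>\<beta> (u - u(0))\<close>. The delicate point is that \<open>u''\<close> must be integrable up to
  \<open>0\<close>. For \<open>\<alpha> + \<beta> < 2\<close> this is part of Caputo differentiability. For \<open>\<alpha> + \<beta> = 2\<close> it has to be read
  off the equation itself.\<close>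

proposition caputo_equation_integrated:
  fixes u g :: "real \<Rightarrow> complex"
  assumes \<alpha>: "0 < \<alpha>" "\<alpha> \<le> 1" and \<gamma>: "1 < \<alpha> + \<beta>" "\<alpha> + \<beta> \<le> 2" and A: "A > 0"
    and d\<gamma>: "caputo_differentiable (\<alpha> + \<beta>) u" and d\<alpha>: "caputo_differentiable \<alpha> u"
    and u0: "(u has_vector_derivative 0) (at 0 within {0..})"
    and g: "continuous_on {0..} g"
    and eq: "\<And>t. t > 0 \<Longrightarrow> complex_of_real A * caputo (\<alpha> + \<beta>) u t + complex_of_real B * caputo \<alpha> u t = g t"
    and t: "t \<ge> 0"
  shows "A *\<^sub>R (u t - u 0) + B *\<^sub>R rl_integral \<beta> (\<lambda>s. u s - u 0) t = rl_integral (\<alpha> + \<beta>) g t"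
proof (cases "t = 0")
  case True
  have "rl_integral \<sigma> f 0 = 0" if "\<sigma> > 0" for \<sigma> and f :: "real \<Rightarrow> complex"
  proof -
    have "rl_kernel \<sigma> 0 s = 0" for s by (auto simp: rl_kernel_def)
    then show ?thesis using that by (simp add: rl_integral_def)
  qed
  then show ?thesis using True \<alpha> \<gamma> by simp
next
  case False
  with t have t: "t > 0" by simp
  define \<gamma>' where "\<gamma>' = \<alpha> + \<beta>"
  define u1 where "u1 = time_deriv (Suc 0) u"
  define u2 where "u2 = time_deriv 2 u"
  have n\<gamma>: "nat \<lceil>\<gamma>'\<rceil> = 2" using \<gamma> by (simp add: \<gamma>'_def) linarith
  have n\<alpha>: "nat \<lceil>\<alpha>\<rceil> = Suc 0" using \<alpha> by linarith
  have du: "(u has_vector_derivative u1 s) (at s)" if "s > 0" for s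
    using d\<alpha> that n\<alpha> unfolding caputo_differentiable_def
    by (auto simp: u1_def time_deriv_simps vector_derivative_works)
  have du1: "(u1 has_vector_derivative u2 s) (at s)" if "s > 0" for s
  proof -
    have "time_deriv (Suc 0) u differentiable (at s)"
      using d\<gamma>[folded \<gamma>'_def] that n\<gamma> unfolding caputo_differentiable_def by simp
    then show ?thesis unfolding u1_def u2_def time_deriv_simps(3) by (simp add: vector_derivative_works)
  qed
  have c\<gamma>: "caputo \<gamma>' u s = rl_integral (2 - \<gamma>') u2 s" for s
    using caputo_eq_rl_integral[of \<gamma>' u s, unfolded n\<gamma>] \<gamma> by (simp add: u2_def \<gamma>'_def)
  have c\<alpha>: "caputo \<alpha> u s = rl_integral (1 - \<alpha>) u1 s" for s
    using caputo_eq_rl_integral[of \<alpha> u s, unfolded n\<alpha>] \<alpha> by (simp add: u1_def)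
  have notnat: "x \<notin> \<nat>" if "real n < x" "x < real (Suc n)" for x n
  proof
    assume "x \<in> \<nat>"
    then obtain k where "x = real k" by (auto elim: Nats_cases)
    then show False using that by (simp only: of_nat_less_iff)
  qed
  have contu1: "continuous_on {0<..} u1"
    using du1 by (intro continuous_at_imp_continuous_on ballI has_vector_derivative_continuous) auto
  have contu: "continuous_on {0..} u"
  proof (rule continuous_on_eq_continuous_within[THEN iffD2], rule ballI)
    fix x :: real assume "x \<in> {0..}"
    show "continuous (at x within {0..}) u"
    proof (cases "x = 0")
      case True
      then show ?thesis using has_vector_derivative_continuous[OF u0] by simp
    next
      case False
      then show ?thesis using has_vector_derivative_continuous[OF du[of x]] \<open>x \<in> {0..}\<close>
        by (auto intro: continuous_at_imp_continuous_at_within)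
    qed
  qed
  have intu2: "set_integrable lborel {0<..<T} u2" if T: "T > 0" for T
  proof (cases "\<gamma>' < 2")
    case True
    have "\<gamma>' \<notin> \<nat>" using notnat[of 1 \<gamma>'] True \<gamma> by (simp add: \<gamma>'_def)
    then show ?thesis
      using time_deriv_integrable[of \<gamma>' u T] n\<gamma> d\<gamma> \<gamma> T by (simp add: \<gamma>'_def u2_def)
  next
    case False
    \<comment> \<open>The equation now expresses \<open>u''\<close> through \<open>g\<close> and the derivative of order \<open>\<alpha>\<close>.\<close>
    then have \<gamma>2: "\<gamma>' = 2" using \<gamma> by (simp add: \<gamma>'_def)
    have "of_real A * u2 s + of_real B * rl_integral (1 - \<alpha>) u1 s = g s" if "s > 0" for s
      using eq[OF that, folded \<gamma>'_def] c\<gamma>[of s] c\<alpha>[of s] \<gamma>2 by (simp add: rl_integral_def)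
    then have u2eq: "u2 s = (1 / of_real A) * (g s - of_real B * rl_integral (1 - \<alpha>) u1 s)" if "s > 0" for s
      using that A by (simp add: field_simps)
    have intg: "set_integrable lborel {0<..<T} g"
      by (intro set_integral_Ioo_continuous(1) continuous_on_subset[OF g]) auto
    have "set_integrable lborel {0<..<T} (rl_integral (1 - \<alpha>) u1)"
    proof (cases "\<alpha> < 1")
      case True
      have "\<alpha> \<notin> \<nat>" using notnat[of 0 \<alpha>] True \<alpha> by simp
      then have "set_integrable lborel {0<..<T} u1"
        using time_deriv_integrable[of \<alpha> u T] n\<alpha> d\<alpha> \<alpha> T by (simp add: u1_def)
      from rl_integral_semigroup(2)[OF _ _ _ this, of 1 "1 - \<alpha>"] True \<alpha> show ?thesis
        by (simp add: rl_kernel_1 set_integrable_def)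
    next
      case False
      then have \<alpha>1: "\<alpha> = 1" using \<alpha> by simp
      have eq1: "of_real A * u2 s + of_real B * u1 s = g s" if "s > 0" for s
        using eq[OF that, folded \<gamma>'_def] c\<gamma>[of s] c\<alpha>[of s] \<gamma>2 \<alpha>1 by (simp add: rl_integral_def)
      \<comment> \<open>For \<open>\<alpha> = 1\<close> the equation says that \<open>A u' + B u\<close> is a primitive of \<open>g\<close>, so \<open>u'\<close> extends continuously to \<open>0\<close>.\<close>
      define E where "E = (\<lambda>s. of_real A * u1 s + of_real B * u s)"
      have dE: "(E has_vector_derivative g s) (at s)" if "s > 0" for s
        unfolding E_def eq1[OF that, symmetric]
        by (intro has_vector_derivative_add has_vector_derivative_mult_right du du1 that)
      have gi: "g integrable_on {0..T}"
        by (intro integrable_continuous_real continuous_on_subset[OF g]) auto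
      define G where "G = (\<lambda>s. integral {0..s} g)"
      have contG: "continuous_on {0..T} G" unfolding G_def by (rule indefinite_integral_continuous_1[OF gi])
      have Eeq: "E s = E T - (G T - G s)" if s: "0 < s" "s \<le> T" for s
      proof -
        have "(g has_integral (E T - E s)) {s..T}"
          using s by (intro fundamental_theorem_of_calculus) (auto intro!: has_vector_derivative_at_within dE)
        moreover have "integral {0..s} g + integral {s..T} g = integral {0..T} g"
          using s gi by (intro Henstock_Kurzweil_Integration.integral_combine) auto
        ultimately show ?thesis by (simp add: G_def integral_unique algebra_simps)
      qed
      define Z where "Z = (\<lambda>s. (1 / of_real A) * (E T - (G T - G s) - of_real B * u s))"
      have contZ: "continuous_on {0..T} Z" unfolding Z_def
        by (intro continuous_intros contG continuous_on_subset[OF contu]) auto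
      have Zu: "u1 s = Z s" if "0 < s" "s < T" for s
        using Eeq[of s] that A by (simp add: Z_def E_def field_simps)
      have "set_integrable lborel {0<..<T} Z" by (rule set_integral_Ioo_continuous(1)[OF contZ])
      then have "set_integrable lborel {0<..<T} u1"
        by (rule set_integrable_cong[THEN iffD1, rotated 3]) (use Zu in auto)
      then show ?thesis using \<alpha>1 by (simp add: rl_integral_def[abs_def])
    qed
    then have "set_integrable lborel {0<..<T} (\<lambda>s. (1 / of_real A) * (g s - of_real B * rl_integral (1 - \<alpha>) u1 s))"
      using intg by (intro set_integrable_mult_right set_integral_diff(1)) auto
    then show ?thesis
      by (rule set_integrable_cong[THEN iffD1, rotated 3]) (use u2eq in auto)
  qed
  have I1: "rl_integral 1 u2 s = u1 s" "set_integrable lborel {0<..<s} u1" if "s > 0" for s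
    using derivative_from_second_derivative[OF du du1 u0 intu2 that] by auto
  have I2: "rl_integral 1 u1 s = u s - u 0" if "s \<ge> 0" for s
  proof (cases "s = 0")
    case True then show ?thesis by (simp add: rl_integral_1 set_lebesgue_integral_def)
  next
    case False
    then show ?thesis using that
      by (intro rl_integral_1_derivative du I1 continuous_on_subset[OF contu]) auto
  qed
  have \<gamma>pos: "\<gamma>' > 0" using \<gamma> by (simp add: \<gamma>'_def)
  have \<beta>pos: "\<beta> > 0" using \<gamma> \<alpha> by simp
  let ?Ig = "\<lambda>f. rl_integral \<gamma>' f t"
  have J\<gamma>: "?Ig (rl_integral (2 - \<gamma>') u2) = u t - u 0"
    "integrable lborel (\<lambda>s. rl_kernel \<gamma>' t s *\<^sub>R rl_integral (2 - \<gamma>') u2 s)"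
  proof -
    have *: "rl_integral 2 u2 t = u t - u 0"
    proof -
      have "rl_integral 2 u2 t = rl_integral 1 (rl_integral 1 u2) t"
        using rl_integral_semigroup(1)[of 1 1 t u2] intu2[OF t] by simp
      also have "\<dots> = rl_integral 1 u1 t"
        by (rule rl_integral_cong) (use I1 in auto)
      finally show ?thesis using I2[of t] t by simp
    qed
    have "?Ig (rl_integral (2 - \<gamma>') u2) = rl_integral 2 u2 t \<and> integrable lborel (\<lambda>s. rl_kernel \<gamma>' t s *\<^sub>R rl_integral (2 - \<gamma>') u2 s)"
    proof (cases "\<gamma>' < 2")
      case True
      then show ?thesis
        using rl_integral_semigroup[of \<gamma>' "2 - \<gamma>'" t u2] intu2[OF t] \<gamma>pos by simp
    next
      case False
      then have e: "\<gamma>' = 2" using \<gamma> by (simp add: \<gamma>'_def)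
      have "integrable lborel (\<lambda>s. rl_kernel 2 t s *\<^sub>R u2 s)"
      proof -
        have "integrable lborel (\<lambda>s. rl_kernel 2 t s *\<^sub>R (indicator {0<..<t} s *\<^sub>R u2 s))"
        proof (rule Bochner_Integration.integrable_bound)
          show "integrable lborel (\<lambda>s. t *\<^sub>R (indicator {0<..<t} s *\<^sub>R u2 s))"
            using intu2[OF t] unfolding set_integrable_def by (rule integrable_scaleR_right)
          have "(\<lambda>s. indicator {0<..<t} s *\<^sub>R u2 s) \<in> borel_measurable lborel"
            using intu2[OF t] unfolding set_integrable_def by (rule borel_measurable_integrable)
          then show "(\<lambda>s. rl_kernel 2 t s *\<^sub>R (indicator {0<..<t} s *\<^sub>R u2 s)) \<in> borel_measurable lborel"
            by measurable
          show "AE s in lborel. norm (rl_kernel 2 t s *\<^sub>R (indicator {0<..<t} s *\<^sub>R u2 s)) \<le> norm (t *\<^sub>R (indicator {0<..<t} s *\<^sub>R u2 s))"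
          proof (intro AE_I2)
            fix s
            have "\<bar>rl_kernel 2 t s\<bar> \<le> \<bar>t\<bar>"
              using rl_kernel_bound[of 2 t s] t by (simp add: Gamma_numeral)
            then show "norm (rl_kernel 2 t s *\<^sub>R (indicator {0<..<t} s *\<^sub>R u2 s)) \<le> norm (t *\<^sub>R (indicator {0<..<t} s *\<^sub>R u2 s))"
              unfolding norm_scaleR[of "rl_kernel 2 t s"] norm_scaleR[of t] by (rule mult_right_mono) simp
          qed
        qed
        then show ?thesis
          by (rule Bochner_Integration.integrable_cong[OF refl, THEN iffD1, rotated]) (auto simp: rl_kernel_def)
      qed
      then show ?thesis using e by (simp add: rl_integral_def[of 0, abs_def])
    qed
    then show "?Ig (rl_integral (2 - \<gamma>') u2) = u t - u 0"
      "integrable lborel (\<lambda>s. rl_kernel \<gamma>' t s *\<^sub>R rl_integral (2 - \<gamma>') u2 s)" using * by auto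
  qed
  have J\<alpha>: "?Ig (rl_integral (1 - \<alpha>) u1) = rl_integral \<beta> (\<lambda>s. u s - u 0) t"
    "integrable lborel (\<lambda>s. rl_kernel \<gamma>' t s *\<^sub>R rl_integral (1 - \<alpha>) u1 s)"
  proof -
    have *: "rl_integral (\<beta> + 1) u1 t = rl_integral \<beta> (\<lambda>s. u s - u 0) t"
    proof -
      have "rl_integral (\<beta> + 1) u1 t = rl_integral \<beta> (rl_integral 1 u1) t"
        using rl_integral_semigroup(1)[of \<beta> 1 t u1] I1(2)[OF t] \<beta>pos by simp
      also have "\<dots> = rl_integral \<beta> (\<lambda>s. u s - u 0) t"
        by (rule rl_integral_cong) (use I2 \<beta>pos in auto)
      finally show ?thesis .
    qed
    have "?Ig (rl_integral (1 - \<alpha>) u1) = rl_integral (\<beta> + 1) u1 t \<and> integrable lborel (\<lambda>s. rl_kernel \<gamma>' t s *\<^sub>R rl_integral (1 - \<alpha>) u1 s)"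
    proof (cases "\<alpha> < 1")
      case True
      then show ?thesis
        using rl_integral_semigroup[of \<gamma>' "1 - \<alpha>" t u1] I1(2)[OF t] \<gamma>pos \<beta>pos by (simp add: \<gamma>'_def add_ac)
    next
      case False
      then have e: "\<alpha> = 1" using \<alpha> by simp
      have "integrable lborel (\<lambda>s. rl_kernel \<gamma>' t s *\<^sub>R rl_integral 1 u2 s)"
        using rl_integral_semigroup[of \<gamma>' 1 t u2] intu2[OF t] \<gamma>pos by simp
      then have "integrable lborel (\<lambda>s. rl_kernel \<gamma>' t s *\<^sub>R u1 s)"
        by (rule Bochner_Integration.integrable_cong[OF refl, THEN iffD1, rotated]) (use I1 in \<open>auto simp: rl_kernel_def\<close>)
      then show ?thesis using e by (simp add: rl_integral_def[of 0, abs_def] \<gamma>'_def add.commute)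
    qed
    then show "?Ig (rl_integral (1 - \<alpha>) u1) = rl_integral \<beta> (\<lambda>s. u s - u 0) t"
      "integrable lborel (\<lambda>s. rl_kernel \<gamma>' t s *\<^sub>R rl_integral (1 - \<alpha>) u1 s)" using * by auto
  qed
  have "?Ig g = ?Ig (\<lambda>s. A *\<^sub>R rl_integral (2 - \<gamma>') u2 s + B *\<^sub>R rl_integral (1 - \<alpha>) u1 s)"
    by (rule rl_integral_cong) (use eq c\<gamma> c\<alpha> \<gamma>pos in \<open>auto simp: \<gamma>'_def scaleR_conv_of_real\<close>)
  also have "\<dots> = (LINT s|lborel. A *\<^sub>R (rl_kernel \<gamma>' t s *\<^sub>R rl_integral (2 - \<gamma>') u2 s) + B *\<^sub>R (rl_kernel \<gamma>' t s *\<^sub>R rl_integral (1 - \<alpha>) u1 s))"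
    using \<gamma>pos by (simp add: rl_integral_def[of \<gamma>'] scaleR_add_right mult_ac)
  also have "\<dots> = A *\<^sub>R ?Ig (rl_integral (2 - \<gamma>') u2) + B *\<^sub>R ?Ig (rl_integral (1 - \<alpha>) u1)"
    using \<gamma>pos by (subst Bochner_Integration.integral_add)
      (auto intro!: integrable_scaleR_right J\<gamma>(2) J\<alpha>(2) simp: rl_integral_def[of \<gamma>'] simp del: scaleR_scaleR)
  finally show ?thesis using J\<gamma>(1) J\<alpha>(1) by (simp add: \<gamma>'_def)
qed

section \<open>The series solution of the Volterra equation\<close>

locale volterra_series =
  fixes \<beta> \<gamma> A :: real
  assumes \<beta>_pos: "0 < \<beta>" and \<gamma>_pos: "0 < \<gamma>" and A_nonneg: "0 \<le> A"
begin

text \<open>The \<open>m\<close>-th power of \<open>- (A I\<^sup>\<beta> + \<zeta> I\<^sup>\<gamma>)\<close>, expanded by the binomial theorem and applied to the monomial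
  of index \<open>x\<close>.\<close>

definition vterm :: "real \<Rightarrow> real \<Rightarrow> nat \<Rightarrow> real \<Rightarrow> real" where
  "vterm x \<zeta> m t = (\<Sum>n\<le>m. real (m choose n) * (- A) ^ (m - n) * (- \<zeta>) ^ n *
     rl_monomial (\<beta> * real (m - n) + \<gamma> * real n + x) t)"

text \<open>The same sum with absolute values inside. It is what makes the double series absolutely convergent,
  so that it can be summed in either order.\<close>

definition vterm_abs :: "real \<Rightarrow> real \<Rightarrow> nat \<Rightarrow> real \<Rightarrow> real" where
  "vterm_abs x \<zeta> m t = (\<Sum>n\<le>m. \<bar>real (m choose n) * (- A) ^ (m - n) * (- \<zeta>) ^ n *
     rl_monomial (\<beta> * real (m - n) + \<gamma> * real n + x) t\<bar>)"

text \<open>The Neumann series for the equation \<open>u + A I\<^sup>\<beta> u + \<zeta> I\<^sup>\<gamma> u = t\<^sup>x / \<Gamma>(x + 1)\<close>.\<close>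

definition vsol :: "real \<Rightarrow> real \<Rightarrow> real \<Rightarrow> real" where
  "vsol x \<zeta> t = (\<Sum>m. vterm x \<zeta> m t)"

end

text \<open>Real powers of negative numbers are powers of the absolute value here. The series are therefore defined,
  even and continuous on the whole line, and no domain restrictions are needed for continuity.\<close>

lemma rl_monomial_abs: "rl_monomial x \<bar>t\<bar> = rl_monomial x t"
  by (simp add: rl_monomial_def abs_if uminus_powr_eq)

lemma rl_monomial_nonneg: "x > -1 \<Longrightarrow> 0 \<le> rl_monomial x t"
  by (auto simp: rl_monomial_def less_imp_le[OF Gamma_real_pos])

lemma continuous_on_rl_monomial [continuous_intros]:
  fixes f :: "'b::topological_space \<Rightarrow> real"
  assumes "x > 0" "continuous_on S f"
  shows "continuous_on S (\<lambda>p. rl_monomial x (f p))"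
proof -
  have "continuous_on S (\<lambda>p. \<bar>f p\<bar> powr x)"
    using assms by (intro continuous_on_powr' continuous_intros) auto
  moreover have "\<bar>f p\<bar> powr x = f p powr x" for p by (simp add: abs_if uminus_powr_eq)
  ultimately have c: "continuous_on S (\<lambda>p. f p powr x)" by simp
  have "Gamma (x + 1) \<noteq> 0" using Gamma_real_pos[of "x + 1"] assms by linarith
  then show ?thesis unfolding rl_monomial_def by (intro continuous_on_divide[OF c continuous_on_const]) simp
qed

text \<open>With a large rate the two integral operators have small weighted norm together.\<close>

lemma exists_dominating_rate:
  fixes A Z :: real
  assumes "0 < \<beta>" "0 < \<gamma>"
  obtains \<mu> where "\<mu> > 0" "A * \<mu> powr (- \<beta>) + Z * \<mu> powr (- \<gamma>) \<le> 1 / 2"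
proof -
  have "((\<lambda>\<mu>. A * \<mu> powr (- \<beta>) + Z * \<mu> powr (- \<gamma>)) \<longlongrightarrow> A * 0 + Z * 0) at_top"
    using assms by (intro tendsto_intros tendsto_neg_powr filterlim_ident) auto
  then have "\<forall>\<^sub>F \<mu> in at_top. A * \<mu> powr (- \<beta>) + Z * \<mu> powr (- \<gamma>) < 1 / 2"
    by (rule order_tendstoD) auto
  then have "\<forall>\<^sub>F \<mu> in at_top. \<mu> > 0 \<and> A * \<mu> powr (- \<beta>) + Z * \<mu> powr (- \<gamma>) < 1 / 2"
    using eventually_gt_at_top[of 0] by eventually_elim auto
  then obtain \<mu> where "\<mu> > 0 \<and> A * \<mu> powr (- \<beta>) + Z * \<mu> powr (- \<gamma>) < 1 / 2"
    using eventually_happens'[OF trivial_limit_at_top_linorder] by blast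
  then show thesis using that by auto
qed

text \<open>Multiplying a binomial expansion by \<open>p + q\<close>, where the powers of \<open>p\<close> and \<open>q\<close> also label a function
  \<open>F\<close> of the two exponents. It expresses that the \<open>(m+1)\<close>-st Neumann term is
  \<open>- (A I\<^sup>\<beta> + \<zeta> I\<^sup>\<gamma>)\<close> of the \<open>m\<close>-th one.\<close>

lemma pascal_sum:
  fixes p q :: "'a::comm_ring_1" and F :: "nat \<Rightarrow> nat \<Rightarrow> 'a"
  shows "(\<Sum>n\<le>Suc m. of_nat (Suc m choose n) * p ^ (Suc m - n) * q ^ n * F (Suc m - n) n) =
     p * (\<Sum>n\<le>m. of_nat (m choose n) * p ^ (m - n) * q ^ n * F (Suc (m - n)) n) +
     q * (\<Sum>n\<le>m. of_nat (m choose n) * p ^ (m - n) * q ^ n * F (m - n) (Suc n))"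
proof -
  define G where "G = (\<lambda>n. of_nat (m choose n) * p ^ (Suc m - n) * q ^ n * F (Suc m - n) n)"
  have "(\<Sum>n\<le>Suc m. of_nat (Suc m choose n) * p ^ (Suc m - n) * q ^ n * F (Suc m - n) n) =
      G 0 + (\<Sum>n\<le>m. of_nat (Suc m choose Suc n) * p ^ (m - n) * q ^ Suc n * F (m - n) (Suc n))"
    by (subst sum.atMost_Suc_shift) (simp add: G_def)
  also have "(\<Sum>n\<le>m. of_nat (Suc m choose Suc n) * p ^ (m - n) * q ^ Suc n * F (m - n) (Suc n)) =
     (\<Sum>n\<le>m. G (Suc n)) + q * (\<Sum>n\<le>m. of_nat (m choose n) * p ^ (m - n) * q ^ n * F (m - n) (Suc n))"
    by (simp add: G_def sum_distrib_left algebra_simps flip: sum.distrib)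
  also have "G 0 + ((\<Sum>n\<le>m. G (Suc n)) + q * (\<Sum>n\<le>m. of_nat (m choose n) * p ^ (m - n) * q ^ n * F (m - n) (Suc n))) =
     (\<Sum>n\<le>Suc m. G n) + q * (\<Sum>n\<le>m. of_nat (m choose n) * p ^ (m - n) * q ^ n * F (m - n) (Suc n))"
    by (subst sum.atMost_Suc_shift) (simp add: add.assoc)
  also have "(\<Sum>n\<le>Suc m. G n) = (\<Sum>n\<le>m. G n)" by (simp add: G_def binomial_eq_0)
  also have "\<dots> = p * (\<Sum>n\<le>m. of_nat (m choose n) * p ^ (m - n) * q ^ n * F (Suc (m - n)) n)"
    unfolding sum_distrib_left by (intro sum.cong) (auto simp: G_def Suc_diff_le mult_ac)
  finally show ?thesis .
qed

context volterra_series
begin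

lemma exponent_pos: "x > 0 \<Longrightarrow> \<beta> * real i + \<gamma> * real n + x > 0"
  using \<beta>_pos \<gamma>_pos by (intro add_nonneg_pos add_nonneg_nonneg mult_nonneg_nonneg) auto

text \<open>The monomial bound is multiplicative in the index, so the binomial theorem can be applied backwards.\<close>

lemma vterm_abs_bound:
  assumes "x > 0" "\<mu> > 0" "\<bar>\<zeta>\<bar> \<le> Z"
  shows "vterm_abs x \<zeta> m t
    \<le> exp (\<mu> * \<bar>t\<bar>) * \<mu> powr (- x) * (A * \<mu> powr (- \<beta>) + Z * \<mu> powr (- \<gamma>)) ^ m"
proof -
  have "vterm_abs x \<zeta> m t \<le>
     (\<Sum>n\<le>m. exp (\<mu> * \<bar>t\<bar>) * \<mu> powr (- x) * (real (m choose n) * (Z * \<mu> powr (- \<gamma>)) ^ n * (A * \<mu> powr (- \<beta>)) ^ (m - n)))"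
    unfolding vterm_abs_def
  proof (intro sum_mono)
    fix n assume "n \<in> {..m}"
    let ?e = "\<beta> * real (m - n) + \<gamma> * real n + x"
    have e: "?e > 0" by (rule exponent_pos[OF assms(1)])
    have 1: "rl_monomial ?e t \<le> exp (\<mu> * \<bar>t\<bar>) * \<mu> powr (- ?e)"
      using rl_monomial_bound[of ?e \<mu> "\<bar>t\<bar>"] e assms by (simp add: rl_monomial_abs)
    have 2: "\<mu> powr (- ?e) = \<mu> powr (- x) * ((\<mu> powr (- \<gamma>)) ^ n * (\<mu> powr (- \<beta>)) ^ (m - n))"
      using assms(2) by (simp add: powr_power algebra_simps flip: powr_add)
    have "\<bar>real (m choose n) * (- A) ^ (m - n) * (- \<zeta>) ^ n * rl_monomial ?e t\<bar> =
        real (m choose n) * A ^ (m - n) * \<bar>\<zeta>\<bar> ^ n * rl_monomial ?e t"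
      using e A_nonneg by (simp add: abs_mult power_abs rl_monomial_nonneg)
    also have "\<dots> \<le> real (m choose n) * A ^ (m - n) * Z ^ n * (exp (\<mu> * \<bar>t\<bar>) * \<mu> powr (- ?e))"
      using 1 e A_nonneg assms by (intro mult_mono mult_left_mono power_mono mult_nonneg_nonneg rl_monomial_nonneg) auto
    finally show "\<bar>real (m choose n) * (- A) ^ (m - n) * (- \<zeta>) ^ n * rl_monomial ?e t\<bar> \<le>
      exp (\<mu> * \<bar>t\<bar>) * \<mu> powr (- x) * (real (m choose n) * (Z * \<mu> powr (- \<gamma>)) ^ n * (A * \<mu> powr (- \<beta>)) ^ (m - n))"
      unfolding 2 by (simp add: power_mult_distrib mult_ac)
  qed
  also have "\<dots> = exp (\<mu> * \<bar>t\<bar>) * \<mu> powr (- x) * (A * \<mu> powr (- \<beta>) + Z * \<mu> powr (- \<gamma>)) ^ m"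
    unfolding sum_distrib_left[symmetric] binomial_ring[symmetric] by (simp add: add.commute)
  finally show ?thesis .
qed

lemma vterm_geometric_bound:
  assumes "x > 0"
  shows "\<exists>\<mu>>0. \<forall>\<zeta> m t. \<bar>\<zeta>\<bar> \<le> Z \<longrightarrow> vterm_abs x \<zeta> m t \<le> exp (\<mu> * \<bar>t\<bar>) * \<mu> powr (- x) * (1 / 2) ^ m"
proof -
  obtain \<mu> where \<mu>: "\<mu> > 0" "A * \<mu> powr (- \<beta>) + Z * \<mu> powr (- \<gamma>) \<le> 1 / 2"
    using exists_dominating_rate[OF \<beta>_pos \<gamma>_pos] by metis
  have "vterm_abs x \<zeta> m t \<le> exp (\<mu> * \<bar>t\<bar>) * \<mu> powr (- x) * (1 / 2) ^ m"
    if z: "\<bar>\<zeta>\<bar> \<le> Z" for \<zeta> t m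
  proof -
    have Z: "Z \<ge> 0" using z by simp
    then have "(A * \<mu> powr (- \<beta>) + Z * \<mu> powr (- \<gamma>)) ^ m \<le> (1 / 2) ^ m"
      using \<mu> A_nonneg by (intro power_mono) auto
    then show ?thesis
      using vterm_abs_bound[OF assms \<mu>(1) z, of m t]
      by (elim order_trans) (intro mult_left_mono; simp)
  qed
  then show ?thesis using \<mu>(1) by blast
qed

lemma vterm_le:
  "\<bar>vterm x \<zeta> m t\<bar> \<le> vterm_abs x \<zeta> m t"
  unfolding vterm_def vterm_abs_def by (rule sum_abs)

lemma summable_vterm:
  assumes "x > 0" shows "summable (\<lambda>m. vterm x \<zeta> m t)"
proof -
  obtain \<mu> where \<mu>: "\<mu> > 0" "\<And>\<zeta>' m t. \<bar>\<zeta>'\<bar> \<le> \<bar>\<zeta>\<bar> \<Longrightarrow> vterm_abs x \<zeta>' m t \<le> exp (\<mu> * \<bar>t\<bar>) * \<mu> powr (- x) * (1 / 2) ^ m"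
    using vterm_geometric_bound[OF assms, of "\<bar>\<zeta>\<bar>"] by blast
  show ?thesis
  proof (rule summable_comparison_test[OF _ summable_mult[OF summable_geometric]])
    show "\<exists>N. \<forall>m\<ge>N. norm (vterm x \<zeta> m t) \<le> exp (\<mu> * \<bar>t\<bar>) * \<mu> powr (- x) * (1 / 2) ^ m"
      using order_trans[OF vterm_le \<mu>(2)[of \<zeta>]] by auto
  qed auto
qed

lemma continuous_on_vterm:
  assumes "x > 0"
  shows "continuous_on S (\<lambda>p. vterm x (fst p) m (snd p))"
  unfolding vterm_def by (intro continuous_intros exponent_pos assms)

text \<open>Uniform convergence on bounded boxes; joint continuity is needed for measurability in \<open>(\<kappa>, t)\<close>.\<close>

lemma continuous_on_vsol:
  assumes "x > 0"
  shows "continuous_on UNIV (\<lambda>p. vsol x (fst p) (snd p))"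
proof (rule continuous_at_imp_continuous_on, rule ballI)
  fix p :: "real \<times> real"
  define Z where "Z = \<bar>fst p\<bar> + 1"
  define T where "T = \<bar>snd p\<bar> + 1"
  define U where "U = {-Z<..<Z} \<times> {-T<..<T}"
  have U: "open U" "p \<in> U" by (auto simp: U_def Z_def T_def mem_Times_iff intro!: open_Times)
  obtain \<mu> where \<mu>: "\<mu> > 0" "\<And>\<zeta>' m t. \<bar>\<zeta>'\<bar> \<le> Z \<Longrightarrow> vterm_abs x \<zeta>' m t \<le> exp (\<mu> * \<bar>t\<bar>) * \<mu> powr (- x) * (1 / 2) ^ m"
    using vterm_geometric_bound[OF assms, of "Z"] by blast
  have "uniform_limit U (\<lambda>N q. \<Sum>m<N. vterm x (fst q) m (snd q)) (\<lambda>q. \<Sum>m. vterm x (fst q) m (snd q)) sequentially"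
  proof (rule Weierstrass_m_test)
    show "summable (\<lambda>m. exp (\<mu> * T) * \<mu> powr (- x) * (1 / 2) ^ m)"
      by (intro summable_mult summable_geometric) auto
    fix m q assume q: "q \<in> U"
    have "\<bar>vterm x (fst q) m (snd q)\<bar> \<le> exp (\<mu> * \<bar>snd q\<bar>) * \<mu> powr (- x) * (1 / 2) ^ m"
      by (rule order_trans[OF vterm_le \<mu>(2)]) (use q in \<open>auto simp: U_def mem_Times_iff\<close>)
    also have "\<dots> \<le> exp (\<mu> * T) * \<mu> powr (- x) * (1 / 2) ^ m"
      using q \<mu>(1) by (intro mult_right_mono) (auto simp: U_def mem_Times_iff)
    finally show "norm (vterm x (fst q) m (snd q)) \<le> exp (\<mu> * T) * \<mu> powr (- x) * (1 / 2) ^ m" by simp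
  qed
  then have "continuous_on U (\<lambda>q. \<Sum>m. vterm x (fst q) m (snd q))"
    by (rule uniform_limit_theorem[rotated]) (auto intro!: always_eventually continuous_on_sum continuous_on_vterm assms)
  then have "continuous_on U (\<lambda>p. vsol x (fst p) (snd p))" by (simp add: vsol_def)
  then show "isCont (\<lambda>p. vsol x (fst p) (snd p)) p"
    using U by (simp add: continuous_on_eq_continuous_at)
qed

lemma continuous_on_vsol' [continuous_intros]:
  fixes f g :: "'b::topological_space \<Rightarrow> real"
  assumes "x > 0" "continuous_on S f" "continuous_on S g"
  shows "continuous_on S (\<lambda>p. vsol x (f p) (g p))"
  using continuous_on_compose2[OF continuous_on_vsol[OF assms(1)] continuous_on_Pair[OF assms(2,3)]] by simp

lemma vterm_Suc:
  "vterm x \<zeta> (Suc m) t = - A * vterm (x + \<beta>) \<zeta> m t - \<zeta> * vterm (x + \<gamma>) \<zeta> m t"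
proof -
  have e1: "\<beta> * real (Suc i) + \<gamma> * real n + x = \<beta> * real i + \<gamma> * real n + (x + \<beta>)" for i n
    by (simp add: algebra_simps)
  have e2: "\<beta> * real i + \<gamma> * real (Suc n) + x = \<beta> * real i + \<gamma> * real n + (x + \<gamma>)" for i n
    by (simp add: algebra_simps)
  show ?thesis
    unfolding vterm_def
    using pascal_sum[of m "- A" "- \<zeta>" "\<lambda>i n. rl_monomial (\<beta> * real i + \<gamma> * real n + x) t", unfolded e1 e2]
    by simp
qed

text \<open>Split off the first term of the series and apply Pascal's rule to the others.\<close>

lemma vsol_equation:
  assumes "x > 0"
  shows "vsol x \<zeta> t = rl_monomial x t - A * vsol (x + \<beta>) \<zeta> t - \<zeta> * vsol (x + \<gamma>) \<zeta> t"
proof -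
  have s: "summable (\<lambda>m. vterm y \<zeta> m t)" if "y > 0" for y using summable_vterm[OF that] .
  have p: "x + \<beta> > 0" "x + \<gamma> > 0" using assms \<beta>_pos \<gamma>_pos by auto
  have "vsol x \<zeta> t = vterm x \<zeta> 0 t + (\<Sum>m. vterm x \<zeta> (Suc m) t)"
    unfolding vsol_def using suminf_split_head[OF s[OF assms]] by simp
  also have "(\<Sum>m. vterm x \<zeta> (Suc m) t) = - A * vsol (x + \<beta>) \<zeta> t - \<zeta> * vsol (x + \<gamma>) \<zeta> t"
    unfolding vterm_Suc vsol_def using s[OF p(1)] s[OF p(2)]
    by (subst suminf_diff[symmetric]) (auto intro!: summable_mult summable_minus simp: suminf_mult suminf_minus)
  finally show ?thesis by (simp add: vterm_def)
qed

lemma rl_kernel_vterm: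
  assumes "\<sigma> > 0" "x > 0" "t \<ge> 0"
  shows "has_bochner_integral lborel (\<lambda>s. rl_kernel \<sigma> t s * vterm x \<zeta> m s) (vterm (x + \<sigma>) \<zeta> m t)"
proof -
  have "has_bochner_integral lborel (\<lambda>s. \<Sum>n\<le>m. real (m choose n) * (- A) ^ (m - n) * (- \<zeta>) ^ n *
     (rl_kernel \<sigma> t s * rl_monomial (\<beta> * real (m - n) + \<gamma> * real n + x) s))
     (\<Sum>n\<le>m. real (m choose n) * (- A) ^ (m - n) * (- \<zeta>) ^ n *
     rl_monomial ((\<beta> * real (m - n) + \<gamma> * real n + x) + \<sigma>) t)"
  proof (intro has_bochner_integral_sum has_bochner_integral_mult_right rl_kernel_monomial assms)
    fix n
    show "-1 < \<beta> * real (m - n) + \<gamma> * real n + x" using exponent_pos[OF assms(2), of "m - n" n] by simp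
    show "\<beta> * real (m - n) + \<gamma> * real n + x + \<sigma> \<noteq> 0" using exponent_pos[OF assms(2), of "m - n" n] assms by simp
  qed
  then show ?thesis by (simp add: vterm_def sum_distrib_left add_ac mult_ac)
qed

text \<open>Termwise integration, justified by the geometric majorant.\<close>

lemma rl_integral_vsol:
  assumes "\<sigma> \<ge> 0" "x > 0" "t \<ge> 0"
  shows "rl_integral \<sigma> (vsol x \<zeta>) t = vsol (x + \<sigma>) \<zeta> t"
proof (cases "\<sigma> = 0")
  case True then show ?thesis by (simp add: rl_integral_def)
next
  case False
  then have \<sigma>: "\<sigma> > 0" using assms by simp
  note I = rl_kernel_vterm[OF \<sigma> assms(2,3)]
  obtain \<mu> where \<mu>: "\<mu> > 0" "\<And>\<zeta>' m t. \<bar>\<zeta>'\<bar> \<le> \<bar>\<zeta>\<bar> \<Longrightarrow> vterm_abs x \<zeta>' m t \<le> exp (\<mu> * \<bar>t\<bar>) * \<mu> powr (- x) * (1 / 2) ^ m"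
    using vterm_geometric_bound[OF assms(2), of "\<bar>\<zeta>\<bar>"] by blast
  have vb: "\<bar>vterm x \<zeta> m s\<bar> \<le> exp (\<mu> * \<bar>s\<bar>) * \<mu> powr (- x) * (1 / 2) ^ m" for m s
    by (rule order_trans[OF vterm_le \<mu>(2)]) simp
  have "rl_integral \<sigma> (vsol x \<zeta>) t = (LINT s|lborel. (\<Sum>m. rl_kernel \<sigma> t s * vterm x \<zeta> m s))"
    using False summable_vterm[OF assms(2)] by (simp add: rl_integral_def vsol_def suminf_mult)
  also have "\<dots> = (\<Sum>m. (LINT s|lborel. rl_kernel \<sigma> t s * vterm x \<zeta> m s))"
  proof (rule integral_suminf)
    show "integrable lborel (\<lambda>s. rl_kernel \<sigma> t s * vterm x \<zeta> m s)" for m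
      using I by (simp add: has_bochner_integral_iff)
    show "AE s in lborel. summable (\<lambda>m. norm (rl_kernel \<sigma> t s * vterm x \<zeta> m s))"
    proof (intro AE_I2)
      fix s
      have "summable (\<lambda>m. \<bar>vterm x \<zeta> m s\<bar>)"
        by (rule summable_comparison_test[OF _ summable_mult[OF summable_geometric]]) (use vb in auto)
      then show "summable (\<lambda>m. norm (rl_kernel \<sigma> t s * vterm x \<zeta> m s))"
        by (simp add: abs_mult summable_mult)
    qed
    show "summable (\<lambda>m. LINT s|lborel. norm (rl_kernel \<sigma> t s * vterm x \<zeta> m s))"
    proof (rule summable_comparison_test[OF _ summable_mult[OF summable_geometric]], intro exI allI impI)
      fix m :: nat
      have "(LINT s|lborel. norm (rl_kernel \<sigma> t s * vterm x \<zeta> m s)) \<le> (LINT s|lborel. rl_kernel \<sigma> t s * (exp (\<mu> * t) * \<mu> powr (- x) * (1 / 2) ^ m))"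
      proof (rule integral_mono)
        show "integrable lborel (\<lambda>s. norm (rl_kernel \<sigma> t s * vterm x \<zeta> m s))"
          by (rule integrable_norm) (use I in \<open>simp add: has_bochner_integral_iff\<close>)
        show "integrable lborel (\<lambda>s. rl_kernel \<sigma> t s * (exp (\<mu> * t) * \<mu> powr (- x) * (1 / 2) ^ m))"
          using rl_kernel_integrable[OF \<sigma>] by simp
        fix s
        show "norm (rl_kernel \<sigma> t s * vterm x \<zeta> m s) \<le> rl_kernel \<sigma> t s * (exp (\<mu> * t) * \<mu> powr (- x) * (1 / 2) ^ m)"
        proof (cases "0 < s \<and> s < t")
          case True
          have "\<bar>vterm x \<zeta> m s\<bar> \<le> exp (\<mu> * t) * \<mu> powr (- x) * (1 / 2) ^ m"
            by (rule order_trans[OF vb]) (use True \<mu> in \<open>auto intro!: mult_right_mono\<close>)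
          then show ?thesis using rl_kernel_nonneg[OF \<sigma>, of t s] by (simp add: abs_mult mult_left_mono)
        qed (auto simp: rl_kernel_def)
      qed
      then show "norm (LINT s|lborel. norm (rl_kernel \<sigma> t s * vterm x \<zeta> m s)) \<le> ((LINT s|lborel. rl_kernel \<sigma> t s) * exp (\<mu> * t) * \<mu> powr (- x)) * (1 / 2) ^ m"
        by (simp add: mult_ac)
    qed auto
  qed
  also have "\<dots> = vsol (x + \<sigma>) \<zeta> t"
    using I by (simp add: has_bochner_integral_iff vsol_def)
  finally show ?thesis .
qed

end

section \<open>The energy bound\<close>

lemma rl_kernel_continuous_integrable:
  fixes f :: "real \<Rightarrow> real"
  assumes "\<sigma> > 0" "continuous_on UNIV f"
  shows "integrable lborel (\<lambda>s. rl_kernel \<sigma> t s * f s)"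
proof -
  have "bounded (f ` {0..t})"
    by (intro compact_imp_bounded compact_continuous_image continuous_on_subset[OF assms(2)]) auto
  then obtain B where B: "\<And>s. s \<in> {0..t} \<Longrightarrow> norm (f s) \<le> B"
    unfolding bounded_iff by (metis imageI)
  have "set_borel_measurable borel {0<..<t} f"
    unfolding set_borel_measurable_def
    by (intro borel_measurable_continuous_on_indicator continuous_on_subset[OF assms(2)]) auto
  then show ?thesis
    using rl_kernel_scaleR_integrable[OF assms(1), of t f B] B by simp
qed

text \<open>With \<open>W(t)\<close> the integral of \<open>exp (l s) g(s)\<close> over \<open>(0, t)\<close> the integrand is
  \<open>exp (- 2 l t) W W'\<close>, that is, the derivative of \<open>exp (- 2 l t) W\<^sup>2 / 2\<close> plus the nonnegative
  \<open>l exp (- 2 l t) W\<^sup>2\<close>.\<close>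

lemma exponential_kernel_positive:
  fixes g :: "real \<Rightarrow> real"
  assumes g: "continuous_on UNIV g" and l: "l \<ge> 0" and T: "T \<ge> 0"
  shows "0 \<le> (LINT t:{0<..<T}|lborel. g t * (LINT s:{0<..<t}|lborel. exp (- (l * (t - s))) * g s))"
proof -
  define W where "W = (\<lambda>t. integral {0..t} (\<lambda>s. exp (l * s) * g s))"
  have cg: "continuous_on S g" for S using continuous_on_subset[OF g] by auto
  have ci: "continuous_on S (\<lambda>s. exp (l * s) * g s)" for S by (intro continuous_intros cg)
  have cW: "continuous_on {0..T} W" unfolding W_def
    by (intro indefinite_integral_continuous_1 integrable_continuous_real ci)
  have dW: "(W has_real_derivative exp (l * t) * g t) (at t)" if "0 < t" "t < T" for t
  proof -
    have "(W has_real_derivative exp (l * t) * g t) (at t within {0..T})"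
      unfolding W_def using that by (intro integral_has_real_derivative ci) auto
    then show ?thesis using that by (simp add: at_within_Icc_at)
  qed
  have E: "(LINT s:{0<..<t}|lborel. exp (- (l * (t - s))) * g s) = exp (- (l * t)) * W t" for t
  proof -
    have "(LINT s:{0<..<t}|lborel. exp (- (l * (t - s))) * g s) = (LINT s:{0<..<t}|lborel. exp (- (l * t)) * (exp (l * s) * g s))"
      by (simp add: algebra_simps exp_diff exp_minus field_simps)
    also have "\<dots> = exp (- (l * t)) * (LINT s:{0<..<t}|lborel. exp (l * s) * g s)"
      by simp
    also have "(LINT s:{0<..<t}|lborel. exp (l * s) * g s) = W t"
      unfolding W_def by (rule set_integral_Ioo_continuous(2)[OF ci])
    finally show ?thesis .
  qed
  define \<Phi> where "\<Phi> = (\<lambda>t. exp (- (2 * l * t)) * (W t)\<^sup>2 / 2)"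
  define G where "G = (\<lambda>t. g t * (exp (- (l * t)) * W t))"
  define R where "R = (\<lambda>t. l * exp (- (2 * l * t)) * (W t)\<^sup>2)"
  have "((\<lambda>t. G t - R t) has_integral (\<Phi> T - \<Phi> 0)) {0..T}"
  proof (rule fundamental_theorem_of_calculus_interior[OF T])
    show "continuous_on {0..T} \<Phi>" unfolding \<Phi>_def by (intro continuous_intros cW) auto
    fix t assume t: "t \<in> {0<..<T}"
    have "(\<Phi> has_real_derivative G t - R t) (at t)"
    proof -
      have e: "exp (- (2 * l * t)) * exp (l * t) = exp (- (l * t))"
        by (simp flip: exp_add)
      have "(\<Phi> has_real_derivative (exp (- (2 * l * t)) * (- (2 * l)) * (W t)\<^sup>2 + exp (- (2 * l * t)) * (2 * W t * (exp (l * t) * g t))) / 2) (at t)"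
        unfolding \<Phi>_def using t by (auto intro!: derivative_eq_intros dW simp: power2_eq_square field_simps)
      also have "(exp (- (2 * l * t)) * (- (2 * l)) * (W t)\<^sup>2 + exp (- (2 * l * t)) * (2 * W t * (exp (l * t) * g t))) / 2
        = (exp (- (2 * l * t)) * exp (l * t)) * W t * g t - R t"
        by (simp add: R_def field_simps)
      finally show ?thesis unfolding e by (simp add: G_def mult_ac)
    qed
    then show "(\<Phi> has_vector_derivative G t - R t) (at t)"
      by (simp add: has_real_derivative_iff_has_vector_derivative)
  qed
  moreover have cR: "continuous_on {0..T} R" unfolding R_def by (intro continuous_intros cW)
  moreover have cG: "continuous_on {0..T} G" unfolding G_def by (intro continuous_intros cW cg)
  ultimately have "integral {0..T} G - integral {0..T} R = \<Phi> T"
    using integral_diff[of G "{0..T}" R] by (simp add: integrable_continuous_real integral_unique \<Phi>_def W_def)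
  moreover have "integral {0..T} R \<ge> 0"
    using l by (intro integral_nonneg integrable_continuous_real cR) (auto simp: R_def)
  moreover have "\<Phi> T \<ge> 0" by (simp add: \<Phi>_def)
  ultimately have "integral {0..T} G \<ge> 0" by simp
  moreover have "(LINT t:{0<..<T}|lborel. G t) = integral {0..T} G"
    by (rule set_integral_Ioo_continuous(2)[OF cG])
  ultimately show ?thesis unfolding E by (simp add: G_def)
qed

text \<open>For \<open>\<sigma> < 1\<close> the kernel is completely monotone: a positive mixture of decaying exponentials.\<close>

lemma power_as_exponential_mixture:
  fixes \<sigma> u :: real
  assumes "0 < \<sigma>" "\<sigma> < 1" "u > 0"
  shows "has_bochner_integral lborel (\<lambda>l. indicator {0<..} l * l powr (- \<sigma>) * exp (- (l * u))) (Gamma (1 - \<sigma>) * u powr (\<sigma> - 1))"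
proof -
  have "set_integrable lebesgue {0..} (\<lambda>t. t powr ((1 - \<sigma>) - 1) / exp t)"
    using Gamma_integral_real[of "1 - \<sigma>"] assms
    by (intro nonnegative_absolutely_integrable_1) (auto simp: has_integral_integrable_integral)
  moreover have "(\<lambda>t::real. indicator {0..} t *\<^sub>R (t powr ((1 - \<sigma>) - 1) / exp t)) \<in> borel_measurable lborel"
    by measurable
  ultimately have i: "set_integrable lborel {0..} (\<lambda>t. t powr ((1 - \<sigma>) - 1) / exp t)"
    by (simp add: set_integrable_def integrable_completion)
  have "(LINT t:{0..}|lborel. t powr ((1 - \<sigma>) - 1) / exp t) = Gamma (1 - \<sigma>)"
    using set_borel_integral_eq_integral(2)[OF i] Gamma_integral_real[of "1 - \<sigma>"] assms by (simp add: integral_unique)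
  then have "has_bochner_integral lborel (\<lambda>t. indicator {0..} t * (t powr (- \<sigma>) / exp t)) (Gamma (1 - \<sigma>))"
    using i by (simp add: has_bochner_integral_iff set_integrable_def set_lebesgue_integral_def)
  then have "has_bochner_integral lborel (\<lambda>l. indicator {0..} (0 + u * l) * ((0 + u * l) powr (- \<sigma>) / exp (0 + u * l))) (Gamma (1 - \<sigma>) /\<^sub>R \<bar>u\<bar>)"
    using assms by (subst lborel_has_bochner_integral_real_affine_iff[of u _ _ 0, symmetric]) auto
  then have "has_bochner_integral lborel (\<lambda>l. u powr \<sigma> * (indicator {0..} (0 + u * l) * ((0 + u * l) powr (- \<sigma>) / exp (0 + u * l)))) (u powr \<sigma> * (Gamma (1 - \<sigma>) /\<^sub>R \<bar>u\<bar>))"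
    by (rule has_bochner_integral_mult_right)
  moreover have "u powr \<sigma> * (Gamma (1 - \<sigma>) /\<^sub>R \<bar>u\<bar>) = Gamma (1 - \<sigma>) * u powr (\<sigma> - 1)"
    using assms by (simp add: powr_diff field_simps)
  moreover have "u powr \<sigma> * (indicator {0..} (0 + u * l) * ((0 + u * l) powr (- \<sigma>) / exp (0 + u * l))) = indicator {0<..} l * l powr (- \<sigma>) * exp (- (l * u))" for l
  proof (cases "l > 0")
    case True
    have "u powr \<sigma> * u powr (- \<sigma>) = 1" using assms by (simp flip: powr_add)
    moreover have "(u * l) powr (- \<sigma>) = u powr (- \<sigma>) * l powr (- \<sigma>)" using assms True by (simp add: powr_mult)
    ultimately have "u powr \<sigma> * (u * l) powr (- \<sigma>) = l powr (- \<sigma>)" by (simp add: mult.assoc[symmetric])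
    then show ?thesis using assms True by (simp add: exp_minus divide_inverse mult_ac)
  next
    case False
    then show ?thesis using assms by (cases "l = 0") (auto simp: indicator_def zero_le_mult_iff)
  qed
  ultimately show ?thesis by (simp only:)
qed

text \<open>Fractional integration of order at most \<open>1\<close> is positive semidefinite. For \<open>\<sigma> < 1\<close> this is inherited
  from the exponential kernels in the mixture; for \<open>\<sigma> = 1\<close> the kernel is the exponential with rate \<open>0\<close>.\<close>

lemma rl_integral_positive:
  fixes g :: "real \<Rightarrow> real"
  assumes g: "continuous_on UNIV g" and \<sigma>: "0 < \<sigma>" "\<sigma> \<le> 1" and T: "T \<ge> 0"
  shows "0 \<le> (LINT t:{0<..<T}|lborel. g t * rl_integral \<sigma> g t)"
proof (cases "\<sigma> = 1")
  case True
  have "rl_integral 1 g t = (LINT s:{0<..<t}|lborel. exp (- (0 * (t - s))) * g s)" for t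
    by (auto simp: rl_integral_def set_lebesgue_integral_def rl_kernel_def intro!: Bochner_Integration.integral_cong)
  then show ?thesis using exponential_kernel_positive[OF g order.refl T] True by simp
next
  case False
  with \<sigma> have \<sigma>1: "\<sigma> < 1" by simp
  have gm [measurable]: "g \<in> borel_measurable borel" using g by (rule borel_measurable_continuous_onI)
  have "bounded (g ` {0..T})"
    by (intro compact_imp_bounded compact_continuous_image continuous_on_subset[OF g]) auto
  then obtain B where B: "\<And>s. s \<in> {0..T} \<Longrightarrow> \<bar>g s\<bar> \<le> B"
    unfolding bounded_iff by (metis imageI real_norm_def)
  have B0: "B \<ge> 0" using B[of 0] T by auto
  define C where "C = Gamma \<sigma> * Gamma (1 - \<sigma>)"
  have C: "C > 0" using \<sigma> \<sigma>1 by (simp add: C_def)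
  define h where "h = (\<lambda>t s. indicator {0<..<T} t * g t * (indicator {0<..<t} s * g s))"
  define K where "K = (\<lambda>(t, s). rl_kernel \<sigma> t s * h t s)"
  define F where "F = (\<lambda>l p. (indicator {0<..} l * l powr (- \<sigma>) * exp (- (l * (fst p - snd p)))) * h (fst p) (snd p))"
  have hm: "(\<lambda>p. h (fst p) (snd p)) \<in> borel_measurable (borel \<Otimes>\<^sub>M borel)"
  proof -
    have "(\<lambda>p::real\<times>real. (if 0 < fst p \<and> fst p < T then 1 else 0) * g (fst p) * ((if 0 < snd p \<and> snd p < fst p then 1 else 0) * g (snd p))) \<in> borel_measurable (borel \<Otimes>\<^sub>M borel)"
      by measurable
    also have "(\<lambda>p::real\<times>real. (if 0 < fst p \<and> fst p < T then 1 else 0) * g (fst p) * ((if 0 < snd p \<and> snd p < fst p then 1 else 0) * g (snd p))) = (\<lambda>p. h (fst p) (snd p))"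
      by (auto simp: h_def fun_eq_iff)
    finally show ?thesis .
  qed
  have hm' [measurable]: "(\<lambda>p. h (fst p) (snd p)) \<in> borel_measurable borel" using hm by (simp add: borel_prod)
  have h_bound: "\<bar>h t s\<bar> \<le> B\<^sup>2 * indicator {0<..<T} t" for t s
    using mult_mono[OF B[of t] B[of s]] B0 by (auto simp: h_def indicator_def abs_mult power2_eq_square)
  have KI: "integrable (lborel \<Otimes>\<^sub>M lborel) K"
  proof (rule Bochner_Integration.integrable_bound)
    show "integrable (lborel \<Otimes>\<^sub>M lborel) (\<lambda>(t, s). B\<^sup>2 * (indicator {0<..<T} t * rl_kernel \<sigma> t s))"
    proof (rule lborel_pair.Fubini_integrable)
      show "(\<lambda>(t, s). B\<^sup>2 * (indicator {0<..<T} t * rl_kernel \<sigma> t s)) \<in> borel_measurable (lborel \<Otimes>\<^sub>M lborel)"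
        by measurable
      show "AE t in lborel. integrable lborel (\<lambda>s. case (t, s) of (t, s) \<Rightarrow> B\<^sup>2 * (indicator {0<..<T} t * rl_kernel \<sigma> t s))"
        using rl_kernel_integrable[OF \<sigma>(1)] by simp
      have "(LINT s|lborel. norm (case (t, s) of (t, s) \<Rightarrow> B\<^sup>2 * (indicator {0<..<T} t * rl_kernel \<sigma> t s)))
          = B\<^sup>2 * (indicator {0<..<T} t * rl_monomial \<sigma> t)" for t
      proof -
        have "(LINT s|lborel. rl_kernel \<sigma> t s) = rl_monomial \<sigma> t" if "t > 0" for t
        proof -
          have "(\<lambda>s. rl_kernel \<sigma> t s * rl_monomial 0 s) = rl_kernel \<sigma> t"
            by (auto simp: rl_kernel_def rl_monomial_def fun_eq_iff)
          then show ?thesis using rl_kernel_monomial[of \<sigma> 0 t] \<sigma> that by (simp add: has_bochner_integral_iff)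
        qed
        then show ?thesis using rl_kernel_nonneg[OF \<sigma>(1), of t]
          by (auto simp: abs_mult indicator_def)
      qed
      moreover have "integrable lborel (\<lambda>t. B\<^sup>2 * (indicator {0<..<T} t * rl_monomial \<sigma> t))"
      proof -
        have "set_integrable lborel {0<..<T} (rl_monomial \<sigma>)"
          using \<sigma> by (intro set_integral_Ioo_continuous(1) continuous_on_rl_monomial continuous_intros)
        then show ?thesis by (simp add: set_integrable_def)
      qed
      ultimately show "integrable lborel (\<lambda>t. LINT s|lborel. norm (case (t, s) of (t, s) \<Rightarrow> B\<^sup>2 * (indicator {0<..<T} t * rl_kernel \<sigma> t s)))"
        by simp
    qed
    show "K \<in> borel_measurable (lborel \<Otimes>\<^sub>M lborel)"
      unfolding K_def case_prod_beta' using hm by measurable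
    show "AE p in lborel \<Otimes>\<^sub>M lborel. norm (K p) \<le> norm (case p of (t, s) \<Rightarrow> B\<^sup>2 * (indicator {0<..<T} t * rl_kernel \<sigma> t s))"
    proof (intro AE_I2)
      fix p :: "real \<times> real"
      obtain t s where p: "p = (t, s)" by (cases p)
      show "norm (K p) \<le> norm (case p of (t, s) \<Rightarrow> B\<^sup>2 * (indicator {0<..<T} t * rl_kernel \<sigma> t s))"
        using mult_left_mono[OF h_bound[of t s] rl_kernel_nonneg[OF \<sigma>(1), of t s]] rl_kernel_nonneg[OF \<sigma>(1), of t s]
        by (simp add: p K_def abs_mult mult_ac)
    qed
  qed
  have inner: "has_bochner_integral lborel (\<lambda>l. F l p) (C * K p)"
    and innern: "has_bochner_integral lborel (\<lambda>l. norm (F l p)) (C * norm (K p))" for p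
  proof -
    obtain t s where p: "p = (t, s)" by (cases p)
    have "has_bochner_integral lborel (\<lambda>l. F l p) (C * K p) \<and> has_bochner_integral lborel (\<lambda>l. norm (F l p)) (C * norm (K p))"
    proof (cases "0 < s \<and> s < t")
      case True
      have "Gamma \<sigma> > 0" using \<sigma> by simp
      then have CK: "Gamma (1 - \<sigma>) * (t - s) powr (\<sigma> - 1) = C * rl_kernel \<sigma> t s"
        using True by (simp add: rl_kernel_def C_def)
      have m: "has_bochner_integral lborel (\<lambda>l. indicator {0<..} l * l powr (- \<sigma>) * exp (- (l * (t - s)))) (C * rl_kernel \<sigma> t s)"
        using power_as_exponential_mixture[of \<sigma> "t - s"] True \<sigma> \<sigma>1 CK by simp
      have k: "rl_kernel \<sigma> t s \<ge> 0" by (rule rl_kernel_nonneg[OF \<sigma>(1)])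
      show ?thesis
        using has_bochner_integral_mult_left[OF m, of "h t s"] has_bochner_integral_mult_left[OF m, of "\<bar>h t s\<bar>"] k
        by (simp add: F_def p K_def abs_mult mult_ac)
    next
      case False
      then have "h t s = 0" by (auto simp: h_def)
      then show ?thesis by (simp add: F_def K_def p has_bochner_integral_zero)
    qed
    then show "has_bochner_integral lborel (\<lambda>l. F l p) (C * K p)"
      "has_bochner_integral lborel (\<lambda>l. norm (F l p)) (C * norm (K p))" by auto
  qed
  have FI: "integrable (lborel \<Otimes>\<^sub>M lborel) (case_prod (\<lambda>p l. F l p))"
  proof (rule lborel_pair.Fubini_integrable)
    have "(\<lambda>q::(real\<times>real)\<times>real. (indicator {0<..} (snd q) * snd q powr (- \<sigma>) * exp (- (snd q * (fst (fst q) - snd (fst q))))) * h (fst (fst q)) (snd (fst q))) \<in> borel_measurable (borel \<Otimes>\<^sub>M borel)"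
      using measurable_compose[OF measurable_fst[of "borel :: (real\<times>real) measure" "borel :: real measure"] hm']
      by (intro borel_measurable_times) (measurable; simp add: borel_prod[symmetric])+
    then show "case_prod (\<lambda>p l. F l p) \<in> borel_measurable (lborel \<Otimes>\<^sub>M lborel)"
      by (simp add: F_def case_prod_beta')
    show "AE p in lborel. integrable lborel (\<lambda>l. case (p, l) of (p, l) \<Rightarrow> F l p)"
      using inner by (simp add: has_bochner_integral_iff)
    have "integrable lborel (\<lambda>p. C * norm (K p))"
      using KI unfolding lborel_prod by simp
    then show "integrable lborel (\<lambda>p. LINT l|lborel. norm (case (p, l) of (p, l) \<Rightarrow> F l p))"
      using innern by (simp add: has_bochner_integral_iff)
  qed
  \<comment> \<open>For each rate \<open>l\<close> this is the quadratic form of an exponential kernel.\<close>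
  have nonneg: "0 \<le> (LINT p|lborel. F l p)" for l
  proof (cases "integrable lborel (F l) \<and> l > 0")
    case True
    then have Fl: "integrable (lborel \<Otimes>\<^sub>M lborel) (F l)" unfolding lborel_prod by simp
    have "(LINT p|lborel. F l p) = (LINT t|lborel. (LINT s|lborel. F l (t, s)))"
      using lborel_pair.integral_fst'[OF Fl] unfolding lborel_prod by simp
    also have "\<dots> = (LINT t|lborel. l powr (- \<sigma>) * (indicator {0<..<T} t *\<^sub>R (g t * (LINT s:{0<..<t}|lborel. exp (- (l * (t - s))) * g s))))"
    proof (intro Bochner_Integration.integral_cong refl)
      fix t
      have "(LINT s|lborel. F l (t, s)) = (LINT s|lborel. (l powr (- \<sigma>) * (indicator {0<..<T} t * g t)) * (indicator {0<..<t} s *\<^sub>R (exp (- (l * (t - s))) * g s)))"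
        using True by (intro Bochner_Integration.integral_cong) (auto simp: F_def h_def mult_ac)
      then show "(LINT s|lborel. F l (t, s)) = l powr (- \<sigma>) * (indicator {0<..<T} t *\<^sub>R (g t * (LINT s:{0<..<t}|lborel. exp (- (l * (t - s))) * g s)))"
        by (simp add: set_lebesgue_integral_def)
    qed
    also have "\<dots> = l powr (- \<sigma>) * (LINT t:{0<..<T}|lborel. g t * (LINT s:{0<..<t}|lborel. exp (- (l * (t - s))) * g s))"
      by (simp add: set_lebesgue_integral_def)
    also have "\<dots> \<ge> 0" using exponential_kernel_positive[OF g _ T, of l] True by simp
    finally show ?thesis .
  next
    case False
    then show ?thesis by (cases "l > 0") (auto simp: not_integrable_integral_eq F_def)
  qed
  have "(LINT p|lborel. C * K p) = (LINT l|lborel. (LINT p|lborel. F l p))"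
    using lborel_pair.Fubini_integral[OF FI] inner by (simp add: has_bochner_integral_iff)
  also have "\<dots> \<ge> 0" by (rule Bochner_Integration.integral_nonneg) (simp add: nonneg)
  finally have "0 \<le> (LINT p|lborel. K p)" using C by (simp add: zero_le_mult_iff)
  also have "(LINT p|lborel. K p) = (LINT t|lborel. (LINT s|lborel. K (t, s)))"
    using lborel_pair.integral_fst'[OF KI] unfolding lborel_prod by simp
  also have "\<dots> = (LINT t:{0<..<T}|lborel. g t * rl_integral \<sigma> g t)"
    unfolding set_lebesgue_integral_def
  proof (intro Bochner_Integration.integral_cong refl)
    fix t
    have "(LINT s|lborel. K (t, s)) = (LINT s|lborel. (indicator {0<..<T} t * g t) * (rl_kernel \<sigma> t s *\<^sub>R g s))"
      by (intro Bochner_Integration.integral_cong) (auto simp: K_def h_def rl_kernel_def)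
    then show "(LINT s|lborel. K (t, s)) = indicator {0<..<T} t *\<^sub>R (g t * rl_integral \<sigma> g t)"
      using \<sigma> by (simp add: rl_integral_def)
  qed
  finally show ?thesis .
qed

context volterra_series
begin

text \<open>The solution of \<open>(f - 1) + A I\<^sup>\<beta> (f - 1) = - \<zeta> I\<^sup>\<gamma> f\<close>.\<close>

definition relaxation :: "real \<Rightarrow> real \<Rightarrow> real" where
  "relaxation \<zeta> t = 1 - \<zeta> * vsol \<gamma> \<zeta> t"

lemma continuous_on_relaxation:
  fixes f g :: "'b::topological_space \<Rightarrow> real"
  assumes "continuous_on S f" "continuous_on S g"
  shows "continuous_on S (\<lambda>p. relaxation (f p) (g p))"
  unfolding relaxation_def using \<gamma>_pos assms by (intro continuous_intros)

lemma continuous_on_vsol_t: "x > 0 \<Longrightarrow> continuous_on S (vsol x \<zeta>)"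
  using continuous_on_vsol'[of x S "\<lambda>_. \<zeta>" "\<lambda>t. t"] by (simp add: continuous_on_id)

lemma relaxation_0: "relaxation \<zeta> 0 = 1"
proof -
  have "vterm \<gamma> \<zeta> m 0 = 0" for m
    using exponent_pos[OF \<gamma>_pos] by (auto simp: vterm_def rl_monomial_def)
  then show ?thesis by (simp add: relaxation_def vsol_def)
qed

lemma relaxation_equation:
  assumes "t \<ge> 0"
  shows "(relaxation \<zeta> t - 1) + A * rl_integral \<beta> (\<lambda>s. relaxation \<zeta> s - 1) t = - \<zeta> * rl_integral \<gamma> (relaxation \<zeta>) t"
proof -
  have 1: "rl_integral \<beta> (\<lambda>s. relaxation \<zeta> s - 1) t = - \<zeta> * vsol (\<gamma> + \<beta>) \<zeta> t"
  proof -
    have "rl_integral \<beta> (\<lambda>s. relaxation \<zeta> s - 1) t = (LINT s|lborel. - \<zeta> * (rl_kernel \<beta> t s *\<^sub>R vsol \<gamma> \<zeta> s))"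
      using \<beta>_pos by (simp add: rl_integral_def relaxation_def mult_ac)
    also have "\<dots> = - \<zeta> * rl_integral \<beta> (vsol \<gamma> \<zeta>) t"
      using \<beta>_pos by (simp add: rl_integral_def)
    finally show ?thesis using rl_integral_vsol[of \<beta> \<gamma> t \<zeta>] assms \<beta>_pos \<gamma>_pos by simp
  qed
  have 2: "rl_integral \<gamma> (relaxation \<zeta>) t = rl_monomial \<gamma> t - \<zeta> * vsol (\<gamma> + \<gamma>) \<zeta> t"
  proof -
    have "rl_integral \<gamma> (relaxation \<zeta>) t = (LINT s|lborel. rl_kernel \<gamma> t s * rl_monomial 0 s - \<zeta> * (rl_kernel \<gamma> t s * vsol \<gamma> \<zeta> s))"
      using \<gamma>_pos unfolding rl_integral_def
      by (auto simp: relaxation_def rl_monomial_def rl_kernel_def algebra_simps intro!: Bochner_Integration.integral_cong)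
    also have "\<dots> = rl_monomial \<gamma> t - \<zeta> * rl_integral \<gamma> (vsol \<gamma> \<zeta>) t"
      using rl_kernel_monomial[of \<gamma> 0 t] rl_kernel_continuous_integrable[OF \<gamma>_pos continuous_on_vsol_t[OF \<gamma>_pos], of t \<zeta>] \<gamma>_pos assms
      by (subst Bochner_Integration.integral_diff) (auto simp: has_bochner_integral_iff rl_integral_def)
    finally show ?thesis using rl_integral_vsol[of \<gamma> \<gamma> t \<zeta>] assms \<gamma>_pos by simp
  qed
  show ?thesis unfolding 1 2 using arg_cong[OF vsol_equation[OF \<gamma>_pos, of \<zeta> t], of "\<lambda>v. \<zeta> * v"]
    by (simp add: relaxation_def algebra_simps)
qed

text \<open>The energy estimate. Write \<open>f\<close> for the solution, \<open>\<delta> = \<gamma> - 1\<close> and \<open>p = f'\<close>. One derivative of the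
  Volterra equation reads \<open>p = I\<^sup>\<delta> q\<close> with \<open>q + A I\<^sup>1\<^sup>-\<^sup>\<alpha> p = - \<zeta> f\<close>. Multiplying the latter by \<open>p\<close> and
  integrating over \<open>(0, T)\<close>, the left side is a sum of the two quadratic forms of \<open>I\<^sup>\<delta>\<close> in \<open>q\<close> and of
  \<open>I\<^sup>1\<^sup>-\<^sup>\<alpha>\<close> in \<open>p\<close>, hence nonnegative, and the right side is \<open>- \<zeta> (f(T)\<^sup>2 - 1) / 2\<close>. The orders
  \<open>\<delta>\<close> and \<open>1 - \<alpha>\<close> lie in \<open>[0, 1]\<close> under the hypotheses on \<open>\<alpha>\<close> and \<open>\<beta>\<close>.\<close>

lemma relaxation_bounded:
  assumes \<alpha>: "0 < \<alpha>" "\<alpha> \<le> 1" and \<gamma>eq: "\<gamma> = \<alpha> + \<beta>" and \<gamma>: "1 < \<gamma>" "\<gamma> \<le> 2" and \<zeta>: "\<zeta> \<ge> 0" and T: "T \<ge> 0"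
  shows "\<bar>relaxation \<zeta> T\<bar> \<le> 1"
proof (cases "\<zeta> = 0")
  case True then show ?thesis by (simp add: relaxation_def)
next
  case False
  with \<zeta> have \<zeta>: "\<zeta> > 0" by simp
  define \<delta> where "\<delta> = \<gamma> - 1"
  have \<delta>: "0 < \<delta>" "\<delta> \<le> 1" "\<gamma> = \<delta> + 1" using \<gamma> by (auto simp: \<delta>_def)
  define f where "f = relaxation \<zeta>"
  define p where "p = (\<lambda>t. - \<zeta> * vsol \<delta> \<zeta> t)"
  define r where "r = (\<lambda>t. - \<zeta> * vsol \<beta> \<zeta> t)"
  define q where "q = (\<lambda>t. - \<zeta> * f t - A * r t)"
  have cf: "continuous_on S f" for S unfolding f_def by (intro continuous_on_relaxation continuous_intros)
  have cp: "continuous_on S p" for S unfolding p_def by (intro continuous_intros continuous_on_vsol_t \<delta>)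
  have cr: "continuous_on S r" for S unfolding r_def by (intro continuous_intros continuous_on_vsol_t \<beta>_pos)
  have cq: "continuous_on S q" for S unfolding q_def by (intro continuous_intros cf cr)
  have pr: "p t = rl_integral \<delta> q t" if "t \<ge> 0" for t
  proof -
    have "rl_integral \<delta> q t = (LINT s|lborel. - \<zeta> * (rl_kernel \<delta> t s * rl_monomial 0 s) + (\<zeta>\<^sup>2 * (rl_kernel \<delta> t s * vsol \<gamma> \<zeta> s) + A * \<zeta> * (rl_kernel \<delta> t s * vsol \<beta> \<zeta> s)))"
      using \<delta>(1) unfolding rl_integral_def
      by (auto simp: q_def f_def r_def relaxation_def rl_monomial_def rl_kernel_def algebra_simps power2_eq_square intro!: Bochner_Integration.integral_cong)
    also have "\<dots> = - \<zeta> * rl_monomial \<delta> t + (\<zeta>\<^sup>2 * rl_integral \<delta> (vsol \<gamma> \<zeta>) t + A * \<zeta> * rl_integral \<delta> (vsol \<beta> \<zeta>) t)"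
      using rl_kernel_monomial[of \<delta> 0 t] rl_kernel_continuous_integrable[OF \<delta>(1) continuous_on_vsol_t[OF \<gamma>_pos], of t \<zeta>]
        rl_kernel_continuous_integrable[OF \<delta>(1) continuous_on_vsol_t[OF \<beta>_pos], of t \<zeta>] \<delta>(1) that
      by (subst Bochner_Integration.integral_add; (subst Bochner_Integration.integral_add)?)
         (auto simp: has_bochner_integral_iff rl_integral_def)
    also have "\<dots> = - \<zeta> * (rl_monomial \<delta> t - A * vsol (\<delta> + \<beta>) \<zeta> t - \<zeta> * vsol (\<delta> + \<gamma>) \<zeta> t)"
      using rl_integral_vsol[of \<delta> \<gamma> t \<zeta>] rl_integral_vsol[of \<delta> \<beta> t \<zeta>] \<delta>(1) \<gamma>_pos \<beta>_pos that
      by (simp add: algebra_simps power2_eq_square)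
    also have "\<dots> = p t" unfolding p_def using vsol_equation[OF \<delta>(1), of \<zeta> t] by simp
    finally show ?thesis by simp
  qed
  have P1: "0 \<le> (LINT t:{0<..<T}|lborel. q t * p t)"
  proof -
    have "(LINT t:{0<..<T}|lborel. q t * p t) = (LINT t:{0<..<T}|lborel. q t * rl_integral \<delta> q t)"
      by (rule set_lebesgue_integral_cong) (auto simp: pr)
    then show ?thesis using rl_integral_positive[OF cq \<delta>(1,2) T] by simp
  qed
  have P2: "0 \<le> (LINT t:{0<..<T}|lborel. p t * r t)"
  proof (cases "\<alpha> = 1")
    case True
    then have "\<delta> = \<beta>" using \<gamma>eq \<delta> by simp
    then show ?thesis by (simp add: p_def r_def set_lebesgue_integral_def)
  next
    case False
    have e: "\<delta> + (1 - \<alpha>) = \<beta>" using \<gamma>eq by (simp add: \<delta>_def)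
    have "rl_integral (1 - \<alpha>) p t = r t" if "t \<ge> 0" for t
    proof -
      have "rl_integral (1 - \<alpha>) p t = - \<zeta> * rl_integral (1 - \<alpha>) (vsol \<delta> \<zeta>) t"
        using False by (simp add: rl_integral_def p_def mult_ac)
      also have "rl_integral (1 - \<alpha>) (vsol \<delta> \<zeta>) t = vsol \<beta> \<zeta> t"
        using rl_integral_vsol[of "1 - \<alpha>" \<delta> t \<zeta>, unfolded e] \<alpha> \<delta>(1) that by simp
      finally show ?thesis by (simp add: r_def)
    qed
    then have "(LINT t:{0<..<T}|lborel. p t * r t) = (LINT t:{0<..<T}|lborel. p t * rl_integral (1 - \<alpha>) p t)"
      by (intro set_lebesgue_integral_cong) auto
    then show ?thesis using rl_integral_positive[OF cp, of "1 - \<alpha>" T] T \<alpha> False by simp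
  qed
  have df: "(f has_real_derivative p t) (at t)" if t: "0 < t" "t < T" for t
  proof -
    have V: "vsol \<gamma> \<zeta> s = integral {0..s} (vsol \<delta> \<zeta>)" if "s \<ge> 0" for s
    proof -
      have "vsol \<gamma> \<zeta> s = rl_integral 1 (vsol \<delta> \<zeta>) s"
        using rl_integral_vsol[of 1 \<delta> s \<zeta>] \<delta> that by simp
      also have "\<dots> = (LINT x:{0<..<s}|lborel. vsol \<delta> \<zeta> x)"
        by (auto simp: rl_integral_def set_lebesgue_integral_def rl_kernel_def intro!: Bochner_Integration.integral_cong)
      also have "\<dots> = integral {0..s} (vsol \<delta> \<zeta>)"
        by (rule set_integral_Ioo_continuous(2)[OF continuous_on_vsol_t[OF \<delta>(1)]])
      finally show ?thesis .
    qed
    have "((\<lambda>s. integral {0..s} (vsol \<delta> \<zeta>)) has_real_derivative vsol \<delta> \<zeta> t) (at t within {0..T})"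
      using t by (intro integral_has_real_derivative continuous_on_vsol_t \<delta>) auto
    then have "(vsol \<gamma> \<zeta> has_real_derivative vsol \<delta> \<zeta> t) (at t within {0..T})"
      unfolding has_field_derivative_def by (rule has_derivative_transform[rotated 2]) (use t V in auto)
    then have "(vsol \<gamma> \<zeta> has_real_derivative vsol \<delta> \<zeta> t) (at t)"
      using t by (simp add: at_within_Icc_at)
    then show ?thesis
      unfolding f_def relaxation_def[abs_def] p_def by (auto intro!: derivative_eq_intros)
  qed
  have "((\<lambda>t. f t * p t) has_integral ((f T)\<^sup>2 / 2 - (f 0)\<^sup>2 / 2)) {0..T}"
  proof (rule fundamental_theorem_of_calculus_interior[OF T])
    show "continuous_on {0..T} (\<lambda>t. (f t)\<^sup>2 / 2)" by (intro continuous_intros cf) auto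
    fix t assume "t \<in> {0<..<T}"
    then show "((\<lambda>t. (f t)\<^sup>2 / 2) has_vector_derivative f t * p t) (at t)"
      using df[of t] by (auto intro!: derivative_eq_intros simp: has_real_derivative_iff_has_vector_derivative[symmetric])
  qed
  then have E: "integral {0..T} (\<lambda>t. f t * p t) = ((f T)\<^sup>2 - 1) / 2"
    by (simp add: integral_unique f_def relaxation_0 diff_divide_distrib)
  note si = set_integral_Ioo_continuous[where t = T]
  have "(LINT t:{0<..<T}|lborel. q t * p t) + A * (LINT t:{0<..<T}|lborel. p t * r t) = (LINT t:{0<..<T}|lborel. q t * p t + A * (p t * r t))"
    by (subst set_integral_add(2)) (auto intro!: si continuous_intros cp cq cr)
  also have "\<dots> = (LINT t:{0<..<T}|lborel. - \<zeta> * (f t * p t))"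
    by (simp add: q_def algebra_simps)
  also have "\<dots> = - \<zeta> * (LINT t:{0<..<T}|lborel. f t * p t)" by (rule set_integral_mult_right)
  also have "\<dots> = - \<zeta> * (((f T)\<^sup>2 - 1) / 2)"
    unfolding E[symmetric] by (subst si(2)) (auto intro!: continuous_intros cf cp)
  finally have "- \<zeta> * (((f T)\<^sup>2 - 1) / 2) \<ge> 0"
    using P1 P2 A_nonneg by (metis add_nonneg_nonneg mult_nonneg_nonneg)
  then have "(f T)\<^sup>2 \<le> 1" using \<zeta> by (auto simp: zero_le_mult_iff mult_le_0_iff)
  then show ?thesis by (simp add: f_def abs_square_le_1)
qed

end

section \<open>Prabhakar and binomial form of the series\<close>

context volterra_series
begin

text \<open>The terms of the double series after the substitution \<open>m = n + k\<close>, so that \<open>n\<close> counts the factors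
  \<open>\<zeta>\<close> and \<open>k\<close> the factors \<open>A\<close>.\<close>

definition row_term :: "real \<Rightarrow> real \<Rightarrow> nat \<Rightarrow> nat \<Rightarrow> real" where
  "row_term \<zeta> t n k = - \<zeta> * (real (n + k choose n) * (- A) ^ k * (- \<zeta>) ^ n *
     rl_monomial (\<beta> * real k + \<gamma> * real n + \<gamma>) t)"

text \<open>Absolute convergence over the triangle \<open>n \<le> m\<close> allows reindexing by \<open>(n, k) \<mapsto> (n + k, n)\<close>.\<close>

lemma row_term_has_sum:
  "((\<lambda>(n, k). row_term \<zeta> t n k) has_sum (- \<zeta> * vsol \<gamma> \<zeta> t)) UNIV"
proof -
  define d where "d = (\<lambda>(m, n). - \<zeta> * (real (m choose n) * (- A) ^ (m - n) * (- \<zeta>) ^ n *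
     rl_monomial (\<beta> * real (m - n) + \<gamma> * real n + \<gamma>) t))"
  let ?S = "SIGMA m:UNIV. {..m::nat}"
  obtain \<mu> where \<mu>: "\<mu> > 0" "\<And>m. vterm_abs \<gamma> \<zeta> m t \<le> exp (\<mu> * \<bar>t\<bar>) * \<mu> powr (- \<gamma>) * (1 / 2) ^ m"
    using vterm_geometric_bound[OF \<gamma>_pos, of "\<bar>\<zeta>\<bar>"] by (metis order.refl)
  have fin: "(\<lambda>n. d (m, n)) summable_on {..m}" for m by simp
  have inner: "infsum (\<lambda>n. d (m, n)) {..m} = - \<zeta> * vterm \<gamma> \<zeta> m t" for m
    by (simp add: d_def vterm_def sum_distrib_left)
  have "(\<lambda>p. norm (d p)) summable_on ?S"
  proof (rule Infinite_Sum.abs_summable_on_Sigma_iff[THEN iffD2], intro conjI ballI)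
    show "(\<lambda>y. norm (d (x, y))) summable_on {..x}" for x by simp
    have e: "infsum (\<lambda>y. norm (d (x, y))) {..x} = \<bar>\<zeta>\<bar> * vterm_abs \<gamma> \<zeta> x t" for x
      by (simp add: d_def vterm_abs_def sum_distrib_left abs_mult)
    have vnn: "0 \<le> vterm_abs \<gamma> \<zeta> x t" for x by (simp add: vterm_abs_def sum_nonneg)
    have "summable (\<lambda>x. norm (\<bar>\<zeta>\<bar> * vterm_abs \<gamma> \<zeta> x t))"
    proof (rule summable_comparison_test[OF _ summable_mult[OF summable_geometric]])
      show "\<exists>N. \<forall>n\<ge>N. norm (norm (\<bar>\<zeta>\<bar> * vterm_abs \<gamma> \<zeta> n t)) \<le> (\<bar>\<zeta>\<bar> * (exp (\<mu> * \<bar>t\<bar>) * \<mu> powr (- \<gamma>))) * (1 / 2) ^ n"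
        using mult_left_mono[OF \<mu>(2) abs_ge_zero[of \<zeta>]] vnn by (simp add: abs_mult mult.assoc)
    qed auto
    then have "(\<lambda>x. norm (\<bar>\<zeta>\<bar> * vterm_abs \<gamma> \<zeta> x t)) summable_on UNIV"
      by (intro norm_summable_imp_summable_on) simp
    then show "(\<lambda>x. norm (infsum (\<lambda>y. norm (d (x, y))) {..x})) summable_on UNIV"
      unfolding e by simp
  qed
  then have dS: "d summable_on ?S" by (rule abs_summable_summable)
  then have hs: "(d has_sum infsum d ?S) ?S" by (rule has_sum_infsum)
  have "((\<lambda>m. infsum (\<lambda>n. d (m, n)) {..m}) has_sum infsum d ?S) UNIV"
    by (rule has_sum_SigmaD[OF hs]) (rule has_sum_infsum[OF fin])
  then have "(\<lambda>m. - \<zeta> * vterm \<gamma> \<zeta> m t) sums infsum d ?S"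
    unfolding inner by (rule has_sum_imp_sums)
  moreover have "(\<lambda>m. - \<zeta> * vterm \<gamma> \<zeta> m t) sums (- \<zeta> * vsol \<gamma> \<zeta> t)"
    unfolding vsol_def by (intro sums_mult summable_sums summable_vterm \<gamma>_pos)
  ultimately have val: "infsum d ?S = - \<zeta> * vsol \<gamma> \<zeta> t" by (rule sums_unique2)
  have bij: "bij_betw (\<lambda>(n, k). (n + k, n)) UNIV ?S"
    by (rule bij_betwI[where g = "\<lambda>(m, n). (n, m - n)"]) auto
  have "((\<lambda>p. d (case p of (n, k) \<Rightarrow> (n + k, n))) has_sum (- \<zeta> * vsol \<gamma> \<zeta> t)) UNIV"
    using has_sum_reindex_bij_betw[OF bij, of d] hs val by simp
  moreover have "d (case p of (n, k) \<Rightarrow> (n + k, n)) = (case p of (n, k) \<Rightarrow> row_term \<zeta> t n k)" for p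
    by (cases p) (simp add: d_def row_term_def)
  ultimately show ?thesis by simp
qed

lemma row_sums:
  "(\<lambda>k. row_term \<zeta> t n k) sums (\<Sum>k. row_term \<zeta> t n k)"
  "(\<lambda>n. \<Sum>k. row_term \<zeta> t n k) sums (relaxation \<zeta> t - 1)"
proof -
  have hs: "((\<lambda>(n, k). row_term \<zeta> t n k) has_sum (- \<zeta> * vsol \<gamma> \<zeta> t)) (UNIV \<times> UNIV)"
    using row_term_has_sum by simp
  then have s: "(\<lambda>(n, k). row_term \<zeta> t n k) summable_on (UNIV \<times> UNIV)" by (rule has_sum_imp_summable)
  have row: "(\<lambda>k. row_term \<zeta> t n k) summable_on UNIV" for n
    using summable_on_SigmaD1[OF s, of n] by simp
  have r: "((\<lambda>k. row_term \<zeta> t n k) has_sum (\<Sum>k. row_term \<zeta> t n k)) UNIV" for n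
    using has_sum_infsum[OF row] has_sum_imp_sums sums_unique by metis
  show "(\<lambda>k. row_term \<zeta> t n k) sums (\<Sum>k. row_term \<zeta> t n k)" using has_sum_imp_sums[OF r] .
  have "((\<lambda>n. \<Sum>k. row_term \<zeta> t n k) has_sum (- \<zeta> * vsol \<gamma> \<zeta> t)) UNIV"
    using has_sum_SigmaD[OF hs] r by simp
  then show "(\<lambda>n. \<Sum>k. row_term \<zeta> t n k) sums (relaxation \<zeta> t - 1)"
    using has_sum_imp_sums by (simp add: relaxation_def)
qed

end

lemma pochhammer_as_binomial:
  "pochhammer (real n + 1) k / fact k = real (n + k choose n)"
proof -
  have "real (n + k choose k) = real (n + k) gchoose k" by (rule binomial_gbinomial)
  also have "\<dots> = pochhammer (real (n + k) - real k + 1) k / fact k" by (rule gbinomial_pochhammer')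
  finally show ?thesis using binomial_symmetric[of n "n + k"] by simp
qed

text \<open>Row \<open>n\<close> of the double series is a Prabhakar function up to the power of \<open>\<zeta>\<close>. At \<open>t = 0\<close> or \<open>\<zeta> = 0\<close>
  both sides vanish.\<close>

lemma prabhakar_row:
  assumes "0 < \<beta>" "0 < \<gamma>" "0 \<le> A" "t \<ge> 0"
  shows "complex_of_real (- (\<zeta> * t powr \<gamma>)) ^ (n + 1) *
      prabhakar (of_real \<beta>) (of_real (\<gamma> * (real n + 1) + 1)) (real n + 1) (of_real (- A * t powr \<beta>))
    = of_real (\<Sum>k. volterra_series.row_term \<beta> \<gamma> A \<zeta> t n k)"
proof -
  interpret volterra_series \<beta> \<gamma> A by standard (use assms in auto)
  define f where "f = (\<lambda>k. pochhammer (real n + 1) k * (- A * t powr \<beta>) ^ k / (fact k * Gamma (\<beta> * real k + (\<gamma> * (real n + 1) + 1))))"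
  have fr: "(- (\<zeta> * t powr \<gamma>)) ^ (n + 1) * f k = row_term \<zeta> t n k" for k
  proof (cases "t = 0")
    case True
    have "\<beta> * real k + \<gamma> * real n + \<gamma> \<noteq> 0" using exponent_pos[OF \<gamma>_pos, of k n] by simp
    then show ?thesis using True by (simp add: row_term_def rl_monomial_def)
  next
    case False
    with assms have t: "t > 0" by simp
    have p: "t powr (\<beta> * real k + \<gamma> * real n + \<gamma>) = (t powr \<beta>) ^ k * (t powr \<gamma>) ^ (n + 1)"
      using t by (simp add: powr_power powr_add mult.commute)
    have g: "\<beta> * real k + \<gamma> * real n + \<gamma> + 1 = \<beta> * real k + (\<gamma> * (real n + 1) + 1)" by (simp add: algebra_simps)
    have "(- (\<zeta> * t powr \<gamma>)) ^ (n + 1) * f k = (- \<zeta>) ^ (n + 1) * (- A) ^ k * (pochhammer (real n + 1) k / fact k) *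
       ((t powr \<beta>) ^ k * (t powr \<gamma>) ^ (n + 1) / Gamma (\<beta> * real k + (\<gamma> * (real n + 1) + 1)))"
    proof -
      have 1: "(- (\<zeta> * t powr \<gamma>)) ^ (n + 1) = (- \<zeta>) ^ (n + 1) * (t powr \<gamma>) ^ (n + 1)"
        by (subst power_mult_distrib[symmetric]) simp
      have 2: "(- A * t powr \<beta>) ^ k = (- A) ^ k * (t powr \<beta>) ^ k" by (rule power_mult_distrib)
      show ?thesis unfolding f_def 1 2
        by (simp only: times_divide_eq_left times_divide_eq_right divide_divide_eq_left mult_ac)
    qed
    then show ?thesis unfolding pochhammer_as_binomial row_term_def rl_monomial_def p g by (simp add: mult_ac)
  qed
  show ?thesis
  proof (cases "\<zeta> * t powr \<gamma> = 0")
    case True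
    then have "row_term \<zeta> t n k = 0" for k unfolding fr[symmetric] True by simp
    then show ?thesis using True by simp
  next
    case False
    have c: "complex_of_real (f k) = complex_of_real (pochhammer (real n + 1) k) * complex_of_real (- A * t powr \<beta>) ^ k / (fact k * Gamma (complex_of_real \<beta> * of_nat k + complex_of_real (\<gamma> * (real n + 1) + 1)))" for k
    proof -
      have "complex_of_real \<beta> * of_nat k + complex_of_real (\<gamma> * (real n + 1) + 1) = complex_of_real (\<beta> * real k + (\<gamma> * (real n + 1) + 1))"
        by simp
      then have "Gamma (complex_of_real \<beta> * of_nat k + complex_of_real (\<gamma> * (real n + 1) + 1)) = complex_of_real (Gamma (\<beta> * real k + (\<gamma> * (real n + 1) + 1)))"
        by (simp only: Gamma_complex_of_real)
      then show ?thesis by (simp add: f_def)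
    qed
    let ?x = "(- (\<zeta> * t powr \<gamma>)) ^ (n + 1)"
    have x: "?x \<noteq> 0" using False by simp
    have "(\<lambda>k. inverse ?x * row_term \<zeta> t n k) sums (inverse ?x * (\<Sum>k. row_term \<zeta> t n k))"
      by (intro sums_mult row_sums)
    moreover have "inverse ?x * row_term \<zeta> t n k = f k" for k unfolding fr[symmetric] by (simp only: mult.assoc[symmetric] left_inverse[OF x] mult_1)
    ultimately have "f sums (inverse ?x * (\<Sum>k. row_term \<zeta> t n k))" by simp
    then have "(\<lambda>k. complex_of_real (f k)) sums complex_of_real (inverse ?x * (\<Sum>k. row_term \<zeta> t n k))"
      by (rule sums_of_real)
    then have "prabhakar (of_real \<beta>) (of_real (\<gamma> * (real n + 1) + 1)) (real n + 1) (of_real (- A * t powr \<beta>)) = complex_of_real (inverse ?x * (\<Sum>k. row_term \<zeta> t n k))"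
      unfolding prabhakar_def c by (rule sums_unique[symmetric])
    then have "complex_of_real (- (\<zeta> * t powr \<gamma>)) ^ (n + 1) * prabhakar (of_real \<beta>) (of_real (\<gamma> * (real n + 1) + 1)) (real n + 1) (of_real (- A * t powr \<beta>))
       = complex_of_real (?x * (inverse ?x * (\<Sum>k. row_term \<zeta> t n k)))"
      by (simp only: of_real_mult of_real_power)
    also have "?x * (inverse ?x * (\<Sum>k. row_term \<zeta> t n k)) = (\<Sum>k. row_term \<zeta> t n k)"
      using x by (metis mult.assoc mult_1 right_inverse)
    finally show ?thesis .
  qed
qed

proposition relaxation_prabhakar_series:
  assumes "0 < \<beta>" "0 < \<gamma>" "0 \<le> A" "t \<ge> 0"
  shows "(\<lambda>n. complex_of_real (- (\<zeta> * t powr \<gamma>)) ^ (n + 1) *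
      prabhakar (of_real \<beta>) (of_real (\<gamma> * (real n + 1) + 1)) (real n + 1) (of_real (- A * t powr \<beta>)))
    sums (of_real (volterra_series.relaxation \<beta> \<gamma> A \<zeta> t) - 1)"
proof -
  interpret volterra_series \<beta> \<gamma> A by standard (use assms in auto)
  show ?thesis unfolding prabhakar_row[OF assms] using sums_of_real[OF row_sums(2)[of \<zeta> t], where 'a = complex] by simp
qed

text \<open>Since \<open>A = c\<^sup>2 / D\<close> and \<open>\<zeta> = c\<^sup>2 r\<^sup>2 = A D r\<^sup>2\<close>, replacing \<open>A\<^sup>m\<^sup>-\<^sup>n \<zeta>\<^sup>n\<close> by \<open>A\<^sup>m (D r\<^sup>2)\<^sup>n\<close> turns the
  Neumann terms into the terms of the statement.\<close>

proposition relaxation_binomial_series: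
  fixes \<alpha> \<beta> c D t r :: real
  assumes "0 < \<alpha>" "0 < \<beta>" "c > 0" "D > 0" "t \<ge> 0"
  defines "F \<equiv> \<lambda>m. \<Sum>n. real (m choose n) * (- (c\<^sup>2 / D) * t powr \<beta>) ^ m * (r\<^sup>2 * D * t powr \<alpha>) ^ n
                   / Gamma (\<beta> * real m + \<alpha> * real n + \<alpha> + \<beta> + 1)"
  shows "summable F"
    and "volterra_series.relaxation \<beta> (\<alpha> + \<beta>) (c\<^sup>2 / D) (c\<^sup>2 * r\<^sup>2) t = 1 - r\<^sup>2 * c\<^sup>2 * t powr (\<alpha> + \<beta>) * (\<Sum>m. F m)"
proof -
  interpret volterra_series \<beta> "\<alpha> + \<beta>" "c\<^sup>2 / D" by standard (use assms in auto)
  let ?\<zeta> = "c\<^sup>2 * r\<^sup>2"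
  have Ffin: "F m = (\<Sum>n\<le>m. real (m choose n) * (- (c\<^sup>2 / D) * t powr \<beta>) ^ m * (r\<^sup>2 * D * t powr \<alpha>) ^ n
                   / Gamma (\<beta> * real m + \<alpha> * real n + \<alpha> + \<beta> + 1))" for m
    unfolding F_def by (rule suminf_finite) (auto simp: binomial_eq_0)
  have "summable F \<and> relaxation ?\<zeta> t = 1 - r\<^sup>2 * c\<^sup>2 * t powr (\<alpha> + \<beta>) * (\<Sum>m. F m)"
  proof (cases "t = 0")
    case True
    have "F m = 0" if "m \<noteq> 0" for m unfolding Ffin using that True by (simp add: power_0_left)
    then have "summable F" by (intro summable_finite[of "{0}"]) auto
    then show ?thesis using True by (simp add: relaxation_0)
  next
    case False
    with assms have t: "t > 0" by simp
    have Fv: "t powr (\<alpha> + \<beta>) * F m = vterm (\<alpha> + \<beta>) ?\<zeta> m t" for m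
      unfolding Ffin vterm_def sum_distrib_left
    proof (intro sum.cong refl)
      fix n assume "n \<in> {..m}"
      then have nm: "n \<le> m" by simp
      let ?e = "\<beta> * real (m - n) + (\<alpha> + \<beta>) * real n + (\<alpha> + \<beta>)"
      have e: "?e = \<beta> * real m + \<alpha> * real n + (\<alpha> + \<beta>)" using nm by (simp add: of_nat_diff algebra_simps)
      have p: "t powr ?e = t powr (\<alpha> + \<beta>) * ((t powr \<beta>) ^ m * (t powr \<alpha>) ^ n)"
        unfolding e using t by (simp add: powr_power powr_add mult_ac)
      have s: "(- (c\<^sup>2 / D)) ^ m * (r\<^sup>2 * D) ^ n = (- (c\<^sup>2 / D)) ^ (m - n) * (- ?\<zeta>) ^ n"
      proof -
        have "(- (c\<^sup>2 / D)) ^ m = (- (c\<^sup>2 / D)) ^ (m - n) * (- (c\<^sup>2 / D)) ^ n" using nm by (simp flip: power_add)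
        moreover have "(- (c\<^sup>2 / D)) ^ n * (r\<^sup>2 * D) ^ n = (- ?\<zeta>) ^ n"
          using assms by (simp flip: power_mult_distrib)
        ultimately show ?thesis by (simp add: mult.assoc)
      qed
      have "t powr (\<alpha> + \<beta>) * (real (m choose n) * (- (c\<^sup>2 / D) * t powr \<beta>) ^ m * (r\<^sup>2 * D * t powr \<alpha>) ^ n
                   / Gamma (\<beta> * real m + \<alpha> * real n + \<alpha> + \<beta> + 1))
         = real (m choose n) * ((- (c\<^sup>2 / D)) ^ m * (r\<^sup>2 * D) ^ n) * ((t powr (\<alpha> + \<beta>) * ((t powr \<beta>) ^ m * (t powr \<alpha>) ^ n)) / Gamma (\<beta> * real m + \<alpha> * real n + \<alpha> + \<beta> + 1))"
        unfolding power_mult_distrib by (simp add: mult_ac)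
      also have "\<dots> = real (m choose n) * ((- (c\<^sup>2 / D)) ^ (m - n) * (- ?\<zeta>) ^ n) * rl_monomial ?e t"
      proof -
        have g: "\<beta> * real m + \<alpha> * real n + \<alpha> + \<beta> + 1 = ?e + 1" by (simp only: e)
        show ?thesis unfolding s p[symmetric] rl_monomial_def g ..
      qed
      finally show "t powr (\<alpha> + \<beta>) * (real (m choose n) * (- (c\<^sup>2 / D) * t powr \<beta>) ^ m * (r\<^sup>2 * D * t powr \<alpha>) ^ n
                   / Gamma (\<beta> * real m + \<alpha> * real n + \<alpha> + \<beta> + 1))
         = real (m choose n) * (- (c\<^sup>2 / D)) ^ (m - n) * (- ?\<zeta>) ^ n * rl_monomial ?e t"
        by (simp add: mult.assoc)
    qed
    have Fv': "F m = inverse (t powr (\<alpha> + \<beta>)) * vterm (\<alpha> + \<beta>) ?\<zeta> m t" for m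
      unfolding Fv[symmetric] using t by simp
    have sv: "summable (\<lambda>m. vterm (\<alpha> + \<beta>) ?\<zeta> m t)" by (rule summable_vterm[OF \<gamma>_pos])
    have "summable F" unfolding Fv' by (rule summable_mult[OF sv])
    moreover have "t powr (\<alpha> + \<beta>) * (\<Sum>m. F m) = vsol (\<alpha> + \<beta>) ?\<zeta> t"
      using suminf_mult[OF \<open>summable F\<close>, of "t powr (\<alpha> + \<beta>)"] by (simp add: Fv vsol_def)
    ultimately show ?thesis by (simp add: relaxation_def mult_ac)
  qed
  then show "summable F" "relaxation ?\<zeta> t = 1 - r\<^sup>2 * c\<^sup>2 * t powr (\<alpha> + \<beta>) * (\<Sum>m. F m)" by auto
qed

section \<open>Bounded sets of Schwartz functions\<close>

lemma partial_deriv_eq: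
  "(\<phi> has_derivative D) (at x) \<Longrightarrow> partial_deriv i \<phi> x = D (axis i 1)"
  by (simp add: partial_deriv_def frechet_derivative_at[symmetric])

lemma iter_partial_simps:
  "iter_partial [] \<phi> = \<phi>"
  "iter_partial (d # ds) \<phi> = partial_deriv d (iter_partial ds \<phi>)"
  "iter_partial (ds @ [d]) \<phi> = iter_partial ds (partial_deriv d \<phi>)"
  by (simp_all add: iter_partial_def)

definition rapidly_decreasing :: "(real^3 \<Rightarrow> complex) set \<Rightarrow> bool" where
  "rapidly_decreasing S \<longleftrightarrow> (\<forall>k. \<exists>C. \<forall>\<phi>\<in>S. \<forall>x. (1 + norm x) ^ k * norm (\<phi> x) \<le> C)"

text \<open>The bounded sets of the Schwartz space. A tempered distribution is bounded on each of them, and this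
  is all the continuity that is needed; it spares computing with seminorms.\<close>

definition schwartz_bounded :: "(real^3 \<Rightarrow> complex) set \<Rightarrow> bool" where
  "schwartz_bounded S \<longleftrightarrow>
     (\<forall>ds. (\<forall>\<phi>\<in>S. \<forall>x. iter_partial ds \<phi> differentiable (at x)) \<and> rapidly_decreasing (iter_partial ds ` S))"

lemma schwartz_bounded_subset: "schwartz_bounded S \<Longrightarrow> S' \<subseteq> S \<Longrightarrow> schwartz_bounded S'"
  unfolding schwartz_bounded_def rapidly_decreasing_def by (simp add: subset_iff) metis

lemma schwartz_iff_bounded: "schwartz \<phi> \<longleftrightarrow> schwartz_bounded {\<phi>}"
  unfolding schwartz_def schwartz_bounded_def rapidly_decreasing_def
  by (auto simp: bounded_iff abs_mult)

lemma schwartz_bounded_imp_schwartz: "schwartz_bounded S \<Longrightarrow> \<phi> \<in> S \<Longrightarrow> schwartz \<phi>"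
  unfolding schwartz_iff_bounded by (rule schwartz_bounded_subset) auto

lemma schwartz_bounded_differentiable: "schwartz_bounded S \<Longrightarrow> \<phi> \<in> S \<Longrightarrow> \<phi> differentiable (at x)"
  unfolding schwartz_bounded_def by (metis iter_partial_simps(1))

lemma schwartz_bounded_rapid: "schwartz_bounded S \<Longrightarrow> rapidly_decreasing S"
  unfolding schwartz_bounded_def
  by (metis (no_types, lifting) image_cong image_ident iter_partial_simps(1))

lemma schwartz_bounded_partial: "schwartz_bounded S \<Longrightarrow> schwartz_bounded (partial_deriv j ` S)"
  unfolding schwartz_bounded_def image_image
  by (simp add: iter_partial_simps(3)[symmetric])

text \<open>To show that a set is bounded it is enough to place it in a class of uniformly rapidly decreasing sets
  that is closed, up to inclusion, under partial derivatives. Higher derivatives never have to be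
  computed.\<close>

lemma schwartz_bounded_coinduct [consumes 1, case_names diff rapid partial]:
  assumes "P S"
    and diff: "\<And>S \<phi> x. P S \<Longrightarrow> \<phi> \<in> S \<Longrightarrow> \<phi> differentiable (at x)"
    and rapid: "\<And>S. P S \<Longrightarrow> rapidly_decreasing S"
    and partial: "\<And>S j. P S \<Longrightarrow> \<exists>S'. P S' \<and> partial_deriv j ` S \<subseteq> S'"
  shows "schwartz_bounded S"
proof -
  have "\<exists>S'. P S' \<and> iter_partial ds ` S \<subseteq> S'" for ds
  proof (induction ds)
    case Nil
    then show ?case using assms(1) by (auto simp: iter_partial_simps)
  next
    case (Cons d ds)
    then obtain S' where S': "P S'" "iter_partial ds ` S \<subseteq> S'" by blast
    obtain S'' where "P S''" "partial_deriv d ` S' \<subseteq> S''" using partial[OF S'(1)] by blast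
    then show ?case using S'(2) by (auto simp: iter_partial_simps image_subset_iff)
  qed
  note * = this
  show ?thesis unfolding schwartz_bounded_def
  proof (intro allI conjI ballI)
    fix ds
    obtain S' where S': "P S'" "iter_partial ds ` S \<subseteq> S'" using * by blast
    show "iter_partial ds \<phi> differentiable at x" if "\<phi> \<in> S" for \<phi> x
      using diff[OF S'(1)] S'(2) that by blast
    show "rapidly_decreasing (iter_partial ds ` S)"
      using rapid[OF S'(1)] S'(2) unfolding rapidly_decreasing_def by (meson subsetD)
  qed
qed

definition fun_sum :: "(real^3 \<Rightarrow> complex) set \<Rightarrow> (real^3 \<Rightarrow> complex) set \<Rightarrow> (real^3 \<Rightarrow> complex) set" where
  "fun_sum S S' = (\<lambda>(\<phi>, \<eta>). (\<lambda>x. \<phi> x + \<eta> x)) ` (S \<times> S')"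

definition fun_scale :: "real \<Rightarrow> (real^3 \<Rightarrow> complex) set \<Rightarrow> (real^3 \<Rightarrow> complex) set" where
  "fun_scale K S = (\<lambda>(c, \<phi>). (\<lambda>x. c * \<phi> x)) ` ({c. norm c \<le> K} \<times> S)"

definition fun_coord :: "3 \<Rightarrow> (real^3 \<Rightarrow> complex) set \<Rightarrow> (real^3 \<Rightarrow> complex) set" where
  "fun_coord i S = (\<lambda>\<phi> x. complex_of_real (x $ i) * \<phi> x) ` S"

lemma fun_sum_iff: "\<phi> \<in> fun_sum S S' \<longleftrightarrow> (\<exists>\<phi>1\<in>S. \<exists>\<phi>2\<in>S'. \<phi> = (\<lambda>x. \<phi>1 x + \<phi>2 x))"
  by (auto simp: fun_sum_def image_iff)

lemma fun_scale_iff: "\<phi> \<in> fun_scale K S \<longleftrightarrow> (\<exists>c. norm c \<le> K \<and> (\<exists>\<phi>1\<in>S. \<phi> = (\<lambda>x. c * \<phi>1 x)))"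
  by (auto simp: fun_scale_def image_iff)

lemma fun_coord_iff: "\<phi> \<in> fun_coord i S \<longleftrightarrow> (\<exists>\<phi>1\<in>S. \<phi> = (\<lambda>x. complex_of_real (x $ i) * \<phi>1 x))"
  by (auto simp: fun_coord_def image_iff)

lemma fun_sumI: "\<phi>1 \<in> S \<Longrightarrow> \<phi>2 \<in> S' \<Longrightarrow> (\<lambda>x. \<phi>1 x + \<phi>2 x) \<in> fun_sum S S'"
  unfolding fun_sum_iff by (intro bexI) (rule refl)

lemma fun_scaleI: "norm c \<le> K \<Longrightarrow> \<phi>1 \<in> S \<Longrightarrow> (\<lambda>x. c * \<phi>1 x) \<in> fun_scale K S"
  unfolding fun_scale_iff by (intro exI conjI bexI) (assumption, rule refl)

lemma fun_coordI: "\<phi>1 \<in> S \<Longrightarrow> (\<lambda>x. complex_of_real (x $ i) * \<phi>1 x) \<in> fun_coord i S"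
  unfolding fun_coord_iff by (intro bexI) (rule refl)

lemma fun_sumE:
  assumes "\<phi> \<in> fun_sum S S'"
  obtains \<phi>1 \<phi>2 where "\<phi>1 \<in> S" "\<phi>2 \<in> S'" "\<phi> = (\<lambda>x. \<phi>1 x + \<phi>2 x)"
  using assms unfolding fun_sum_iff by (elim bexE) (rule that)

lemma fun_scaleE:
  assumes "\<phi> \<in> fun_scale K S"
  obtains c \<phi>1 where "norm c \<le> K" "\<phi>1 \<in> S" "\<phi> = (\<lambda>x. c * \<phi>1 x)"
  using assms unfolding fun_scale_iff by (elim bexE exE conjE) (rule that)

lemma fun_coordE:
  assumes "\<phi> \<in> fun_coord i S"
  obtains \<phi>1 where "\<phi>1 \<in> S" "\<phi> = (\<lambda>x. complex_of_real (x $ i) * \<phi>1 x)"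
  using assms unfolding fun_coord_iff by (elim bexE) (rule that)

lemma rapidly_decreasing_sum:
  assumes "rapidly_decreasing S" "rapidly_decreasing S'"
  shows "rapidly_decreasing (fun_sum S S')"
  unfolding rapidly_decreasing_def
proof
  fix k
  obtain C C' where C: "\<And>\<phi> x. \<phi> \<in> S \<Longrightarrow> (1 + norm x) ^ k * norm (\<phi> x) \<le> C"
    "\<And>\<phi> x. \<phi> \<in> S' \<Longrightarrow> (1 + norm x) ^ k * norm (\<phi> x) \<le> C'"
    using assms unfolding rapidly_decreasing_def by metis
  have "(1 + norm x) ^ k * norm (\<phi> x + \<eta> x) \<le> C + C'" if "\<phi> \<in> S" "\<eta> \<in> S'" for \<phi> \<eta> x
  proof -
    have "(1 + norm x) ^ k * norm (\<phi> x + \<eta> x) \<le> (1 + norm x) ^ k * (norm (\<phi> x) + norm (\<eta> x))"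
      by (intro mult_left_mono norm_triangle_ineq) auto
    also have "\<dots> \<le> C + C'" using C(1)[OF that(1), of x] C(2)[OF that(2), of x] by (simp add: distrib_left)
    finally show ?thesis .
  qed
  then show "\<exists>C. \<forall>\<phi>\<in>fun_sum S S'. \<forall>x. (1 + norm x) ^ k * norm (\<phi> x) \<le> C"
    unfolding fun_sum_def by fastforce
qed

lemma rapidly_decreasing_scale:
  assumes "rapidly_decreasing S"
  shows "rapidly_decreasing (fun_scale K S)"
  unfolding rapidly_decreasing_def
proof
  fix k
  obtain C where C: "\<And>\<phi> x. \<phi> \<in> S \<Longrightarrow> (1 + norm x) ^ k * norm (\<phi> x) \<le> C"
    using assms unfolding rapidly_decreasing_def by metis
  have "(1 + norm x) ^ k * norm (c * \<phi> x) \<le> K * C" if "\<phi> \<in> S" "norm c \<le> K" for \<phi> c x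
  proof -
    have "(1 + norm x) ^ k * norm (c * \<phi> x) = norm c * ((1 + norm x) ^ k * norm (\<phi> x))"
      by (simp add: norm_mult)
    also have "\<dots> \<le> K * C"
      by (rule mult_mono[OF that(2) C[OF that(1)]]) (use order_trans[OF norm_ge_zero that(2)] in auto)
    finally show ?thesis .
  qed
  then show "\<exists>C. \<forall>\<phi>\<in>fun_scale K S. \<forall>x. (1 + norm x) ^ k * norm (\<phi> x) \<le> C"
    unfolding fun_scale_def by fastforce
qed

lemma rapidly_decreasing_coord:
  assumes "rapidly_decreasing S"
  shows "rapidly_decreasing (fun_coord i S)"
  unfolding rapidly_decreasing_def
proof
  fix k
  obtain C where C: "\<And>\<phi> x. \<phi> \<in> S \<Longrightarrow> (1 + norm x) ^ Suc k * norm (\<phi> x) \<le> C"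
    using assms unfolding rapidly_decreasing_def by metis
  have "(1 + norm x) ^ k * norm (complex_of_real (x $ i) * \<phi> x) \<le> C" if "\<phi> \<in> S" for \<phi> x
  proof -
    have "\<bar>x $ i\<bar> \<le> 1 + norm x" using component_le_norm_cart[of x i] by simp
    then have "\<bar>x $ i\<bar> * ((1 + norm x) ^ k * norm (\<phi> x)) \<le> (1 + norm x) * ((1 + norm x) ^ k * norm (\<phi> x))"
      by (rule mult_right_mono) simp
    also have "\<dots> \<le> C" using C[OF that, of x] by (simp add: mult.assoc)
    finally show ?thesis by (simp add: norm_mult mult_ac)
  qed
  then show "\<exists>C. \<forall>\<phi>\<in>fun_coord i S. \<forall>x. (1 + norm x) ^ k * norm (\<phi> x) \<le> C"
    unfolding fun_coord_def by fastforce
qed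

lemma has_derivative_coord:
  "((\<lambda>x::real^3. complex_of_real (x $ i)) has_derivative (\<lambda>v. complex_of_real (v $ i))) (at x)"
  by (intro has_derivative_of_real bounded_linear.has_derivative[OF bounded_linear_vec_nth] has_derivative_ident)

lemma partial_deriv_sum:
  assumes "\<And>x. \<phi> differentiable (at x)" "\<And>x. \<eta> differentiable (at x)"
  shows "partial_deriv j (\<lambda>x. \<phi> x + \<eta> x) = (\<lambda>x. partial_deriv j \<phi> x + partial_deriv j \<eta> x)"
proof
  fix x
  have "((\<lambda>x. \<phi> x + \<eta> x) has_derivative (\<lambda>v. frechet_derivative \<phi> (at x) v + frechet_derivative \<eta> (at x) v)) (at x)"
    using assms by (intro has_derivative_add) (simp_all add: frechet_derivative_works)
  then show "partial_deriv j (\<lambda>x. \<phi> x + \<eta> x) x = partial_deriv j \<phi> x + partial_deriv j \<eta> x"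
    by (subst partial_deriv_eq) (auto simp: partial_deriv_def)
qed

lemma partial_deriv_mult:
  assumes "\<And>x. \<phi> differentiable (at x)" "\<And>x. \<eta> differentiable (at x)"
  shows "partial_deriv j (\<lambda>x. \<phi> x * \<eta> x) = (\<lambda>x. \<phi> x * partial_deriv j \<eta> x + partial_deriv j \<phi> x * \<eta> x)"
proof
  fix x
  have "((\<lambda>x. \<phi> x * \<eta> x) has_derivative (\<lambda>v. \<phi> x * frechet_derivative \<eta> (at x) v + frechet_derivative \<phi> (at x) v * \<eta> x)) (at x)"
    using assms by (intro has_derivative_mult) (simp_all add: frechet_derivative_works)
  then show "partial_deriv j (\<lambda>x. \<phi> x * \<eta> x) x = \<phi> x * partial_deriv j \<eta> x + partial_deriv j \<phi> x * \<eta> x"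
    by (subst partial_deriv_eq) (auto simp: partial_deriv_def)
qed

lemma partial_deriv_const: "partial_deriv j (\<lambda>x. c) = (\<lambda>x. 0)"
  by (rule ext, subst partial_deriv_eq, rule has_derivative_const) simp

lemma partial_deriv_scale:
  assumes "\<And>x. \<phi> differentiable (at x)"
  shows "partial_deriv j (\<lambda>x. c * \<phi> x) = (\<lambda>x. c * partial_deriv j \<phi> x)"
  using partial_deriv_mult[of "\<lambda>_. c" \<phi> j] assms by (simp add: partial_deriv_const)

lemma coord_differentiable: "(\<lambda>x::real^3. complex_of_real (x $ i)) differentiable (at x)"
  using has_derivative_coord differentiable_def by blast

lemma partial_deriv_coord:
  assumes "\<And>x. \<phi> differentiable (at x)"
  shows "partial_deriv j (\<lambda>x. complex_of_real (x $ i) * \<phi> x) =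
    (\<lambda>x. complex_of_real (x $ i) * partial_deriv j \<phi> x + (if i = j then 1 else 0) * \<phi> x)"
proof -
  have "partial_deriv j (\<lambda>x. complex_of_real (x $ i)) = (\<lambda>x. if i = j then 1 else 0)"
    by (rule ext, subst partial_deriv_eq, rule has_derivative_coord) (simp add: axis_def)
  then show ?thesis
    using partial_deriv_mult[of "\<lambda>x. complex_of_real (x $ i)" \<phi> j] assms coord_differentiable by simp
qed

lemma schwartz_bounded_sum:
  assumes "schwartz_bounded S" "schwartz_bounded S'"
  shows "schwartz_bounded (fun_sum S S')"
proof -
  let ?P = "\<lambda>S. \<exists>S1 S2. S = fun_sum S1 S2 \<and> schwartz_bounded S1 \<and> schwartz_bounded S2"
  show ?thesis
  proof (rule schwartz_bounded_coinduct[where P = ?P])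
    show "?P (fun_sum S S')" using assms by blast
  next
    fix S \<phi> x assume "?P S" "\<phi> \<in> S"
    then show "\<phi> differentiable at x"
      by (auto simp: fun_sum_iff intro!: differentiable_add) (blast intro: schwartz_bounded_differentiable)+
  next
    fix S assume "?P S"
    then show "rapidly_decreasing S" by (elim exE conjE) (simp add: rapidly_decreasing_sum schwartz_bounded_rapid)
  next
    fix S j assume "?P S"
    then obtain S1 S2 where S: "S = fun_sum S1 S2" "schwartz_bounded S1" "schwartz_bounded S2" by blast
    have "partial_deriv j \<phi> \<in> fun_sum (partial_deriv j ` S1) (partial_deriv j ` S2)" if "\<phi> \<in> S" for \<phi>
    proof -
      from that obtain \<phi>1 \<phi>2 where \<phi>: "\<phi>1 \<in> S1" "\<phi>2 \<in> S2" "\<phi> = (\<lambda>x. \<phi>1 x + \<phi>2 x)"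
        unfolding S(1) by (rule fun_sumE)
      have "partial_deriv j \<phi> = (\<lambda>x. partial_deriv j \<phi>1 x + partial_deriv j \<phi>2 x)"
        unfolding \<phi>(3) using schwartz_bounded_differentiable S \<phi> by (intro partial_deriv_sum) blast+
      then show ?thesis unfolding fun_sum_iff using \<phi> by blast
    qed
    then show "\<exists>S'. ?P S' \<and> partial_deriv j ` S \<subseteq> S'" using schwartz_bounded_partial S(2,3) by blast
  qed
qed

lemma schwartz_bounded_scale:
  assumes "schwartz_bounded S"
  shows "schwartz_bounded (fun_scale K S)"
proof -
  let ?P = "\<lambda>S. \<exists>S1. S = fun_scale K S1 \<and> schwartz_bounded S1"
  show ?thesis
  proof (rule schwartz_bounded_coinduct[where P = ?P])
    show "?P (fun_scale K S)" using assms by blast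
  next
    fix S \<phi> x assume "?P S" "\<phi> \<in> S"
    then show "\<phi> differentiable at x"
      by (auto simp: fun_scale_iff intro!: differentiable_mult) (blast intro: schwartz_bounded_differentiable)+
  next
    fix S assume "?P S"
    then show "rapidly_decreasing S" by (elim exE conjE) (simp add: rapidly_decreasing_scale schwartz_bounded_rapid)
  next
    fix S j assume "?P S"
    then obtain S1 where S: "S = fun_scale K S1" "schwartz_bounded S1" by blast
    have "partial_deriv j \<phi> \<in> fun_scale K (partial_deriv j ` S1)" if "\<phi> \<in> S" for \<phi>
    proof -
      from that obtain c \<phi>1 where \<phi>: "norm c \<le> K" "\<phi>1 \<in> S1" "\<phi> = (\<lambda>x. c * \<phi>1 x)"
        unfolding S(1) by (rule fun_scaleE)
      have "partial_deriv j \<phi> = (\<lambda>x. c * partial_deriv j \<phi>1 x)"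
        unfolding \<phi>(3) using schwartz_bounded_differentiable S \<phi> by (intro partial_deriv_scale) blast+
      then show ?thesis unfolding fun_scale_iff using \<phi> by blast
    qed
    then show "\<exists>S'. ?P S' \<and> partial_deriv j ` S \<subseteq> S'" using schwartz_bounded_partial S(2) by blast
  qed
qed

text \<open>The derivative of \<open>x\<^sub>i \<phi>\<close> has the form \<open>x\<^sub>i \<phi>' + \<chi>\<close>, so the coinduction runs over sums of this form.\<close>

lemma schwartz_bounded_coord:
  assumes "schwartz_bounded S"
  shows "schwartz_bounded (fun_coord i S)"
proof -
  let ?P = "\<lambda>S. \<exists>S1 S2. S = fun_sum (fun_coord i S1) S2 \<and> schwartz_bounded S1 \<and> schwartz_bounded S2"
  have "schwartz_bounded (fun_sum (fun_coord i S) (fun_scale 0 S))"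
  proof (rule schwartz_bounded_coinduct[where P = ?P])
    show "?P (fun_sum (fun_coord i S) (fun_scale 0 S))" using assms schwartz_bounded_scale by blast
  next
    fix S \<phi> x assume "?P S" "\<phi> \<in> S"
    then show "\<phi> differentiable at x"
      by (auto simp: fun_sum_iff fun_coord_iff intro!: differentiable_add differentiable_mult coord_differentiable) (blast intro: schwartz_bounded_differentiable)+
  next
    fix S assume "?P S"
    then show "rapidly_decreasing S"
      by (elim exE conjE) (simp add: rapidly_decreasing_sum rapidly_decreasing_coord schwartz_bounded_rapid)
  next
    fix S j assume "?P S"
    then obtain S1 S2 where S: "S = fun_sum (fun_coord i S1) S2" "schwartz_bounded S1" "schwartz_bounded S2" by blast
    define S2' where "S2' = fun_sum (fun_scale 1 S1) (partial_deriv j ` S2)"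
    have "partial_deriv j ` S \<subseteq> fun_sum (fun_coord i (partial_deriv j ` S1)) S2'"
    proof safe
      fix \<phi> assume "\<phi> \<in> S"
      then obtain \<phi>0 \<phi>2 where \<phi>0: "\<phi>0 \<in> fun_coord i S1" "\<phi>2 \<in> S2" "\<phi> = (\<lambda>x. \<phi>0 x + \<phi>2 x)"
        unfolding S(1) by (rule fun_sumE)
      obtain \<phi>1 where \<phi>1: "\<phi>1 \<in> S1" "\<phi>0 = (\<lambda>x. complex_of_real (x $ i) * \<phi>1 x)"
        by (rule fun_coordE[OF \<phi>0(1)])
      have \<phi>: "\<phi> = (\<lambda>x. complex_of_real (x $ i) * \<phi>1 x + \<phi>2 x)" "\<phi>1 \<in> S1" "\<phi>2 \<in> S2"
        using \<phi>0 \<phi>1 by auto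
      have d: "\<phi>1 differentiable at x" "\<phi>2 differentiable at x" for x
        using schwartz_bounded_differentiable S \<phi> by blast+
      have "partial_deriv j \<phi> = (\<lambda>x. complex_of_real (x $ i) * partial_deriv j \<phi>1 x + ((if i = j then 1 else 0) * \<phi>1 x + partial_deriv j \<phi>2 x))"
        unfolding \<phi>(1) using d
        by (subst partial_deriv_sum) (auto intro!: differentiable_mult coord_differentiable simp: partial_deriv_coord add.assoc)
      moreover have "(\<lambda>x. (if i = j then 1 else 0) * \<phi>1 x + partial_deriv j \<phi>2 x) \<in> S2'"
        unfolding S2'_def fun_sum_iff fun_scale_iff using \<phi>
        by (intro bexI[of _ "\<lambda>x. (if i = j then 1 else 0) * \<phi>1 x"] bexI[of _ "partial_deriv j \<phi>2"] refl CollectI exI[of _ "if i = j then 1 else 0"])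
           (auto simp: fun_scale_iff intro!: exI[of _ "if i = j then 1 else 0"] bexI[of _ \<phi>1])
      ultimately show "partial_deriv j \<phi> \<in> fun_sum (fun_coord i (partial_deriv j ` S1)) S2'"
        unfolding fun_sum_iff using \<phi>
        by (intro bexI[of _ "\<lambda>x. complex_of_real (x $ i) * partial_deriv j \<phi>1 x"] bexI[of _ "\<lambda>x. (if i = j then 1 else 0) * \<phi>1 x + partial_deriv j \<phi>2 x"])
           (auto simp: fun_coord_iff)
    qed
    moreover have "schwartz_bounded S2'"
      unfolding S2'_def by (intro schwartz_bounded_sum schwartz_bounded_scale schwartz_bounded_partial S)
    ultimately show "\<exists>S'. ?P S' \<and> partial_deriv j ` S \<subseteq> S'"
      using schwartz_bounded_partial[OF S(2)] by blast
  qed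
  moreover have "fun_coord i S \<subseteq> fun_sum (fun_coord i S) (fun_scale 0 S)"
  proof
    fix \<phi> assume "\<phi> \<in> fun_coord i S"
    then obtain \<phi>1 where "\<phi> = (\<lambda>x. complex_of_real (x $ i) * \<phi>1 x)" "\<phi>1 \<in> S" by (auto simp: fun_coord_def)
    then show "\<phi> \<in> fun_sum (fun_coord i S) (fun_scale 0 S)"
      unfolding fun_sum_def fun_coord_def fun_scale_def
      by (force intro!: image_eqI[where x = "(\<phi>, \<lambda>x. 0 * \<phi>1 x)"] image_eqI[where x = "(0, \<phi>1)"])
  qed
  ultimately show ?thesis by (rule schwartz_bounded_subset)
qed

lemma schwartz_sum: "schwartz \<phi> \<Longrightarrow> schwartz \<eta> \<Longrightarrow> schwartz (\<lambda>x. \<phi> x + \<eta> x)"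
  unfolding schwartz_iff_bounded using schwartz_bounded_sum[of "{\<phi>}" "{\<eta>}"] by (simp add: fun_sum_def)

lemma schwartz_scale: "schwartz \<phi> \<Longrightarrow> schwartz (\<lambda>x. c * \<phi> x)"
  unfolding schwartz_iff_bounded using schwartz_bounded_scale[of "{\<phi>}" "norm c"]
  by (rule schwartz_bounded_subset) (auto simp: fun_scale_def)

lemma schwartz_coord: "schwartz \<phi> \<Longrightarrow> schwartz (\<lambda>x. complex_of_real (x $ i) * \<phi> x)"
  unfolding schwartz_iff_bounded using schwartz_bounded_coord[of "{\<phi>}" i] by (simp add: fun_coord_def)

lemma schwartz_partial: "schwartz \<phi> \<Longrightarrow> schwartz (partial_deriv j \<phi>)"
  unfolding schwartz_iff_bounded using schwartz_bounded_partial[of "{\<phi>}" j] by simp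

lemma schwartz_iter_partial: "schwartz \<phi> \<Longrightarrow> schwartz (iter_partial ds \<phi>)"
  by (induction ds) (auto simp: iter_partial_simps schwartz_partial)

lemma schwartz_differentiable: "schwartz \<phi> \<Longrightarrow> \<phi> differentiable (at x)"
  unfolding schwartz_iff_bounded by (erule schwartz_bounded_differentiable) simp

lemma norm_cart3_squared: "(norm (x :: real^3))\<^sup>2 = (\<Sum>i\<in>UNIV. (x $ i)\<^sup>2)"
  by (simp add: norm_vec_def L2_set_def sum_nonneg)

lemma schwartz_norm_squared:
  assumes "schwartz \<phi>" shows "schwartz (\<lambda>x. complex_of_real ((norm x)\<^sup>2) * \<phi> x)"
proof -
  have "schwartz (\<lambda>x. complex_of_real (x $ 1) * (complex_of_real (x $ 1) * \<phi> x) + (complex_of_real (x $ 2) * (complex_of_real (x $ 2) * \<phi> x) + complex_of_real (x $ 3) * (complex_of_real (x $ 3) * \<phi> x)))"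
    by (intro schwartz_sum schwartz_coord assms)
  then show ?thesis
    unfolding norm_cart3_squared sum_3 by (simp add: power2_eq_square algebra_simps)
qed

lemma schwartz_laplacian: "schwartz \<phi> \<Longrightarrow> schwartz (laplacian \<phi>)"
  unfolding laplacian_def[abs_def] sum_3 by (intro schwartz_sum schwartz_partial)

text \<open>There are only finitely many multi-indices of length at most \<open>N\<close>, so the \<open>N\<close>-th Schwartz norm is bounded
  on the set.\<close>

lemma tempered_distribution_bounded:
  assumes "tempered_distribution T" "schwartz_bounded S"
  shows "\<exists>C. \<forall>\<phi>\<in>S. norm (T \<phi>) \<le> C"
proof -
  obtain C N where CN: "\<And>\<phi>. schwartz \<phi> \<Longrightarrow> norm (T \<phi>) \<le> C * schwartz_norm N \<phi>"
    using assms(1) unfolding tempered_distribution_def by blast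
  let ?L = "{ds :: 3 list. length ds \<le> N}"
  have fin: "finite ?L"
    using finite_lists_length_le[of "UNIV :: 3 set" N] by simp
  have "\<forall>ds. \<exists>B. \<forall>\<phi>\<in>S. \<forall>x. (1 + norm x) ^ N * norm (iter_partial ds \<phi> x) \<le> B"
    using assms(2) unfolding schwartz_bounded_def rapidly_decreasing_def by simp
  then obtain B where B: "\<And>ds \<phi> x. \<phi> \<in> S \<Longrightarrow> (1 + norm x) ^ N * norm (iter_partial ds \<phi> x) \<le> B ds" by metis
  define M where "M = (\<Sum>ds\<in>?L. \<bar>B ds\<bar>)"
  have BM: "(1 + norm x) ^ N * norm (iter_partial ds \<phi> x) \<le> M" if "\<phi> \<in> S" "ds \<in> ?L" for \<phi> ds x
  proof -
    have "\<bar>B ds\<bar> \<le> M" unfolding M_def by (rule member_le_sum) (use that fin in auto)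
    then show ?thesis using B[OF that(1), of x ds] by linarith
  qed
  have "norm (T \<phi>) \<le> \<bar>C\<bar> * M" if \<phi>: "\<phi> \<in> S" for \<phi>
  proof -
    let ?f = "\<lambda>(ds, x). (1 + norm x) ^ N * norm (iter_partial ds \<phi> x)"
    have le: "schwartz_norm N \<phi> \<le> M"
      unfolding schwartz_norm_def by (rule cSUP_least) (use BM[OF \<phi>] in \<open>auto intro: exI[of _ "[]"]\<close>)
    have "bdd_above (?f ` (?L \<times> UNIV))" by (rule bdd_aboveI2[where M = M]) (use BM[OF \<phi>] in auto)
    then have "?f ([], 0) \<le> schwartz_norm N \<phi>"
      unfolding schwartz_norm_def by (intro cSUP_upper) auto
    then have ge: "0 \<le> schwartz_norm N \<phi>"
      by (rule order_trans[rotated]) simp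
    have "norm (T \<phi>) \<le> C * schwartz_norm N \<phi>" by (rule CN) (use assms(2) \<phi> schwartz_bounded_imp_schwartz in blast)
    also have "\<dots> \<le> \<bar>C\<bar> * M" using le ge by (intro mult_mono) auto
    finally show ?thesis .
  qed
  then show ?thesis by blast
qed

section \<open>The Fourier transform on Schwartz functions\<close>

text \<open>Compare with a sum over balls of radius \<open>n + 1\<close>: the volume grows like \<open>n\<^sup>3\<close> and the weight is at most
  \<open>n\<^sup>-\<^sup>5\<close>.\<close>

lemma integrable_polynomial_weight:
  "integrable lborel (\<lambda>x::real^3. 1 / (1 + norm x) ^ 5)"
proof (rule integrableI_nonneg)
  define V where "V = unit_ball_vol (real DIM(real^3))"
  have V: "V \<ge> 0" by (simp add: V_def)
  have "(\<integral>\<^sup>+x. ennreal (1 / (1 + norm (x::real^3)) ^ 5) \<partial>lborel)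
      \<le> (\<integral>\<^sup>+x. (\<Sum>n. ennreal (1 / real (Suc n) ^ 5) * indicator (cball (0::real^3) (real (Suc n))) x) \<partial>lborel)"
  proof (rule nn_integral_mono)
    fix x :: "real^3"
    \<comment> \<open>The ball of radius \<open>n + 1\<close> contains \<open>x\<close>, and \<open>n + 1\<close> is at most \<open>1 + \<parallel>x\<parallel>\<close>.\<close>
    define n where "n = nat \<lfloor>norm x\<rfloor>"
    have n: "norm x \<le> real (Suc n)" "real (Suc n) \<le> 1 + norm x"
      unfolding n_def using of_nat_floor[of "norm x"] by (linarith, simp)
    have "ennreal (1 / (1 + norm x) ^ 5) \<le> ennreal (1 / real (Suc n) ^ 5)"
      using n by (intro ennreal_leI divide_left_mono power_mono mult_pos_pos) auto
    also have "\<dots> = (\<Sum>m\<in>{n}. ennreal (1 / real (Suc m) ^ 5) * indicator (cball (0::real^3) (real (Suc m))) x)"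
      using n by (simp add: indicator_def)
    also have "\<dots> \<le> (\<Sum>m. ennreal (1 / real (Suc m) ^ 5) * indicator (cball (0::real^3) (real (Suc m))) x)"
      by (intro sum_le_suminf) auto
    finally show "ennreal (1 / (1 + norm x) ^ 5) \<le> (\<Sum>m. ennreal (1 / real (Suc m) ^ 5) * indicator (cball (0::real^3) (real (Suc m))) x)" .
  qed
  also have "\<dots> = (\<Sum>n. \<integral>\<^sup>+x. ennreal (1 / real (Suc n) ^ 5) * indicator (cball (0::real^3) (real (Suc n))) x \<partial>lborel)"
    by (rule nn_integral_suminf) (intro borel_measurable_times_ennreal borel_measurable_const borel_measurable_indicator; simp)
  also have "\<dots> = (\<Sum>n. ennreal (V * inverse (real (Suc n) ^ 2)))"
  proof (rule suminf_cong)
    fix n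
    have "(\<integral>\<^sup>+x. ennreal (1 / real (Suc n) ^ 5) * indicator (cball (0::real^3) (real (Suc n))) x \<partial>lborel)
       = ennreal (1 / real (Suc n) ^ 5) * emeasure lborel (cball (0::real^3) (real (Suc n)))"
      by (subst nn_integral_cmult_indicator) auto
    also have "emeasure lborel (cball (0::real^3) (real (Suc n))) = ennreal (V * real (Suc n) ^ 3)"
      by (subst emeasure_cball) (auto simp: V_def)
    also have "ennreal (1 / real (Suc n) ^ 5) * ennreal (V * real (Suc n) ^ 3) = ennreal (V * inverse (real (Suc n) ^ 2))"
    proof -
      have "1 / q ^ 5 * (V * q ^ 3) = V * inverse (q ^ 2)" if "q > 0" for q :: real
        using that by (simp add: field_simps flip: power_add)
      from this[of "real (Suc n)"] show ?thesis using V by (subst ennreal_mult[symmetric]) auto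
    qed
    finally show "(\<integral>\<^sup>+x. ennreal (1 / real (Suc n) ^ 5) * indicator (cball (0::real^3) (real (Suc n))) x \<partial>lborel) = ennreal (V * inverse (real (Suc n) ^ 2))" .
  qed
  also have "\<dots> < \<infinity>"
  proof -
    have "summable (\<lambda>n. inverse (real n ^ 2))" by (rule inverse_power_summable) simp
    then have "summable (\<lambda>n. inverse (real (Suc n) ^ 2))" by (subst summable_Suc_iff)
    then have "summable (\<lambda>n. V * inverse (real (Suc n) ^ 2))" by (rule summable_mult)
    then show ?thesis using V by (subst suminf_ennreal2) (auto simp: top_unique)
  qed
  finally show "(\<integral>\<^sup>+x. ennreal (1 / (1 + norm (x::real^3)) ^ 5) \<partial>lborel) < \<infinity>" .
qed auto

lemma schwartz_continuous: "schwartz \<phi> \<Longrightarrow> continuous_on UNIV \<phi>"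
  by (simp add: continuous_at_imp_continuous_on differentiable_imp_continuous_within schwartz_differentiable)

lemma schwartz_measurable: "schwartz \<phi> \<Longrightarrow> \<phi> \<in> borel_measurable borel"
  by (intro borel_measurable_continuous_onI schwartz_continuous)

lemma schwartz_weight:
  assumes "schwartz \<phi>"
  obtains C where "C \<ge> 0" "\<And>x. (1 + norm x) ^ k * norm (\<phi> x) \<le> C"
proof -
  have "rapidly_decreasing {\<phi>}" using assms unfolding schwartz_iff_bounded by (rule schwartz_bounded_rapid)
  then obtain C where C: "\<And>x. (1 + norm x) ^ k * norm (\<phi> x) \<le> C" unfolding rapidly_decreasing_def by auto
  have "(1 + norm (0::real^3)) ^ k * norm (\<phi> 0) \<ge> 0" by simp
  then have "C \<ge> 0" using C[of 0] by linarith
  then show thesis using that C by blast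
qed

lemma integrable_weight5:
  fixes f :: "real^3 \<Rightarrow> complex"
  assumes "f \<in> borel_measurable borel" "\<And>x. (1 + norm x) ^ 5 * norm (f x) \<le> C"
  shows "integrable lborel f" "(LINT x|lborel. norm (f x)) \<le> C * (LINT x|lborel. 1 / (1 + norm (x::real^3)) ^ 5)"
proof -
  have b: "norm (f x) \<le> C * (1 / (1 + norm x) ^ 5)" for x
  proof -
    have "(1 + norm x) ^ 5 > 0" by (intro zero_less_power) (simp add: add_pos_nonneg)
    then show ?thesis using assms(2)[of x] by (simp add: field_simps)
  qed
  have i: "integrable lborel (\<lambda>x::real^3. C * (1 / (1 + norm x) ^ 5))"
    using integrable_polynomial_weight by (rule integrable_mult_right)
  show f: "integrable lborel f"
  proof (rule Bochner_Integration.integrable_bound[OF i])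
    show "f \<in> borel_measurable lborel" using assms(1) by simp
    show "AE x in lborel. norm (f x) \<le> norm (C * (1 / (1 + norm x) ^ 5))"
      by (intro AE_I2 order_trans[OF b]) (simp only: real_norm_def abs_ge_self)
  qed
  have "(LINT x|lborel. norm (f x)) \<le> (LINT x|lborel. C * (1 / (1 + norm (x::real^3)) ^ 5))"
    by (intro integral_mono integrable_norm f i b)
  then show "(LINT x|lborel. norm (f x)) \<le> C * (LINT x|lborel. 1 / (1 + norm (x::real^3)) ^ 5)"
    by (simp only: Bochner_Integration.integral_mult_right_zero)
qed

lemma schwartz_integrable: "schwartz \<phi> \<Longrightarrow> integrable lborel \<phi>"
  by (rule schwartz_weight[of \<phi> 5]) (auto intro: integrable_weight5(1)[OF schwartz_measurable])

lemma norm_exp_ii: "norm (exp (\<i> * complex_of_real r)) = 1"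
  by (simp add: norm_exp_eq_Re)

lemma fourier_integrable:
  assumes "integrable lborel \<phi>"
  shows "integrable lborel (\<lambda>\<kappa>::real^3. exp (\<i> * complex_of_real (\<kappa> \<bullet> x)) * \<phi> \<kappa>)"
proof (rule Bochner_Integration.integrable_bound[OF assms])
  have "\<phi> \<in> borel_measurable lborel" using assms by (rule borel_measurable_integrable)
  then show "(\<lambda>\<kappa>. exp (\<i> * complex_of_real (\<kappa> \<bullet> x)) * \<phi> \<kappa>) \<in> borel_measurable lborel" by measurable
qed (auto simp: norm_mult norm_exp_ii)

lemma norm_fourier_le: "norm (fourier \<phi> x) \<le> (LINT \<kappa>|lborel. norm (\<phi> \<kappa>))"
proof -
  have "norm (fourier \<phi> x) \<le> (LINT \<kappa>|lborel. norm (exp (\<i> * complex_of_real (\<kappa> \<bullet> x)) * \<phi> \<kappa>))"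
    unfolding fourier_def by (rule integral_norm_bound)
  then show ?thesis by (simp add: norm_mult norm_exp_ii)
qed

lemma fourier_add:
  assumes "integrable lborel \<phi>" "integrable lborel \<psi>"
  shows "fourier (\<lambda>\<kappa>. \<phi> \<kappa> + \<psi> \<kappa>) x = fourier \<phi> x + fourier \<psi> x"
  unfolding fourier_def distrib_left
  by (rule Bochner_Integration.integral_add) (intro fourier_integrable assms)+

lemma fourier_scale: "fourier (\<lambda>\<kappa>. c * \<phi> \<kappa>) x = c * fourier \<phi> x"
  unfolding fourier_def by (simp add: mult.left_commute)

lemma fourier_at_0: "fourier \<phi> 0 = (LINT \<kappa>|lborel. \<phi> \<kappa>)"
  by (simp add: fourier_def)

lemma norm_exp_ii_remainder: "norm (exp (\<i> * complex_of_real r) - 1 - \<i> * complex_of_real r) \<le> r\<^sup>2"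
  using Taylor_exp[of "\<i> * complex_of_real r" 1]
  by (simp add: norm_mult power2_eq_square algebra_simps)

text \<open>Differentiation under the integral sign with an explicit remainder: the second-order Taylor bound for
  \<open>exp (i r)\<close> makes the error at most \<open>\<parallel>v\<parallel>\<^sup>2\<close> times the second absolute moment of \<open>\<phi>\<close>.\<close>

lemma has_derivative_fourier:
  assumes "schwartz \<phi>"
  shows "(fourier \<phi> has_derivative (\<lambda>v. LINT \<kappa>|lborel. (\<i> * complex_of_real (\<kappa> \<bullet> v)) * (exp (\<i> * complex_of_real (\<kappa> \<bullet> x)) * \<phi> \<kappa>))) (at x)"
proof -
  let ?e = "\<lambda>\<kappa>. exp (\<i> * complex_of_real (\<kappa> \<bullet> x)) * \<phi> \<kappa>"
  let ?L = "\<lambda>v. LINT \<kappa>|lborel. (\<i> * complex_of_real (\<kappa> \<bullet> v)) * ?e \<kappa>"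
  have i1: "integrable lborel (\<lambda>\<kappa>. complex_of_real (\<kappa> $ i) * ?e \<kappa>)" for i
    using fourier_integrable[OF schwartz_integrable[OF schwartz_coord[OF assms, of i]], of x]
    by (simp add: mult_ac)
  have iv: "integrable lborel (\<lambda>\<kappa>. (\<i> * complex_of_real (\<kappa> \<bullet> v)) * ?e \<kappa>)" for v
  proof -
    have "integrable lborel (\<lambda>\<kappa>. \<Sum>i\<in>UNIV. (\<i> * complex_of_real (v $ i)) * (complex_of_real (\<kappa> $ i) * ?e \<kappa>))"
      by (intro Bochner_Integration.integrable_sum integrable_mult_right i1)
    then show ?thesis by (simp add: inner_vec_def sum_distrib_left sum_distrib_right mult_ac)
  qed
  have i2: "integrable lborel (\<lambda>\<kappa>. complex_of_real ((norm \<kappa>)\<^sup>2) * \<phi> \<kappa>)"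
    by (intro schwartz_integrable schwartz_norm_squared assms)
  define M where "M = (LINT \<kappa>|lborel. (norm \<kappa>)\<^sup>2 * norm (\<phi> \<kappa>))"
  have M: "integrable lborel (\<lambda>\<kappa>. (norm \<kappa>)\<^sup>2 * norm (\<phi> \<kappa>))"
    using integrable_norm[OF i2] by (simp add: norm_mult norm_power)
  have lin: "linear ?L"
  proof (rule linearI)
    show "?L (v + w) = ?L v + ?L w" for v w
      using iv[of v] iv[of w] by (subst Bochner_Integration.integral_add[symmetric]) (auto simp: inner_add_right algebra_simps)
    show "?L (r *\<^sub>R v) = r *\<^sub>R ?L v" for r v
      by (subst integral_scaleR_right[symmetric]) (simp add: scaleR_conv_of_real[where 'a = complex] mult_ac)
  qed
  have rem: "norm (fourier \<phi> (x + v) - fourier \<phi> x - ?L v) \<le> M * (norm v)\<^sup>2" for v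
  proof -
    have i3: "integrable lborel (\<lambda>\<kappa>. exp (\<i> * complex_of_real (\<kappa> \<bullet> y)) * \<phi> \<kappa>)" for y
      by (intro fourier_integrable schwartz_integrable assms)
    let ?D = "\<lambda>\<kappa>. exp (\<i> * complex_of_real (\<kappa> \<bullet> (x + v))) * \<phi> \<kappa> - ?e \<kappa> - (\<i> * complex_of_real (\<kappa> \<bullet> v)) * ?e \<kappa>"
    have eq: "fourier \<phi> (x + v) - fourier \<phi> x - ?L v = (LINT \<kappa>|lborel. ?D \<kappa>)"
      unfolding fourier_def using i3[of "x + v"] i3[of x] iv[of v]
      by (simp add: Bochner_Integration.integral_diff Bochner_Integration.integrable_diff)
    have "norm (fourier \<phi> (x + v) - fourier \<phi> x - ?L v) \<le> (LINT \<kappa>|lborel. norm (?D \<kappa>))"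
      unfolding eq by (rule integral_norm_bound)
    also have "\<dots> \<le> (LINT \<kappa>|lborel. (norm v)\<^sup>2 * ((norm \<kappa>)\<^sup>2 * norm (\<phi> \<kappa>)))"
    proof (rule integral_mono)
      show "integrable lborel (\<lambda>\<kappa>. norm (exp (\<i> * complex_of_real (\<kappa> \<bullet> (x + v))) * \<phi> \<kappa> - ?e \<kappa> - (\<i> * complex_of_real (\<kappa> \<bullet> v)) * ?e \<kappa>))"
        by (intro integrable_norm Bochner_Integration.integrable_diff i3 iv)
      show "integrable lborel (\<lambda>\<kappa>. (norm v)\<^sup>2 * ((norm \<kappa>)\<^sup>2 * norm (\<phi> \<kappa>)))" by (intro integrable_mult_right M)
      fix \<kappa> :: "real^3"
      have "exp (\<i> * complex_of_real (\<kappa> \<bullet> (x + v))) * \<phi> \<kappa> - ?e \<kappa> - (\<i> * complex_of_real (\<kappa> \<bullet> v)) * ?e \<kappa> =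
         ?e \<kappa> * (exp (\<i> * complex_of_real (\<kappa> \<bullet> v)) - 1 - \<i> * complex_of_real (\<kappa> \<bullet> v))"
        by (simp add: inner_add_right distrib_left exp_add algebra_simps)
      then have "norm (exp (\<i> * complex_of_real (\<kappa> \<bullet> (x + v))) * \<phi> \<kappa> - ?e \<kappa> - (\<i> * complex_of_real (\<kappa> \<bullet> v)) * ?e \<kappa>)
         = norm (\<phi> \<kappa>) * norm (exp (\<i> * complex_of_real (\<kappa> \<bullet> v)) - 1 - \<i> * complex_of_real (\<kappa> \<bullet> v))"
        by (simp only: norm_mult norm_exp_ii mult_1)
      also have "\<dots> \<le> norm (\<phi> \<kappa>) * (norm \<kappa> * norm v)\<^sup>2"
      proof (intro mult_left_mono norm_ge_zero order_trans[OF norm_exp_ii_remainder])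
        have "\<bar>\<kappa> \<bullet> v\<bar> \<le> norm \<kappa> * norm v" by (rule Cauchy_Schwarz_ineq2)
        then show "(\<kappa> \<bullet> v)\<^sup>2 \<le> (norm \<kappa> * norm v)\<^sup>2" by (metis abs_ge_zero power2_abs power_mono)
      qed
      finally show "norm (exp (\<i> * complex_of_real (\<kappa> \<bullet> (x + v))) * \<phi> \<kappa> - ?e \<kappa> - (\<i> * complex_of_real (\<kappa> \<bullet> v)) * ?e \<kappa>) \<le> (norm v)\<^sup>2 * ((norm \<kappa>)\<^sup>2 * norm (\<phi> \<kappa>))"
        by (simp add: power_mult_distrib mult_ac)
    qed
    also have "\<dots> = M * (norm v)\<^sup>2" by (simp add: M_def)
    finally show ?thesis .
  qed
  show ?thesis
  proof (rule has_derivativeI[OF _ , unfolded divide_inverse])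
    show "bounded_linear ?L" using lin linear_conv_bounded_linear by blast
    show "((\<lambda>y. inverse (norm (y - x)) *\<^sub>R (fourier \<phi> y - fourier \<phi> x - ?L (y - x))) \<longlongrightarrow> 0) (at x within UNIV)"
    proof (rule Lim_null_comparison)
      show "\<forall>\<^sub>F y in at x. norm (inverse (norm (y - x)) *\<^sub>R (fourier \<phi> y - fourier \<phi> x - ?L (y - x))) \<le> M * norm (y - x)"
      proof (rule always_eventually, rule allI)
        fix y
        have "inverse (norm (y - x)) * norm (fourier \<phi> y - fourier \<phi> x - ?L (y - x)) \<le> inverse (norm (y - x)) * (M * (norm (y - x))\<^sup>2)"
          using rem[of "y - x"] by (intro mult_left_mono) auto
        also have "\<dots> = M * norm (y - x)" by (cases "y = x") (simp_all add: power2_eq_square field_simps)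
        finally show "norm (inverse (norm (y - x)) *\<^sub>R (fourier \<phi> y - fourier \<phi> x - ?L (y - x))) \<le> M * norm (y - x)" by simp
      qed
      have "((\<lambda>y. M * norm (y - x)) \<longlongrightarrow> M * norm (x - x)) (at x)" by (intro tendsto_intros)
      then show "((\<lambda>y. M * norm (y - x)) \<longlongrightarrow> 0) (at x)" by simp
    qed
  qed
qed

lemma partial_deriv_fourier:
  assumes "schwartz \<phi>"
  shows "partial_deriv j (fourier \<phi>) = fourier (\<lambda>\<kappa>. \<i> * (complex_of_real (\<kappa> $ j) * \<phi> \<kappa>))"
proof
  fix x
  show "partial_deriv j (fourier \<phi>) x = fourier (\<lambda>\<kappa>. \<i> * (complex_of_real (\<kappa> $ j) * \<phi> \<kappa>)) x"
    unfolding partial_deriv_eq[OF has_derivative_fourier[OF assms]] fourier_def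
    by (simp add: inner_axis mult_ac)
qed

lemma fourier_differentiable: "schwartz \<phi> \<Longrightarrow> fourier \<phi> differentiable (at x)"
  using has_derivative_fourier differentiable_def by blast

lemma difference_quotient_tendsto:
  fixes f :: "'a::real_normed_vector \<Rightarrow> 'b::real_normed_vector"
  assumes "(f has_derivative D) (at x)" "h \<longlonglongrightarrow> 0" "\<And>n. h n > 0"
  shows "(\<lambda>n. (f (x + h n *\<^sub>R v) - f x) /\<^sub>R h n) \<longlonglongrightarrow> D v"
proof (cases "v = 0")
  case True
  then show ?thesis using linear_0[OF has_derivative_linear[OF assms(1)]] by simp
next
  case False
  have lin: "linear D" using assms(1) by (rule has_derivative_linear)
  have "((\<lambda>h. norm (f (x + h) - f x - D h) / norm h) \<longlongrightarrow> 0) (at 0)"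
    using assms(1) by (simp add: has_derivative_at)
  moreover have "filterlim (\<lambda>n. h n *\<^sub>R v) (at 0) sequentially"
  proof -
    have "(\<lambda>n. h n *\<^sub>R v) \<longlonglongrightarrow> 0 *\<^sub>R v" by (intro tendsto_intros assms)
    moreover have "h n *\<^sub>R v \<noteq> 0" for n using False assms(3)[of n] by simp
    ultimately show ?thesis by (simp add: filterlim_at)
  qed
  ultimately have "(\<lambda>n. norm (f (x + h n *\<^sub>R v) - f x - D (h n *\<^sub>R v)) / norm (h n *\<^sub>R v)) \<longlonglongrightarrow> 0"
    by (rule filterlim_compose)
  then have "(\<lambda>n. norm v * (norm (f (x + h n *\<^sub>R v) - f x - D (h n *\<^sub>R v)) / norm (h n *\<^sub>R v))) \<longlonglongrightarrow> norm v * 0"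
    by (intro tendsto_intros)
  moreover have "norm v * (norm (f (x + h n *\<^sub>R v) - f x - D (h n *\<^sub>R v)) / norm (h n *\<^sub>R v)) = norm ((f (x + h n *\<^sub>R v) - f x) /\<^sub>R h n - D v)" for n
  proof -
    have E: "(f (x + h n *\<^sub>R v) - f x) /\<^sub>R h n - D v = (f (x + h n *\<^sub>R v) - f x - D (h n *\<^sub>R v)) /\<^sub>R h n"
      using assms(3)[of n] by (simp add: linear_scale[OF lin] scaleR_right_diff_distrib)
    show ?thesis unfolding E using assms(3)[of n] False by (simp add: divide_inverse)
  qed
  ultimately have "(\<lambda>n. norm ((f (x + h n *\<^sub>R v) - f x) /\<^sub>R h n - D v)) \<longlonglongrightarrow> 0" by simp
  then have "(\<lambda>n. (f (x + h n *\<^sub>R v) - f x) /\<^sub>R h n - D v) \<longlonglongrightarrow> 0" by (rule tendsto_norm_zero_cancel)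
  then show ?thesis by (rule LIM_zero_cancel)
qed

lemma fourier_translate:
  assumes [measurable]: "\<phi> \<in> borel_measurable borel"
  shows "fourier (\<lambda>\<kappa>. \<phi> (\<kappa> + c)) x = exp (- (\<i> * complex_of_real (c \<bullet> x))) * fourier \<phi> x"
proof -
  have "fourier \<phi> x = (LINT \<kappa>|distr lborel borel ((+) c). exp (\<i> * complex_of_real (\<kappa> \<bullet> x)) * \<phi> \<kappa>)"
    unfolding fourier_def by (simp add: lborel_distr_plus)
  also have "\<dots> = (LINT \<kappa>|lborel. exp (\<i> * complex_of_real ((c + \<kappa>) \<bullet> x)) * \<phi> (c + \<kappa>))"
    by (subst integral_distr) auto
  also have "\<dots> = (LINT \<kappa>|lborel. exp (\<i> * complex_of_real (c \<bullet> x)) * (exp (\<i> * complex_of_real (\<kappa> \<bullet> x)) * \<phi> (\<kappa> + c)))"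
    by (simp add: inner_add_left distrib_left exp_add mult_ac add.commute)
  also have "\<dots> = exp (\<i> * complex_of_real (c \<bullet> x)) * fourier (\<lambda>\<kappa>. \<phi> (\<kappa> + c)) x"
    by (simp add: fourier_def)
  finally show ?thesis by (simp add: exp_minus)
qed

text \<open>Uniform domination of difference quotients. The factor \<open>32 = 2\<^sup>5\<close> pays for evaluating the weight at
  distance at most \<open>1\<close> from \<open>x\<close>.\<close>

lemma schwartz_difference_quotient_bound:
  assumes "schwartz \<phi>"
  obtains C where "C \<ge> 0" "\<And>h x. 0 < h \<Longrightarrow> h \<le> 1 \<Longrightarrow>
    (1 + norm x) ^ 5 * norm ((\<phi> (x + h *\<^sub>R axis i 1) - \<phi> x) /\<^sub>R h) \<le> C"
proof -
  obtain C where C: "C \<ge> 0" "\<And>x. (1 + norm x) ^ 5 * norm (partial_deriv i \<phi> x) \<le> C"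
    using schwartz_weight[OF schwartz_partial[OF assms]] by metis
  have "(1 + norm x) ^ 5 * norm ((\<phi> (x + h *\<^sub>R axis i 1) - \<phi> x) /\<^sub>R h) \<le> 32 * C" if h: "0 < h" "h \<le> 1" for h x
  proof -
    let ?e = "axis i 1 :: real^3"
    let ?f = "\<lambda>s. \<phi> (x + s *\<^sub>R ?e)"
    have d: "(?f has_derivative (\<lambda>r. frechet_derivative \<phi> (at (x + s *\<^sub>R ?e)) (r *\<^sub>R ?e))) (at s)" for s
    proof (rule has_derivative_compose[of "\<lambda>s. x + s *\<^sub>R ?e" "\<lambda>r. r *\<^sub>R ?e" s UNIV \<phi>])
      show "((\<lambda>s. x + s *\<^sub>R ?e) has_derivative (\<lambda>r. r *\<^sub>R ?e)) (at s)"
        by (auto intro!: derivative_eq_intros)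
      show "(\<phi> has_derivative frechet_derivative \<phi> (at (x + s *\<^sub>R ?e))) (at (x + s *\<^sub>R ?e))"
        using schwartz_differentiable[OF assms] frechet_derivative_works by blast
    qed
    have "\<exists>s\<in>{0<..<h}. norm (?f h - ?f 0) \<le> norm (frechet_derivative \<phi> (at (x + s *\<^sub>R ?e)) ((h - 0) *\<^sub>R ?e))"
    proof (rule mvt_general[OF h(1)])
      show "continuous_on {0..h} ?f"
        using d by (intro continuous_at_imp_continuous_on ballI has_derivative_continuous)
      show "(?f has_derivative (\<lambda>r. frechet_derivative \<phi> (at (x + s *\<^sub>R ?e)) (r *\<^sub>R ?e))) (at s)" for s by (rule d)
    qed
    then obtain s where s: "0 < s" "s < h"
      "norm (?f h - ?f 0) \<le> norm (frechet_derivative \<phi> (at (x + s *\<^sub>R ?e)) (h *\<^sub>R ?e))" by auto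
    let ?y = "x + s *\<^sub>R ?e"
    have lin: "linear (frechet_derivative \<phi> (at ?y))"
      using schwartz_differentiable[OF assms] linear_frechet_derivative by blast
    have "norm (?f h - ?f 0) \<le> h * norm (partial_deriv i \<phi> ?y)"
      using s(3) h by (simp add: linear_scale[OF lin] partial_deriv_def)
    then have "inverse h * norm (?f h - ?f 0) \<le> inverse h * (h * norm (partial_deriv i \<phi> ?y))"
      using h by (intro mult_left_mono) auto
    moreover have "inverse h * (h * norm (partial_deriv i \<phi> ?y)) = norm (partial_deriv i \<phi> ?y)"
      using h by simp
    moreover have "norm ((\<phi> (x + h *\<^sub>R ?e) - \<phi> x) /\<^sub>R h) = inverse h * norm (?f h - ?f 0)"
      using h by simp
    ultimately have 1: "norm ((\<phi> (x + h *\<^sub>R ?e) - \<phi> x) /\<^sub>R h) \<le> norm (partial_deriv i \<phi> ?y)"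
      by (simp only:)
    have "norm x \<le> norm ?y + norm (s *\<^sub>R ?e)" using norm_triangle_ineq4[of ?y "s *\<^sub>R ?e"] by simp
    moreover have "norm (s *\<^sub>R ?e) \<le> 1" using s h by simp
    moreover have "p \<le> q + r \<Longrightarrow> r \<le> 1 \<Longrightarrow> 0 \<le> q \<Longrightarrow> 1 + p \<le> 2 * (1 + q)" for p q r :: real by simp
    ultimately have "1 + norm x \<le> 2 * (1 + norm ?y)" using norm_ge_zero[of ?y] by blast
    then have "(1 + norm x) ^ 5 \<le> (2 * (1 + norm ?y)) ^ 5" by (intro power_mono) auto
    then have "(1 + norm x) ^ 5 * norm ((\<phi> (x + h *\<^sub>R ?e) - \<phi> x) /\<^sub>R h) \<le> (2 * (1 + norm ?y)) ^ 5 * norm (partial_deriv i \<phi> ?y)"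
      using 1 by (intro mult_mono) auto
    also have "\<dots> = 32 * ((1 + norm ?y) ^ 5 * norm (partial_deriv i \<phi> ?y))" unfolding power_mult_distrib by simp
    also have "\<dots> \<le> 32 * C" using C(2)[of ?y] by simp
    finally show ?thesis .
  qed
  then show thesis using that[of "32 * C"] C(1) by auto
qed

text \<open>Translating \<open>\<phi>\<close> multiplies its transform by a phase. Difference quotients of translates therefore have
  explicit transforms, and dominated convergence gives the rule for derivatives without an integration
  by parts in three dimensions.\<close>

lemma fourier_partial_deriv:
  assumes "schwartz \<phi>"
  shows "fourier (partial_deriv i \<phi>) x = - (\<i> * complex_of_real (x $ i)) * fourier \<phi> x"
proof -
  let ?e = "axis i 1 :: real^3"
  define h where "h = (\<lambda>n::nat. 1 / real (Suc n))"
  have h: "h \<longlonglongrightarrow> 0" "\<And>n. h n > 0" "\<And>n. h n \<le> 1"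
    using LIMSEQ_inverse_real_of_nat by (auto simp: h_def inverse_eq_divide)
  let ?q = "\<lambda>n \<kappa>. (\<phi> (\<kappa> + h n *\<^sub>R ?e) - \<phi> \<kappa>) /\<^sub>R h n"
  obtain C where C: "C \<ge> 0" "\<And>h x. 0 < h \<Longrightarrow> h \<le> 1 \<Longrightarrow> (1 + norm x) ^ 5 * norm ((\<phi> (x + h *\<^sub>R ?e) - \<phi> x) /\<^sub>R h) \<le> C"
    using schwartz_difference_quotient_bound[OF assms, of i] by metis
  have m [measurable]: "\<phi> \<in> borel_measurable borel" by (rule schwartz_measurable[OF assms])
  have mp [measurable]: "partial_deriv i \<phi> \<in> borel_measurable borel" by (rule schwartz_measurable[OF schwartz_partial[OF assms]])
  have "(\<lambda>n. fourier (?q n) x) \<longlonglongrightarrow> fourier (partial_deriv i \<phi>) x"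
    unfolding fourier_def
  proof (rule integral_dominated_convergence[where w = "\<lambda>\<kappa>. C * (1 / (1 + norm \<kappa>) ^ 5)"])
    show "integrable lborel (\<lambda>\<kappa>::real^3. C * (1 / (1 + norm \<kappa>) ^ 5))"
      using integrable_polynomial_weight by (rule integrable_mult_right)
    show "AE \<kappa> in lborel. (\<lambda>n. exp (\<i> * complex_of_real (\<kappa> \<bullet> x)) * ?q n \<kappa>) \<longlonglongrightarrow> exp (\<i> * complex_of_real (\<kappa> \<bullet> x)) * partial_deriv i \<phi> \<kappa>"
    proof (intro AE_I2 tendsto_intros)
      fix \<kappa>
      have "(\<phi> has_derivative frechet_derivative \<phi> (at \<kappa>)) (at \<kappa>)"
        using schwartz_differentiable[OF assms] frechet_derivative_works by blast
      then show "(\<lambda>n. ?q n \<kappa>) \<longlonglongrightarrow> partial_deriv i \<phi> \<kappa>"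
        unfolding partial_deriv_def by (rule difference_quotient_tendsto) (rule h)+
    qed
    show "AE \<kappa> in lborel. norm (exp (\<i> * complex_of_real (\<kappa> \<bullet> x)) * ?q n \<kappa>) \<le> C * (1 / (1 + norm \<kappa>) ^ 5)" for n
    proof (intro AE_I2)
      fix \<kappa> :: "real^3"
      have "(1 + norm \<kappa>) ^ 5 > 0" by (intro zero_less_power) (simp add: add_pos_nonneg)
      then show "norm (exp (\<i> * complex_of_real (\<kappa> \<bullet> x)) * ?q n \<kappa>) \<le> C * (1 / (1 + norm \<kappa>) ^ 5)"
        unfolding norm_mult norm_exp_ii using C(2)[OF h(2)[of n] h(3)[of n], of \<kappa>] by (simp add: field_simps)
    qed
  qed measurable
  moreover have "fourier (?q n) x = ((exp (- (\<i> * complex_of_real (h n * x $ i))) - 1) /\<^sub>R h n) * fourier \<phi> x" for n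
  proof -
    have i1: "integrable lborel (\<lambda>\<kappa>. \<phi> (\<kappa> + h n *\<^sub>R ?e))"
    proof -
      have "integrable (distr lborel borel ((+) (h n *\<^sub>R ?e))) \<phi>"
        using schwartz_integrable[OF assms] by (simp add: lborel_distr_plus)
      then show ?thesis by (subst (asm) integrable_distr_eq) (auto simp: add.commute)
    qed
    have "fourier (?q n) x = fourier (\<lambda>\<kappa>. complex_of_real (inverse (h n)) * (\<phi> (\<kappa> + h n *\<^sub>R ?e) + (- 1) * \<phi> \<kappa>)) x"
      by (simp add: scaleR_conv_of_real)
    also have "\<dots> = complex_of_real (inverse (h n)) * (fourier (\<lambda>\<kappa>. \<phi> (\<kappa> + h n *\<^sub>R ?e)) x + (- 1) * fourier \<phi> x)"
      by (subst fourier_scale, subst fourier_add)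
         (auto intro: i1 schwartz_integrable assms simp: fourier_scale[of "-1", simplified])
    also have "\<dots> = ((exp (- (\<i> * complex_of_real (h n * x $ i))) - 1) /\<^sub>R h n) * fourier \<phi> x"
      by (simp add: fourier_translate inner_axis' scaleR_conv_of_real[where 'a = complex] algebra_simps)
    finally show ?thesis .
  qed
  moreover have "(\<lambda>n. ((exp (- (\<i> * complex_of_real (h n * x $ i))) - 1) /\<^sub>R h n) * fourier \<phi> x) \<longlonglongrightarrow> - (\<i> * complex_of_real (x $ i)) * fourier \<phi> x"
  proof (intro tendsto_mult tendsto_const)
    have "((\<lambda>s::real. exp (- (\<i> * complex_of_real (s * x $ i)))) has_derivative (\<lambda>s. s *\<^sub>R - (\<i> * complex_of_real (x $ i)))) (at 0)"
    proof -
      have "((\<lambda>s::real. - (\<i> * complex_of_real (s * x $ i))) has_vector_derivative - (\<i> * complex_of_real (x $ i))) (at 0)"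
        unfolding has_vector_derivative_def
        by (auto intro!: derivative_eq_intros simp: scaleR_conv_of_real)
      from field_vector_diff_chain_at[OF this DERIV_exp]
      show ?thesis by (simp add: has_vector_derivative_def o_def)
    qed
    from difference_quotient_tendsto[OF this h(1,2), of 1]
    show "(\<lambda>n. (exp (- (\<i> * complex_of_real (h n * x $ i))) - 1) /\<^sub>R h n) \<longlonglongrightarrow> - (\<i> * complex_of_real (x $ i))"
      by simp
  qed
  ultimately show ?thesis using LIMSEQ_unique by simp
qed

lemma norm_fourier_monomial:
  assumes "schwartz \<phi>"
  shows "\<bar>x $ i\<bar> ^ k * norm (fourier \<phi> x) = norm (fourier (iter_partial (replicate k i) \<phi>) x)"
proof (induction k)
  case (Suc k)
  have "norm (fourier (iter_partial (replicate (Suc k) i) \<phi>) x) = \<bar>x $ i\<bar> * norm (fourier (iter_partial (replicate k i) \<phi>) x)"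
    using fourier_partial_deriv[OF schwartz_iter_partial[OF assms, of "replicate k i"], of i x]
    by (simp add: iter_partial_simps norm_mult)
  then show ?case using Suc by simp
qed (simp add: iter_partial_simps)

lemma one_plus_norm_power_le:
  fixes x :: "real^3"
  shows "(1 + norm x) ^ k \<le> 4 ^ k * (1 + (\<Sum>i\<in>UNIV. \<bar>x $ i\<bar> ^ k))"
proof -
  define m where "m = Max (insert 1 (range (\<lambda>i. \<bar>x $ i\<bar>)))"
  have fin: "finite (insert 1 (range (\<lambda>i. \<bar>x $ i\<bar>)))" by simp
  have m1: "1 \<le> m" unfolding m_def by (rule Max_ge[OF fin]) auto
  have mi: "\<bar>x $ i\<bar> \<le> m" for i unfolding m_def by (rule Max_ge[OF fin]) auto
  have "norm x \<le> (\<Sum>i\<in>UNIV. \<bar>x $ i\<bar>)" by (rule norm_le_l1_cart)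
  also have "\<dots> \<le> 3 * m" using sum_bounded_above[of UNIV "\<lambda>i. \<bar>x $ i\<bar>" m] mi by simp
  finally have "(1 + norm x) ^ k \<le> (4 * m) ^ k" using m1 by (intro power_mono) auto
  also have "\<dots> = 4 ^ k * m ^ k" by (simp add: power_mult_distrib)
  also have "m ^ k \<le> 1 + (\<Sum>i\<in>UNIV. \<bar>x $ i\<bar> ^ k)"
  proof -
    have "m \<in> insert 1 (range (\<lambda>i. \<bar>x $ i\<bar>))" unfolding m_def using fin by (rule Max_in) simp
    then consider "m = 1" | i where "m = \<bar>x $ i\<bar>" by auto
    then show ?thesis
    proof cases
      case 1
      then show ?thesis by (simp add: sum_nonneg)
    next
      case (2 i)
      have "\<bar>x $ i\<bar> ^ k \<le> (\<Sum>i\<in>UNIV. \<bar>x $ i\<bar> ^ k)" by (rule member_le_sum) auto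
      then show ?thesis using 2 by simp
    qed
  qed
  finally show ?thesis by simp
qed

text \<open>Powers of \<open>x\<^sub>i\<close> become derivatives of \<open>\<phi>\<close>, whose \<open>L\<^sup>1\<close> norms are bounded on the set. Powers of single
  coordinates suffice to dominate \<open>(1 + \<parallel>x\<parallel>)\<^sup>k\<close>.\<close>

lemma rapidly_decreasing_fourier:
  assumes "schwartz_bounded S"
  shows "rapidly_decreasing (fourier ` S)"
  unfolding rapidly_decreasing_def
proof
  fix k
  define I where "I = (LINT x|lborel. 1 / (1 + norm (x::real^3)) ^ 5)"
  have "\<exists>C. \<forall>\<phi>\<in>S. \<forall>x. norm (fourier (iter_partial ds \<phi>) x) \<le> C" for ds
  proof -
    obtain C where C: "\<And>\<phi> x. \<phi> \<in> S \<Longrightarrow> (1 + norm x) ^ 5 * norm (iter_partial ds \<phi> x) \<le> C"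
      using assms unfolding schwartz_bounded_def rapidly_decreasing_def by (simp, metis)
    have "norm (fourier (iter_partial ds \<phi>) x) \<le> C * I" if "\<phi> \<in> S" for \<phi> x
    proof -
      have "(LINT x|lborel. norm (iter_partial ds \<phi> x)) \<le> C * I"
        unfolding I_def
        by (rule integrable_weight5(2)) (use that C schwartz_bounded_imp_schwartz[OF assms] in \<open>auto intro!: schwartz_measurable schwartz_iter_partial\<close>)
      then show ?thesis using norm_fourier_le[of "iter_partial ds \<phi>" x] by linarith
    qed
    then show ?thesis by blast
  qed
  then obtain C where C: "\<And>ds \<phi> x. \<phi> \<in> S \<Longrightarrow> norm (fourier (iter_partial ds \<phi>) x) \<le> C ds" by metis
  have "(1 + norm x) ^ k * norm (fourier \<phi> x) \<le> 4 ^ k * (C [] + (\<Sum>i\<in>UNIV. C (replicate k i)))" if \<phi>: "\<phi> \<in> S" for \<phi> x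
  proof -
    have sw: "schwartz \<phi>" using schwartz_bounded_imp_schwartz[OF assms \<phi>] .
    have "(1 + norm x) ^ k * norm (fourier \<phi> x) \<le> 4 ^ k * (1 + (\<Sum>i\<in>UNIV. \<bar>x $ i\<bar> ^ k)) * norm (fourier \<phi> x)"
      by (intro mult_right_mono one_plus_norm_power_le) simp
    also have "\<dots> = 4 ^ k * (norm (fourier \<phi> x) + (\<Sum>i\<in>UNIV. \<bar>x $ i\<bar> ^ k * norm (fourier \<phi> x)))"
      by (simp add: distrib_right sum_distrib_right mult.assoc)
    also have "\<dots> \<le> 4 ^ k * (C [] + (\<Sum>i\<in>UNIV. C (replicate k i)))"
      unfolding norm_fourier_monomial[OF sw] using C[OF \<phi>, of "[]" x]
      by (intro mult_left_mono add_mono sum_mono C \<phi>) (auto simp: iter_partial_simps)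
    finally show ?thesis .
  qed
  then show "\<exists>C. \<forall>\<phi>\<in>fourier ` S. \<forall>x. (1 + norm x) ^ k * norm (\<phi> x) \<le> C" by blast
qed

text \<open>Differentiating the transform amounts to multiplying \<open>\<phi>\<close> by \<open>i \<kappa>\<^sub>j\<close>, which stays within transforms of
  bounded sets.\<close>

lemma schwartz_bounded_fourier:
  assumes "schwartz_bounded S"
  shows "schwartz_bounded (fourier ` S)"
proof -
  let ?P = "\<lambda>S'. \<exists>S. S' = fourier ` S \<and> schwartz_bounded S"
  show ?thesis
  proof (rule schwartz_bounded_coinduct[where P = ?P])
    show "?P (fourier ` S)" using assms by blast
  next
    fix S \<phi> x assume "?P S" "\<phi> \<in> S"
    then show "\<phi> differentiable at x"
      using fourier_differentiable schwartz_bounded_imp_schwartz by blast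
  next
    fix S assume "?P S"
    then show "rapidly_decreasing S" using rapidly_decreasing_fourier by blast
  next
    fix S' j assume "?P S'"
    then obtain S where S: "S' = fourier ` S" "schwartz_bounded S" by blast
    have "partial_deriv j (fourier \<phi>) \<in> fourier ` fun_scale 1 (fun_coord j S)" if "\<phi> \<in> S" for \<phi>
    proof -
      have "(\<lambda>\<kappa>. \<i> * (complex_of_real (\<kappa> $ j) * \<phi> \<kappa>)) \<in> fun_scale 1 (fun_coord j S)"
        unfolding fun_scale_iff fun_coord_iff using that by (intro exI[of _ \<i>] conjI bexI[of _ "\<lambda>\<kappa>. complex_of_real (\<kappa> $ j) * \<phi> \<kappa>"]) (auto simp: fun_coord_iff)
      then show ?thesis
        unfolding partial_deriv_fourier[OF schwartz_bounded_imp_schwartz[OF S(2) that]] by blast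
    qed
    then show "\<exists>S''. ?P S'' \<and> partial_deriv j ` S' \<subseteq> S''"
      unfolding S(1) using schwartz_bounded_scale[OF schwartz_bounded_coord[OF S(2)], of 1 j] by blast
  qed
qed

lemma schwartz_fourier: "schwartz \<phi> \<Longrightarrow> schwartz (fourier \<phi>)"
  unfolding schwartz_iff_bounded using schwartz_bounded_fourier[of "{\<phi>}"] by simp

lemma laplacian_fourier:
  assumes "schwartz \<phi>"
  shows "laplacian (fourier \<phi>) = fourier (\<lambda>\<kappa>. - (complex_of_real ((norm \<kappa>)\<^sup>2) * \<phi> \<kappa>))"
proof
  fix x
  have s: "schwartz (\<lambda>\<kappa>. \<i> * (complex_of_real (\<kappa> $ j) * \<phi> \<kappa>))" for j
    by (intro schwartz_scale schwartz_coord assms)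
  let ?g = "\<lambda>j \<kappa>. \<i> * (complex_of_real (\<kappa> $ j) * (\<i> * (complex_of_real (\<kappa> $ j) * \<phi> \<kappa>)))"
  have i: "integrable lborel (?g j)" for j
    by (intro schwartz_integrable schwartz_scale schwartz_coord assms)
  have "laplacian (fourier \<phi>) x = (\<Sum>j\<in>UNIV. fourier (?g j) x)"
    unfolding laplacian_def partial_deriv_fourier[OF assms] partial_deriv_fourier[OF s] ..
  also have "\<dots> = fourier (\<lambda>\<kappa>. \<Sum>j\<in>UNIV. ?g j \<kappa>) x"
    unfolding fourier_def sum_distrib_left
    by (rule Bochner_Integration.integral_sum[symmetric]) (intro fourier_integrable i)
  also have "(\<lambda>\<kappa>. \<Sum>j\<in>UNIV. ?g j \<kappa>) = (\<lambda>\<kappa>. - (complex_of_real ((norm \<kappa>)\<^sup>2) * \<phi> \<kappa>))"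
    unfolding norm_cart3_squared by (rule ext) (simp add: sum_3 power2_eq_square algebra_simps)
  finally show "laplacian (fourier \<phi>) x = fourier (\<lambda>\<kappa>. - (complex_of_real ((norm \<kappa>)\<^sup>2) * \<phi> \<kappa>)) x" .
qed

section \<open>Gaussians\<close>

definition gaussian :: "real \<Rightarrow> real^3 \<Rightarrow> real^3 \<Rightarrow> complex" where
  "gaussian s c x = complex_of_real (exp (- (s * (norm (x - c))\<^sup>2)))"

lemma partial_deriv_gaussian:
  "(gaussian s c has_derivative (\<lambda>v. complex_of_real (- (2 * s * ((x - c) \<bullet> v))) * gaussian s c x)) (at x)"
  "partial_deriv j (gaussian s c) = (\<lambda>x. complex_of_real (- 2 * s) * (complex_of_real (x $ j) * gaussian s c x) + complex_of_real (2 * s * c $ j) * gaussian s c x)"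
proof -
  show d: "(gaussian s c has_derivative (\<lambda>v. complex_of_real (- (2 * s * ((x - c) \<bullet> v))) * gaussian s c x)) (at x)" for x
  proof -
    have "((\<lambda>x. exp (- (s * (norm (x - c))\<^sup>2))) has_derivative (\<lambda>v. - (2 * s * ((x - c) \<bullet> v)) * exp (- (s * (norm (x - c))\<^sup>2)))) (at x)"
      unfolding power2_norm_eq_inner
      by (auto intro!: derivative_eq_intros simp: inner_commute algebra_simps)
    from has_derivative_of_real[OF this] show ?thesis
      unfolding gaussian_def[abs_def] by (simp only: of_real_mult)
  qed
  show "partial_deriv j (gaussian s c) = (\<lambda>x. complex_of_real (- 2 * s) * (complex_of_real (x $ j) * gaussian s c x) + complex_of_real (2 * s * c $ j) * gaussian s c x)"
    unfolding partial_deriv_eq[OF d, abs_def]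
    by (rule ext) (simp add: inner_axis algebra_simps)
qed

text \<open>The class generated from one Gaussian by sums, scalings and coordinate multiplications, that is,
  polynomials times the Gaussian. It is closed under derivatives.\<close>

inductive gauss_class :: "real \<Rightarrow> real^3 \<Rightarrow> (real^3 \<Rightarrow> complex) set \<Rightarrow> bool" for s c where
  base: "gauss_class s c {gaussian s c}"
| sum: "gauss_class s c S \<Longrightarrow> gauss_class s c S' \<Longrightarrow> gauss_class s c (fun_sum S S')"
| scale: "gauss_class s c S \<Longrightarrow> gauss_class s c (fun_scale K S)"
| coord: "gauss_class s c S \<Longrightarrow> gauss_class s c (fun_coord i S)"

lemma gauss_class_differentiable:
  assumes "gauss_class s c S" "\<phi> \<in> S"
  shows "\<phi> differentiable (at x)"
  using assms
proof (induction arbitrary: \<phi>)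
  case base
  then show ?case using partial_deriv_gaussian(1) by (auto intro: differentiableI)
next
  case (sum S S')
  from sum.prems show ?case by (rule fun_sumE) (auto intro!: differentiable_add intro: sum.IH)
next
  case (scale S K)
  from scale.prems show ?case by (rule fun_scaleE) (auto intro!: differentiable_mult intro: scale.IH)
next
  case (coord S i)
  from coord.prems show ?case by (rule fun_coordE) (auto intro!: differentiable_mult coord_differentiable intro: coord.IH)
qed

lemma rapidly_decreasing_gaussian:
  assumes "s \<ge> 1"
  shows "rapidly_decreasing {gaussian s c}"
  unfolding rapidly_decreasing_def
proof
  fix k
  have "(1 + norm x) ^ k * norm (gaussian s c x) \<le> (1 + norm c) ^ k * (fact k * exp 2)" for x
  proof -
    define y where "y = norm (x - c)"
    have y: "y \<ge> 0" by (simp add: y_def)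
    have "norm x \<le> norm c + y" unfolding y_def by (rule norm_triangle_sub)
    moreover have "0 \<le> norm c * y" using y by simp
    moreover have "(1 + norm c) * (1 + y) = 1 + norm c + y + norm c * y" by (simp add: algebra_simps)
    ultimately have "1 + norm x \<le> (1 + norm c) * (1 + y)" by linarith
    then have "(1 + norm x) ^ k \<le> (1 + norm c) ^ k * (1 + y) ^ k"
      by (metis power_mono power_mult_distrib add_nonneg_nonneg norm_ge_zero zero_le_one)
    moreover have "(1 + y) ^ k \<le> fact k * exp (1 + y)"
    proof -
      have "(\<Sum>n\<in>{k}. (1 + y) ^ n /\<^sub>R fact n) \<le> (\<Sum>n. (1 + y) ^ n /\<^sub>R fact n)"
        by (rule sum_le_suminf[OF sums_summable[OF exp_converges]]) (use y in auto)
      also have "\<dots> = exp (1 + y)" by (rule sums_unique[OF exp_converges, symmetric])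
      finally show ?thesis by (simp add: field_simps)
    qed
    moreover have "exp (1 + y) * exp (- (s * y\<^sup>2)) \<le> exp 2"
    proof -
      have "y \<le> 1 + y\<^sup>2" using zero_le_power2[of "y - 1 / 2"] by (simp add: power2_eq_square algebra_simps)
      moreover have "y\<^sup>2 \<le> s * y\<^sup>2" using assms by (simp add: mult_le_cancel_right1)
      ultimately have "1 + y + - (s * y\<^sup>2) \<le> 2" by linarith
      then show ?thesis by (simp flip: exp_add)
    qed
    moreover have "norm (gaussian s c x) = exp (- (s * y\<^sup>2))" by (simp add: gaussian_def y_def)
    ultimately have "(1 + norm x) ^ k * norm (gaussian s c x) \<le> (1 + norm c) ^ k * (fact k * exp (1 + y)) * exp (- (s * y\<^sup>2))"
      by (simp only:) (intro mult_right_mono; (elim order_trans)?; (intro mult_left_mono)?; simp)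
    also have "\<dots> = (1 + norm c) ^ k * (fact k * (exp (1 + y) * exp (- (s * y\<^sup>2))))" by (simp add: mult_ac)
    also have "\<dots> \<le> (1 + norm c) ^ k * (fact k * exp 2)"
      using \<open>exp (1 + y) * exp (- (s * y\<^sup>2)) \<le> exp 2\<close> by (intro mult_left_mono) auto
    finally show ?thesis .
  qed
  then show "\<exists>C. \<forall>\<phi>\<in>{gaussian s c}. \<forall>x. (1 + norm x) ^ k * norm (\<phi> x) \<le> C" by blast
qed

lemma schwartz_gaussian:
  assumes s: "s \<ge> 1"
  shows "schwartz (gaussian s c)"
  unfolding schwartz_iff_bounded
proof (rule schwartz_bounded_coinduct[where P = "gauss_class s c"])
  show "gauss_class s c {gaussian s c}" by (rule gauss_class.base)
  show "\<phi> differentiable at x" if "gauss_class s c S" "\<phi> \<in> S" for S \<phi> x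
    using that by (rule gauss_class_differentiable)
  show "rapidly_decreasing S" if "gauss_class s c S" for S
    using that by induction (auto intro: rapidly_decreasing_gaussian[OF s] rapidly_decreasing_sum rapidly_decreasing_scale rapidly_decreasing_coord)
  show "\<exists>S'. gauss_class s c S' \<and> partial_deriv j ` S \<subseteq> S'" if "gauss_class s c S" for S j
    using that
  proof induction
    case base
    let ?S' = "fun_sum (fun_scale \<bar>2 * s\<bar> (fun_coord j {gaussian s c})) (fun_scale \<bar>2 * s * c $ j\<bar> {gaussian s c})"
    have "gauss_class s c ?S'" by (intro gauss_class.intros)
    moreover have "partial_deriv j (gaussian s c) \<in> ?S'"
      unfolding partial_deriv_gaussian(2)
      by (intro fun_sumI fun_scaleI fun_coordI singletonI) (simp_all only: norm_of_real mult_minus_left abs_minus_cancel order.refl)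
    ultimately show ?case by blast
  next
    case (sum S S')
    then obtain T T' where T: "gauss_class s c T" "partial_deriv j ` S \<subseteq> T" "gauss_class s c T'" "partial_deriv j ` S' \<subseteq> T'" by blast
    have "partial_deriv j \<phi> \<in> fun_sum T T'" if "\<phi> \<in> fun_sum S S'" for \<phi>
    proof -
      from that obtain \<phi>1 \<phi>2 where \<phi>: "\<phi>1 \<in> S" "\<phi>2 \<in> S'" "\<phi> = (\<lambda>x. \<phi>1 x + \<phi>2 x)" by (rule fun_sumE)
      have "partial_deriv j \<phi> = (\<lambda>x. partial_deriv j \<phi>1 x + partial_deriv j \<phi>2 x)"
        unfolding \<phi>(3) by (intro partial_deriv_sum gauss_class_differentiable[OF sum.hyps(1) \<phi>(1)] gauss_class_differentiable[OF sum.hyps(2) \<phi>(2)])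
      moreover have "partial_deriv j \<phi>1 \<in> T" "partial_deriv j \<phi>2 \<in> T'" using \<phi> T by blast+
      ultimately show ?thesis by (simp add: fun_sumI)
    qed
    then show ?case using gauss_class.sum[OF T(1,3)] by blast
  next
    case (scale S K)
    then obtain T where T: "gauss_class s c T" "partial_deriv j ` S \<subseteq> T" by blast
    have "partial_deriv j \<phi> \<in> fun_scale K T" if "\<phi> \<in> fun_scale K S" for \<phi>
    proof -
      from that obtain d \<phi>1 where \<phi>: "norm d \<le> K" "\<phi>1 \<in> S" "\<phi> = (\<lambda>x. d * \<phi>1 x)" by (rule fun_scaleE)
      have "partial_deriv j \<phi> = (\<lambda>x. d * partial_deriv j \<phi>1 x)"
        unfolding \<phi>(3) by (intro partial_deriv_scale gauss_class_differentiable[OF scale.hyps \<phi>(2)])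
      moreover have "partial_deriv j \<phi>1 \<in> T" using \<phi> T by blast
      ultimately show ?thesis using \<phi>(1) by (simp add: fun_scaleI)
    qed
    then show ?case using gauss_class.scale[OF T(1)] by blast
  next
    case (coord S i)
    then obtain T where T: "gauss_class s c T" "partial_deriv j ` S \<subseteq> T" by blast
    have "partial_deriv j \<phi> \<in> fun_sum (fun_coord i T) (fun_scale 1 S)" if "\<phi> \<in> fun_coord i S" for \<phi>
    proof -
      from that obtain \<phi>1 where \<phi>: "\<phi>1 \<in> S" "\<phi> = (\<lambda>x. complex_of_real (x $ i) * \<phi>1 x)" by (rule fun_coordE)
      have "partial_deriv j \<phi> = (\<lambda>x. complex_of_real (x $ i) * partial_deriv j \<phi>1 x + (if i = j then 1 else 0) * \<phi>1 x)"
        unfolding \<phi>(2) by (intro partial_deriv_coord gauss_class_differentiable[OF coord.hyps \<phi>(1)])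
      moreover have "partial_deriv j \<phi>1 \<in> T" using \<phi> T by blast
      then have "(\<lambda>x. complex_of_real (x $ i) * partial_deriv j \<phi>1 x) \<in> fun_coord i T" by (rule fun_coordI)
      moreover have "(\<lambda>x. (if i = j then 1 else 0) * \<phi>1 x) \<in> fun_scale 1 S"
        by (rule fun_scaleI[OF _ \<phi>(1)]) simp
      ultimately show ?thesis using fun_sumI by simp
    qed
    then show ?case using gauss_class.sum[OF gauss_class.coord[OF T(1)] gauss_class.scale[OF coord.hyps]] by blast
  qed
qed

text \<open>If \<open>d c \<noteq> 0\<close>, normalise so that the real part \<open>f\<close> of \<open>d / d c\<close> is at least \<open>1/2\<close> on the ball of radius
  \<open>\<delta>\<close>, and test with \<open>g\<^sup>j\<^sup>+\<^sup>1\<close> for the Gaussian \<open>g\<close> centred at \<open>c\<close>. The ball of radius \<open>\<delta> / 2\<close>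
  contributes at least a constant times \<open>p\<^sup>j\<close> and the complement of the large ball at most a constant
  times \<open>q\<^sup>j\<close>, where \<open>p > q\<close> are the values of \<open>g\<close> at distance \<open>\<delta> / 2\<close> and \<open>\<delta>\<close>; letting \<open>j\<close> grow is
  contradictory. Only integrability of \<open>d g\<close> is used far from \<open>c\<close>, so \<open>d\<close> may be unbounded.\<close>

lemma continuous_eq_0_if_orthogonal_to_gaussians:
  fixes d :: "real^3 \<Rightarrow> complex"
  assumes cont: "continuous_on UNIV d"
    and int: "\<And>\<psi>. schwartz \<psi> \<Longrightarrow> integrable lborel (\<lambda>x. d x * \<psi> x)"
    and orth: "\<And>\<psi>. schwartz \<psi> \<Longrightarrow> (LINT x|lborel. d x * \<psi> x) = 0"
  shows "d c = 0"
proof (rule ccontr)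
  assume "d c \<noteq> 0"
  define f where "f = (\<lambda>x. Re (d x / d c))"
  define g where "g = (\<lambda>x. exp (- (norm (x - c))\<^sup>2))"
  have gpow: "g x ^ j = exp (- (real j * (norm (x - c))\<^sup>2))" for x j
    unfolding g_def by (simp add: exp_of_nat_mult[symmetric])
  have re: "f x * g x ^ j = Re (inverse (d c) * (d x * gaussian (real j) c x))" for x j
    by (simp add: f_def gpow gaussian_def divide_inverse algebra_simps)
  have fi: "integrable lborel (\<lambda>x. f x * g x ^ j)" and f0: "(LINT x|lborel. f x * g x ^ j) = 0" if "j \<ge> 1" for j
  proof -
    have i: "integrable lborel (\<lambda>x. inverse (d c) * (d x * gaussian (real j) c x))"
      by (intro integrable_mult_right int schwartz_gaussian) (use that in simp)
    show "integrable lborel (\<lambda>x. f x * g x ^ j)" unfolding re by (rule integrable_Re[OF i])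
    have "(LINT x|lborel. f x * g x ^ j) = Re (LINT x|lborel. inverse (d c) * (d x * gaussian (real j) c x))"
      unfolding re by (rule integral_Re[OF i])
    also have "\<dots> = 0" using orth[OF schwartz_gaussian[of "real j" c]] that by simp
    finally show "(LINT x|lborel. f x * g x ^ j) = 0" .
  qed
  have cf: "continuous_on UNIV f" unfolding f_def by (intro continuous_intros cont) (use \<open>d c \<noteq> 0\<close> in auto)
  have "f c = 1" using \<open>d c \<noteq> 0\<close> by (simp add: f_def)
  have "isCont f c" using cf by (simp add: continuous_on_eq_continuous_at)
  then obtain \<delta> where \<delta>: "\<delta> > 0" "\<And>x. dist x c < \<delta> \<Longrightarrow> dist (f x) (f c) < 1 / 2"
    unfolding continuous_at_eps_delta by (metis half_gt_zero zero_less_one)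
  have near: "f x \<ge> 1 / 2" if "dist x c < \<delta>" for x
    using \<delta>(2)[OF that] \<open>f c = 1\<close> unfolding dist_real_def by linarith
  define B where "B = ball c (\<delta> / 2)"
  define v where "v = measure lborel B"
  have v: "v > 0" unfolding v_def B_def using \<delta>(1) by (intro content_ball_pos) simp
  define M where "M = (LINT x|lborel. \<bar>f x * g x\<bar>)"
  have Mi: "integrable lborel (\<lambda>x. \<bar>f x * g x\<bar>)" using fi[of 1] by simp
  define p where "p = exp (- (\<delta> / 2)\<^sup>2)"
  define q where "q = exp (- \<delta>\<^sup>2)"
  have g01: "0 < g x" "g x \<le> 1" for x by (auto simp: g_def)
  have key: "v * p ^ Suc j / 2 \<le> q ^ j * M" for j
  proof -
    have pt: "indicator B x * (p ^ Suc j / 2) - q ^ j * \<bar>f x * g x\<bar> \<le> f x * g x ^ Suc j" for x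
    proof (cases "dist x c < \<delta>")
      case True
      have "indicator B x * (p ^ Suc j / 2) \<le> f x * g x ^ Suc j"
      proof (cases "x \<in> B")
        case True
        have "norm (x - c) \<le> \<delta> / 2" using True by (simp add: B_def dist_norm norm_minus_commute)
        then have "(norm (x - c))\<^sup>2 \<le> (\<delta> / 2)\<^sup>2" by (intro power_mono) auto
        then have "p \<le> g x" by (simp add: p_def g_def)
        then have "p ^ Suc j \<le> g x ^ Suc j" by (intro power_mono) (auto simp: p_def)
        then have "(1 / 2) * p ^ Suc j \<le> f x * g x ^ Suc j"
          using near[OF \<open>dist x c < \<delta>\<close>] by (intro mult_mono) (auto simp: p_def)
        then show ?thesis using True by simp
      next
        case False
        then show ?thesis using near[OF True] g01(1)[of x] by (simp add: mult_nonneg_nonneg)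
      qed
      moreover have "0 \<le> q ^ j * \<bar>f x * g x\<bar>" by (simp add: q_def)
      ultimately show ?thesis by linarith
    next
      case False
      then have "x \<notin> B" using \<delta>(1) by (auto simp: B_def dist_commute)
      have "\<delta> \<le> norm (x - c)" using False by (simp add: dist_norm)
      then have "\<delta>\<^sup>2 \<le> (norm (x - c))\<^sup>2" using \<delta>(1) by (intro power_mono) auto
      then have "g x \<le> q" by (simp add: q_def g_def)
      then have "g x ^ j \<le> q ^ j" using g01(1)[of x] by (intro power_mono) auto
      then have "\<bar>f x * g x\<bar> * g x ^ j \<le> q ^ j * \<bar>f x * g x\<bar>" by (simp add: mult.commute mult_right_mono)
      moreover have "- (\<bar>f x * g x\<bar> * g x ^ j) \<le> f x * g x ^ Suc j"
        using g01(1)[of x] abs_ge_minus_self[of "f x * g x ^ Suc j"] by (simp add: abs_mult mult_ac)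
      ultimately show ?thesis using \<open>x \<notin> B\<close> by simp
    qed
    have Bi: "integrable lborel (\<lambda>x. indicator B x * (p ^ Suc j / 2))"
      by (intro integrable_mult_left integrable_real_indicator) (use emeasure_lborel_ball_finite[of c "\<delta> / 2"] in \<open>auto simp: B_def infinity_ennreal_def\<close>)
    have "(LINT x|lborel. indicator B x * (p ^ Suc j / 2) - q ^ j * \<bar>f x * g x\<bar>) \<le> (LINT x|lborel. f x * g x ^ Suc j)"
      by (intro integral_mono Bochner_Integration.integrable_diff Bi integrable_mult_right Mi fi pt) simp
    also have "\<dots> = 0" by (rule f0) simp
    also have "(LINT x|lborel. indicator B x * (p ^ Suc j / 2) - q ^ j * \<bar>f x * g x\<bar>) = v * (p ^ Suc j / 2) - q ^ j * M"
      using Bi Mi by (subst Bochner_Integration.integral_diff) (auto simp: v_def M_def B_def)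
    finally show ?thesis by simp
  qed
  have pq: "p > 0" "q > 0" "q < p" using \<delta>(1) by (auto simp: p_def q_def power2_eq_square)
  have "v * p / 2 \<le> (q / p) ^ j * M" for j
    using key[of j] pq by (simp add: power_divide field_simps)
  moreover have "(\<lambda>j. (q / p) ^ j * M) \<longlonglongrightarrow> 0 * M"
    using pq by (intro tendsto_intros LIMSEQ_power_zero) auto
  ultimately have "v * p / 2 \<le> 0 * M"
    by (intro LIMSEQ_le_const) auto
  then show False using v pq(1) by (simp add: mult_le_0_iff)
qed

section \<open>Radial multipliers\<close>

text \<open>The expectation of \<open>a\<close> under the Poisson distribution with parameter \<open>y\<close>. Differentiation in \<open>y\<close>
  replaces \<open>a\<close> by its difference sequence, so derivatives of all orders are again Poisson means.\<close>

definition poisson_mean :: "(nat \<Rightarrow> complex) \<Rightarrow> complex \<Rightarrow> complex" where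
  "poisson_mean a y = exp (- y) * (\<Sum>n. a n / fact n * y ^ n)"

lemma norm_poisson_term:
  fixes a :: "nat \<Rightarrow> complex" and y :: complex
  assumes "norm (a n) \<le> K * (1 + real n * L)" "K \<ge> 0" "L \<ge> 0"
  shows "norm (a n / fact n * y ^ n) \<le> K * ((norm y ^ n / fact n) + L * (real n * (norm y ^ n / fact n)))"
proof -
  have "norm (a n / fact n * y ^ n) = norm (a n) * (norm y ^ n / fact n)"
    by (simp add: norm_mult norm_divide norm_power)
  also have "\<dots> \<le> (K * (1 + real n * L)) * (norm y ^ n / fact n)"
    using assms by (intro mult_right_mono) auto
  finally show ?thesis by (simp add: algebra_simps)
qed

lemma first_moment_sums:
  fixes r :: real
  shows "(\<lambda>n. real n * (r ^ n / fact n)) sums (r * exp r)"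
proof -
  have "(\<lambda>n. r * (r ^ n / fact n)) sums (r * exp r)"
    using exp_converges[of r] by (intro sums_mult) (simp add: divide_inverse mult.commute)
  moreover have "r * (r ^ n / fact n) = real (Suc n) * (r ^ Suc n / fact (Suc n))" for n
    by (simp del: of_nat_Suc)
  ultimately have "(\<lambda>n. real (Suc n) * (r ^ Suc n / fact (Suc n))) sums (r * exp r)" by simp
  then show ?thesis by (subst (asm) sums_Suc_iff) simp
qed

lemma poisson_majorant_sums:
  fixes r :: real
  shows "(\<lambda>n. K * ((r ^ n / fact n) + L * (real n * (r ^ n / fact n)))) sums (K * (exp r + L * (r * exp r)))"
  using exp_converges[of r]
  by (intro sums_mult sums_add first_moment_sums) (simp add: divide_inverse mult.commute)

lemma poisson_summable:
  fixes a :: "nat \<Rightarrow> complex"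
  assumes "\<And>n. norm (a n) \<le> K * (1 + real n * L)" "L \<ge> 0"
  shows "summable (\<lambda>n. a n / fact n * y ^ n)"
proof (rule summable_comparison_test[OF _ sums_summable[OF poisson_majorant_sums]])
  have "K \<ge> 0" using order_trans[OF norm_ge_zero assms(1)[of 0]] by simp
  then show "\<exists>N. \<forall>n\<ge>N. norm (a n / fact n * y ^ n) \<le> K * ((norm y ^ n / fact n) + L * (real n * (norm y ^ n / fact n)))"
    using norm_poisson_term assms by blast
qed

text \<open>A Poisson mean is an average, and the Poisson distribution with parameter \<open>r\<close> has mean \<open>r\<close>.\<close>

lemma norm_poisson_mean_le:
  fixes a :: "nat \<Rightarrow> complex"
  assumes "\<And>n. norm (a n) \<le> K * (1 + real n * L)" "L \<ge> 0" "r \<ge> 0"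
  shows "norm (poisson_mean a (complex_of_real r)) \<le> K * (1 + L * r)"
proof -
  have K: "K \<ge> 0" using order_trans[OF norm_ge_zero assms(1)[of 0]] by simp
  let ?y = "complex_of_real r"
  have t: "norm (a n / fact n * ?y ^ n) \<le> K * ((r ^ n / fact n) + L * (real n * (r ^ n / fact n)))" for n
    using norm_poisson_term[of a n K L ?y] assms K by simp
  have "norm (\<Sum>n. a n / fact n * ?y ^ n) \<le> (\<Sum>n. K * ((r ^ n / fact n) + L * (real n * (r ^ n / fact n))))"
    by (rule norm_suminf_le[OF t sums_summable[OF poisson_majorant_sums]])
  also have "\<dots> = K * (exp r + L * (r * exp r))" using poisson_majorant_sums[of K r L] by (simp add: sums_iff)
  finally have "norm (poisson_mean a ?y) \<le> exp (- r) * (K * (exp r + L * (r * exp r)))"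
    unfolding poisson_mean_def norm_mult by (simp add: norm_exp_eq_Re)
  also have "\<dots> = K * (1 + L * r)" by (simp add: exp_minus field_simps)
  finally show ?thesis .
qed

lemma has_field_derivative_poisson_mean:
  assumes a: "\<And>n. norm (a n) \<le> K * (1 + real n * L)" "L \<ge> 0"
  shows "(poisson_mean a has_field_derivative poisson_mean (\<lambda>n. a (Suc n) - a n) y) (at y)"
proof -
  define c where "c = (\<lambda>n. a n / fact n)"
  have s: "summable (\<lambda>n. c n * y ^ n)" for y unfolding c_def by (rule poisson_summable[OF a])
  have K: "K \<ge> 0" using order_trans[OF norm_ge_zero a(1)[of 0]] by simp
  have a': "norm (a (Suc n)) \<le> (K * (1 + L)) * (1 + real n * L)" for n
  proof -
    have "norm (a (Suc n)) \<le> K * (1 + real (Suc n) * L)" by (rule a)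
    also have "\<dots> \<le> K * ((1 + L) * (1 + real n * L))"
      using K a(2) by (intro mult_left_mono) (auto simp: algebra_simps)
    finally show ?thesis by (simp add: mult.assoc)
  qed
  have s': "summable (\<lambda>n. a (Suc n) / fact n * y ^ n)" using poisson_summable[OF a' a(2)] by blast
  have "((\<lambda>y. \<Sum>n. c n * y ^ n) has_field_derivative (\<Sum>n. diffs c n * y ^ n)) (at y)"
    by (rule termdiffs_strong_converges_everywhere[OF s])
  moreover have "diffs c n = a (Suc n) / fact n" for n
    by (simp add: diffs_def c_def del: of_nat_Suc)
  ultimately have d: "((\<lambda>y. \<Sum>n. c n * y ^ n) has_field_derivative (\<Sum>n. a (Suc n) / fact n * y ^ n)) (at y)" by simp
  have e: "((\<lambda>y. exp (- y)) has_field_derivative - exp (- y)) (at y)"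
    by (auto intro!: derivative_eq_intros)
  have "(poisson_mean a has_field_derivative (- exp (- y)) * (\<Sum>n. c n * y ^ n) + (\<Sum>n. a (Suc n) / fact n * y ^ n) * exp (- y)) (at y)"
    using DERIV_mult[OF e d] by (simp only: poisson_mean_def[abs_def] c_def)
  moreover have "(\<Sum>n. (a (Suc n) - a n) / fact n * y ^ n) = (\<Sum>n. a (Suc n) / fact n * y ^ n) - (\<Sum>n. c n * y ^ n)"
    using suminf_diff[OF s' s[of y]] by (simp add: c_def diff_divide_distrib left_diff_distrib)
  ultimately show ?thesis by (simp add: poisson_mean_def right_diff_distrib mult.commute)
qed

lemma poisson_mean_scale: "poisson_mean (\<lambda>n. c * a n) y = c * poisson_mean a y"
  if "\<And>n. norm (a n) \<le> K * (1 + real n * L)" "L \<ge> 0"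
  using suminf_mult[OF poisson_summable[OF that, of y], of c] by (simp add: poisson_mean_def mult_ac)

lemma poisson_mean_add:
  assumes "\<And>n. norm (a n) \<le> K * (1 + real n * L)" "L \<ge> 0" "\<And>n. norm (b n) \<le> K' * (1 + real n * L')" "L' \<ge> 0"
  shows "poisson_mean (\<lambda>n. a n + b n) y = poisson_mean a y + poisson_mean b y"
proof -
  have "(\<Sum>n. (a n + b n) / fact n * y ^ n) = (\<Sum>n. a n / fact n * y ^ n) + (\<Sum>n. b n / fact n * y ^ n)"
    unfolding add_divide_distrib distrib_right
    by (rule suminf_add[symmetric, OF poisson_summable[OF assms(1,2)] poisson_summable[OF assms(3,4)]])
  then show ?thesis by (simp only: poisson_mean_def distrib_left)
qed

definition radial_multiplier :: "real \<Rightarrow> (nat \<Rightarrow> complex) \<Rightarrow> real^3 \<Rightarrow> complex" where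
  "radial_multiplier \<epsilon> a x = poisson_mean a (complex_of_real (\<epsilon> * (norm x)\<^sup>2))"

lemma has_derivative_radial_multiplier:
  assumes a: "\<And>n. norm (a n) \<le> K * (1 + real n * L)" "L \<ge> 0"
  shows "(radial_multiplier \<epsilon> a has_derivative
     (\<lambda>v. complex_of_real (2 * \<epsilon> * (x \<bullet> v)) * poisson_mean (\<lambda>n. a (Suc n) - a n) (complex_of_real (\<epsilon> * (norm x)\<^sup>2)))) (at x)"
proof -
  have "((\<lambda>x::real^3. complex_of_real (\<epsilon> * (norm x)\<^sup>2)) has_derivative (\<lambda>v. complex_of_real (2 * \<epsilon> * (x \<bullet> v)))) (at x)"
    unfolding power2_norm_eq_inner
    by (auto intro!: derivative_eq_intros simp: inner_commute algebra_simps)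
  from has_derivative_compose[OF this has_field_derivative_poisson_mean[OF a, unfolded has_field_derivative_def]]
  show ?thesis unfolding radial_multiplier_def[abs_def] by (simp only: mult.commute)
qed

text \<open>The admissible growth \<open>1 + n / \<epsilon>\<close> of the sequences serves two purposes. At parameter
  \<open>\<epsilon> \<parallel>x\<parallel>\<^sup>2\<close> it bounds the Poisson mean by \<open>K (1 + \<parallel>x\<parallel>\<^sup>2)\<close> uniformly in \<open>\<epsilon>\<close>; and it admits the sequence that
  is \<open>1 / \<epsilon>\<close> except for the entry \<open>0\<close> at \<open>n = 0\<close>, whose mean is \<open>(1 - exp (- \<epsilon> \<parallel>x\<parallel>\<^sup>2)) / \<epsilon>\<close>, the function
  that measures the convergence of the damped test functions as \<open>\<epsilon> \<rightarrow> 0\<close>.\<close>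

definition radial_family :: "real \<Rightarrow> (real^3 \<Rightarrow> complex) set \<Rightarrow> (real^3 \<Rightarrow> complex) set" where
  "radial_family K \<Psi> = {(\<lambda>x. radial_multiplier \<epsilon> a x * \<psi> x) | \<epsilon> a \<psi>.
     0 < \<epsilon> \<and> \<epsilon> \<le> 1 \<and> (\<forall>n. norm (a n) \<le> K * (1 + real n * (1 / \<epsilon>))) \<and> \<psi> \<in> \<Psi>}"

lemma radial_familyI:
  assumes "0 < \<epsilon>" "\<epsilon> \<le> 1" "\<And>n. norm (a n) \<le> K * (1 + real n * (1 / \<epsilon>))" "\<psi> \<in> \<Psi>"
  shows "(\<lambda>x. radial_multiplier \<epsilon> a x * \<psi> x) \<in> radial_family K \<Psi>"
  unfolding radial_family_def using assms by (intro CollectI exI conjI allI) (rule refl)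

lemma radial_familyE:
  assumes "\<phi> \<in> radial_family K \<Psi>"
  obtains \<epsilon> a \<psi> where "\<phi> = (\<lambda>x. radial_multiplier \<epsilon> a x * \<psi> x)" "0 < \<epsilon>" "\<epsilon> \<le> 1"
    "\<And>n. norm (a n) \<le> K * (1 + real n * (1 / \<epsilon>))" "\<psi> \<in> \<Psi>"
proof -
  from assms obtain \<epsilon> a \<psi> where "\<phi> = (\<lambda>x. radial_multiplier \<epsilon> a x * \<psi> x) \<and> 0 < \<epsilon> \<and> \<epsilon> \<le> 1 \<and>
    (\<forall>n. norm (a n) \<le> K * (1 + real n * (1 / \<epsilon>))) \<and> \<psi> \<in> \<Psi>"
    unfolding radial_family_def by (elim CollectE exE) (rule that)
  then show thesis by (intro that) auto
qed

inductive radial_class :: "(real^3 \<Rightarrow> complex) set \<Rightarrow> bool" where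
  base: "schwartz_bounded \<Psi> \<Longrightarrow> radial_class (radial_family K \<Psi>)"
| sum: "radial_class S \<Longrightarrow> radial_class S' \<Longrightarrow> radial_class (fun_sum S S')"

text \<open>The chain rule produces the sequence \<open>\<epsilon> (a\<^sub>n\<^sub>+\<^sub>1 - a\<^sub>n)\<close> and the factor \<open>2 x\<^sub>j\<close>, which is absorbed by \<open>\<psi>\<close>.\<close>

lemma partial_deriv_radial:
  assumes a: "\<And>n. norm (a n) \<le> K * (1 + real n * L)" "L \<ge> 0" and d: "\<And>x. \<psi> differentiable (at x)"
  shows "partial_deriv j (\<lambda>x. radial_multiplier \<epsilon> a x * \<psi> x) =
    (\<lambda>x. radial_multiplier \<epsilon> a x * partial_deriv j \<psi> x +
         radial_multiplier \<epsilon> (\<lambda>n. of_real \<epsilon> * (a (Suc n) - a n)) x * (2 * (complex_of_real (x $ j) * \<psi> x)))"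
proof -
  have dm: "radial_multiplier \<epsilon> a differentiable (at x)" for x
    using has_derivative_radial_multiplier[OF a] differentiable_def by blast
  have K: "K \<ge> 0" using order_trans[OF norm_ge_zero a(1)[of 0]] by simp
  have b: "norm (a (Suc n) - a n) \<le> (K * (2 + L)) * (1 + real n * L)" for n
  proof -
    have "norm (a (Suc n) - a n) \<le> K * (1 + real (Suc n) * L) + K * (1 + real n * L)"
      using norm_triangle_ineq4[of "a (Suc n)" "a n"] a(1)[of n] a(1)[of "Suc n"] by linarith
    also have "\<dots> = K * (2 + L + 2 * (real n * L))" by (simp add: algebra_simps)
    also have "\<dots> \<le> K * ((2 + L) * (1 + real n * L))"
      using K a(2) by (intro mult_left_mono) (auto simp: algebra_simps)
    finally show ?thesis by (simp add: mult.assoc)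
  qed
  have "partial_deriv j (radial_multiplier \<epsilon> a) x = radial_multiplier \<epsilon> (\<lambda>n. of_real \<epsilon> * (a (Suc n) - a n)) x * (2 * complex_of_real (x $ j))" for x
    unfolding partial_deriv_eq[OF has_derivative_radial_multiplier[OF a]] radial_multiplier_def
      poisson_mean_scale[OF b a(2)]
    by (simp add: inner_axis)
  then show ?thesis
    unfolding partial_deriv_mult[OF dm d] by (simp add: mult_ac)
qed

lemma radial_class_differentiable:
  assumes "radial_class S" "\<phi> \<in> S"
  shows "\<phi> differentiable (at x)"
  using assms
proof (induction arbitrary: \<phi>)
  case (base \<Psi> K)
  from base.prems obtain \<epsilon> a \<psi> where \<phi>: "\<phi> = (\<lambda>x. radial_multiplier \<epsilon> a x * \<psi> x)" "0 < \<epsilon>" "\<epsilon> \<le> 1"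
    "\<And>n. norm (a n) \<le> K * (1 + real n * (1 / \<epsilon>))" "\<psi> \<in> \<Psi>"
    by (rule radial_familyE) (rule that)
  have "1 / \<epsilon> \<ge> 0" using \<phi>(2) by simp
  from has_derivative_radial_multiplier[OF \<phi>(4) this]
  have "radial_multiplier \<epsilon> a differentiable (at x)" by (rule differentiableI)
  then show ?case unfolding \<phi>(1) using schwartz_bounded_differentiable[OF base.hyps \<phi>(5)]
    by (rule differentiable_mult)
next
  case (sum S S')
  from sum.prems obtain \<phi>1 \<phi>2 where "\<phi>1 \<in> S" "\<phi>2 \<in> S'" "\<phi> = (\<lambda>x. \<phi>1 x + \<phi>2 x)" by (rule fun_sumE)
  then show ?case using sum.IH by (auto intro!: differentiable_add)
qed

text \<open>Closure under derivatives uses \<open>\<epsilon> \<le> 1\<close>: the difference sequence scaled by \<open>\<epsilon>\<close> satisfies the growth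
  bound again, with \<open>3 K\<close> in place of \<open>K\<close>.\<close>

lemma radial_class_schwartz_bounded:
  assumes "radial_class S" shows "schwartz_bounded S"
  using assms
proof (rule schwartz_bounded_coinduct[where P = radial_class])
  fix S \<phi> x assume "radial_class S" "\<phi> \<in> S"
  then show "\<phi> differentiable at x" by (rule radial_class_differentiable)
next
  fix S assume "radial_class S"
  then show "rapidly_decreasing S"
  proof induction
    case (base \<Psi> K)
    show ?case unfolding rapidly_decreasing_def
    proof
      fix k
      obtain C where C: "\<And>\<psi> x. \<psi> \<in> \<Psi> \<Longrightarrow> (1 + norm x) ^ (k + 2) * norm (\<psi> x) \<le> C"
        using schwartz_bounded_rapid[OF base] unfolding rapidly_decreasing_def by metis
      have "(1 + norm x) ^ k * norm (radial_multiplier \<epsilon> a x * \<psi> x) \<le> K * C"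
        if e: "0 < \<epsilon>" "\<epsilon> \<le> 1" and a: "\<And>n. norm (a n) \<le> K * (1 + real n * (1 / \<epsilon>))" and \<psi>: "\<psi> \<in> \<Psi>" for \<epsilon> a \<psi> x
      proof -
        have K: "K \<ge> 0" using order_trans[OF norm_ge_zero a[of 0]] by simp
        have "norm (radial_multiplier \<epsilon> a x) \<le> K * (1 + (1 / \<epsilon>) * (\<epsilon> * (norm x)\<^sup>2))"
          unfolding radial_multiplier_def by (rule norm_poisson_mean_le[OF a]) (use e in auto)
        also have "\<dots> = K * (1 + (norm x)\<^sup>2)" using e by simp
        also have "\<dots> \<le> K * (1 + norm x)\<^sup>2"
        proof (intro mult_left_mono K)
          show "1 + (norm x)\<^sup>2 \<le> (1 + norm x)\<^sup>2" by (simp add: power2_sum)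
        qed
        finally have m: "norm (radial_multiplier \<epsilon> a x) \<le> K * (1 + norm x)\<^sup>2" .
        have "(1 + norm x) ^ k * norm (radial_multiplier \<epsilon> a x * \<psi> x) \<le> (1 + norm x) ^ k * ((K * (1 + norm x)\<^sup>2) * norm (\<psi> x))"
          unfolding norm_mult by (intro mult_left_mono mult_right_mono m) auto
        also have "\<dots> = K * ((1 + norm x) ^ (k + 2) * norm (\<psi> x))" by (simp add: power_add power2_eq_square mult_ac)
        also have "\<dots> \<le> K * C" using C[OF \<psi>, of x] K by (rule mult_left_mono)
        finally show ?thesis .
      qed
      note b = this
      show "\<exists>C. \<forall>\<phi>\<in>radial_family K \<Psi>. \<forall>x. (1 + norm x) ^ k * norm (\<phi> x) \<le> C"
      proof (intro exI ballI allI)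
        fix \<phi> x assume "\<phi> \<in> radial_family K \<Psi>"
        then show "(1 + norm x) ^ k * norm (\<phi> x) \<le> K * C" by (rule radial_familyE) (simp add: b)
      qed
    qed
  qed (rule rapidly_decreasing_sum)
next
  fix S j assume "radial_class S"
  then show "\<exists>S'. radial_class S' \<and> partial_deriv j ` S \<subseteq> S'"
  proof induction
    case (base \<Psi> K)
    let ?S' = "fun_sum (radial_family K (partial_deriv j ` \<Psi>)) (radial_family (3 * K) (fun_scale 2 (fun_coord j \<Psi>)))"
    have "radial_class ?S'"
      by (intro radial_class.intros schwartz_bounded_partial schwartz_bounded_scale schwartz_bounded_coord base)
    moreover have "partial_deriv j \<phi> \<in> ?S'" if "\<phi> \<in> radial_family K \<Psi>" for \<phi>
    proof -
      from that obtain \<epsilon> a \<psi> where \<phi>: "\<phi> = (\<lambda>x. radial_multiplier \<epsilon> a x * \<psi> x)" and e: "0 < \<epsilon>" "\<epsilon> \<le> 1"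
        and a: "\<And>n. norm (a n) \<le> K * (1 + real n * (1 / \<epsilon>))" and \<psi>: "\<psi> \<in> \<Psi>"
        by (rule radial_familyE) (rule that)
      have K: "K \<ge> 0" using order_trans[OF norm_ge_zero a[of 0]] by simp
      let ?a' = "\<lambda>n. of_real \<epsilon> * (a (Suc n) - a n)"
      have a': "norm (?a' n) \<le> 3 * K * (1 + real n * (1 / \<epsilon>))" for n
      proof -
        have "norm (?a' n) = \<epsilon> * norm (a (Suc n) - a n)" using e by (simp add: norm_mult)
        also have "\<dots> \<le> \<epsilon> * (K * (1 + real (Suc n) * (1 / \<epsilon>)) + K * (1 + real n * (1 / \<epsilon>)))"
          using e norm_triangle_ineq4[of "a (Suc n)" "a n"] a[of n] a[of "Suc n"] by (intro mult_left_mono) auto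
        also have "\<dots> = K * (2 * \<epsilon> + 2 * real n + 1)" using e by (simp add: field_simps)
        also have "\<dots> \<le> K * (3 * (1 + real n * (1 / \<epsilon>)))"
        proof (intro mult_left_mono K)
          have "real n * 1 \<le> real n * (1 / \<epsilon>)" using e by (intro mult_left_mono) auto
          then show "2 * \<epsilon> + 2 * real n + 1 \<le> 3 * (1 + real n * (1 / \<epsilon>))" using e by (smt (verit) of_nat_0_le_iff)
        qed
        finally show ?thesis by (simp add: mult_ac)
      qed
      have "(\<lambda>x. radial_multiplier \<epsilon> a x * partial_deriv j \<psi> x) \<in> radial_family K (partial_deriv j ` \<Psi>)"
        using e a \<psi> by (intro radial_familyI) auto
      moreover have "(\<lambda>x. radial_multiplier \<epsilon> ?a' x * (2 * (complex_of_real (x $ j) * \<psi> x))) \<in> radial_family (3 * K) (fun_scale 2 (fun_coord j \<Psi>))"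
      proof -
        have "(\<lambda>x. 2 * (complex_of_real (x $ j) * \<psi> x)) \<in> fun_scale 2 (fun_coord j \<Psi>)"
          by (intro fun_scaleI fun_coordI \<psi>) simp
        then show ?thesis using e a' by (intro radial_familyI) auto
      qed
      moreover have "partial_deriv j \<phi> = (\<lambda>x. radial_multiplier \<epsilon> a x * partial_deriv j \<psi> x + radial_multiplier \<epsilon> ?a' x * (2 * (complex_of_real (x $ j) * \<psi> x)))"
        unfolding \<phi> by (rule partial_deriv_radial[OF a]) (use e schwartz_bounded_differentiable[OF base \<psi>] in auto)
      ultimately show ?thesis using fun_sumI by simp
    qed
    ultimately show ?case by blast
  next
    case (sum S S')
    then obtain T T' where T: "radial_class T" "partial_deriv j ` S \<subseteq> T" "radial_class T'" "partial_deriv j ` S' \<subseteq> T'" by blast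
    have "partial_deriv j \<phi> \<in> fun_sum T T'" if "\<phi> \<in> fun_sum S S'" for \<phi>
    proof -
      from that obtain \<phi>1 \<phi>2 where \<phi>: "\<phi>1 \<in> S" "\<phi>2 \<in> S'" "\<phi> = (\<lambda>x. \<phi>1 x + \<phi>2 x)" by (rule fun_sumE)
      have "partial_deriv j \<phi> = (\<lambda>x. partial_deriv j \<phi>1 x + partial_deriv j \<phi>2 x)"
        unfolding \<phi>(3) by (intro partial_deriv_sum radial_class_differentiable[OF sum.hyps(1) \<phi>(1)] radial_class_differentiable[OF sum.hyps(2) \<phi>(2)])
      moreover have "partial_deriv j \<phi>1 \<in> T" "partial_deriv j \<phi>2 \<in> T'" using \<phi> T by blast+
      ultimately show ?thesis by (simp add: fun_sumI)
    qed
    then show ?case using radial_class.sum[OF T(1,3)] by blast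
  qed
qed

section \<open>Uniform bounds on Gaussian moments\<close>

text \<open>The Banach--Steinhaus theorem by Baire's argument: some set of vectors with uniformly bounded orbit
  contains a ball.\<close>

lemma uniform_boundedness:
  fixes L :: "'t \<Rightarrow> 'a::{real_normed_vector, complete_space} \<Rightarrow> 'b::real_normed_vector"
  assumes lin: "\<And>t. t \<in> I \<Longrightarrow> bounded_linear (L t)"
    and ptw: "\<And>a. bounded ((\<lambda>t. L t a) ` I)"
  obtains C where "\<And>t a. t \<in> I \<Longrightarrow> norm (L t a) \<le> C * norm a"
proof -
  define F where "F = (\<lambda>n::nat. {a. \<forall>t\<in>I. norm (L t a) \<le> real n})"
  have closed: "closed (F n)" for n
  proof -
    have "F n = (\<Inter>t\<in>I. {a. norm (L t a) \<le> real n})" by (auto simp: F_def)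
    moreover have "closed {a. norm (L t a) \<le> real n}" if "t \<in> I" for t
      by (intro closed_Collect_le continuous_intros linear_continuous_on lin that)
    ultimately show ?thesis by auto
  qed
  have cover: "(\<Union>n. F n) = UNIV"
  proof (intro set_eqI iffI UNIV_I)
    fix a
    obtain M where M: "\<And>t. t \<in> I \<Longrightarrow> norm (L t a) \<le> M"
      using ptw[of a] unfolding bounded_iff by (metis imageI)
    obtain n where "M \<le> real n" using real_arch_simple by blast
    then have "a \<in> F n" unfolding F_def using M order_trans by blast
    then show "a \<in> (\<Union>n. F n)" by blast
  qed
  have "\<exists>n. interior (F n) \<noteq> {}"
  proof (rule ccontr)
    assume "\<not> ?thesis"
    then have "Met_TC.mtopology interior_of (\<Union>(range F)) = {}"
      using closed by (intro Met_TC.metric_Baire_category_alt) (auto simp: complete_UNIV)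
    then show False using cover by simp
  qed
  then obtain n a0 where "a0 \<in> interior (F n)" by blast
  then obtain r where r: "r > 0" "ball a0 r \<subseteq> F n" unfolding mem_interior by blast
  have "norm (L t a) \<le> (4 * real n / r) * norm a" if t: "t \<in> I" for t a
  proof (cases "a = 0")
    case True
    then show ?thesis using linear_0[OF bounded_linear.linear[OF lin[OF t]]] by simp
  next
    case False
    interpret bounded_linear "L t" by (rule lin[OF t])
    define s where "s = r / 2 / norm a"
    have s: "s > 0" using r False by (simp add: s_def)
    have "dist a0 (a0 + s *\<^sub>R a) = s * norm a" using s by (simp add: dist_norm)
    also have "\<dots> < r" using r False by (simp add: s_def)
    finally have "a0 + s *\<^sub>R a \<in> F n" "a0 \<in> F n" using r by auto
    then have "norm (L t (a0 + s *\<^sub>R a)) \<le> real n" "norm (L t a0) \<le> real n" using t by (auto simp: F_def)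
    then have "norm (L t (a0 + s *\<^sub>R a) - L t a0) \<le> 2 * real n"
      using norm_triangle_ineq4[of "L t (a0 + s *\<^sub>R a)" "L t a0"] by linarith
    then have "s * norm (L t a) \<le> 2 * real n" using s by (simp add: add scale)
    then have "norm (L t a) \<le> 2 * real n / s" using s by (simp add: field_simps)
    also have "\<dots> = (4 * real n / r) * norm a" using r False by (simp add: s_def field_simps)
    finally show ?thesis .
  qed
  then show thesis using that by blast
qed

definition gauss_moment :: "real \<Rightarrow> (real^3 \<Rightarrow> complex) \<Rightarrow> nat \<Rightarrow> real^3 \<Rightarrow> complex" where
  "gauss_moment \<epsilon> \<psi> n x = complex_of_real ((norm x)\<^sup>2 ^ n * exp (- (\<epsilon> * (norm x)\<^sup>2))) * \<psi> x"

text \<open>A unit sequence picks out one Poisson probability, a monomial times a Gaussian.\<close>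

lemma radial_multiplier_unit:
  assumes "\<epsilon> > 0"
  shows "radial_multiplier \<epsilon> (\<lambda>k. if k = n then 1 else 0) x * \<psi> x = complex_of_real (\<epsilon> ^ n / fact n) * gauss_moment \<epsilon> \<psi> n x"
proof -
  have "(\<Sum>k. (if k = n then 1 else 0) / fact k * y ^ k) = y ^ n / fact n" for y :: complex
    by (subst suminf_finite[of "{n}"]) auto
  then have "radial_multiplier \<epsilon> (\<lambda>k. if k = n then 1 else 0) x =
      exp (- complex_of_real (\<epsilon> * (norm x)\<^sup>2)) * (complex_of_real (\<epsilon> * (norm x)\<^sup>2) ^ n / fact n)"
    unfolding radial_multiplier_def poisson_mean_def by simp
  also have "\<dots> = complex_of_real (exp (- (\<epsilon> * (norm x)\<^sup>2)) * ((\<epsilon> * (norm x)\<^sup>2) ^ n / fact n))"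
    by (simp flip: exp_of_real)
  also have "exp (- (\<epsilon> * (norm x)\<^sup>2)) * ((\<epsilon> * (norm x)\<^sup>2) ^ n / fact n) = (\<epsilon> ^ n / fact n) * ((norm x)\<^sup>2 ^ n * exp (- (\<epsilon> * (norm x)\<^sup>2)))"
    unfolding power_mult_distrib by simp
  finally show ?thesis unfolding gauss_moment_def of_real_mult by (simp only: mult.assoc)
qed

text \<open>The mean of a constant sequence without its entry at \<open>0\<close> is the constant times the Poisson probability
  of a nonzero count.\<close>

lemma radial_multiplier_complement:
  assumes "\<epsilon> > 0"
  shows "radial_multiplier \<epsilon> (\<lambda>k. if k = 0 then 0 else complex_of_real (1 / \<epsilon>)) x * \<psi> x = complex_of_real (1 / \<epsilon>) * (\<psi> x - gauss_moment \<epsilon> \<psi> 0 x)"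
proof -
  define y where "y = complex_of_real (\<epsilon> * (norm x)\<^sup>2)"
  have "(\<lambda>k. y ^ k /\<^sub>R fact k) sums exp y" by (rule exp_converges)
  then have "(\<lambda>k. y ^ Suc k /\<^sub>R fact (Suc k)) sums (exp y - 1)" by (subst sums_Suc_iff) simp
  then have "(\<lambda>k. complex_of_real (1 / \<epsilon>) * (y ^ Suc k /\<^sub>R fact (Suc k))) sums (complex_of_real (1 / \<epsilon>) * (exp y - 1))"
    by (rule sums_mult)
  then have "(\<lambda>k. (if Suc k = 0 then 0 else complex_of_real (1 / \<epsilon>)) / fact (Suc k) * y ^ Suc k) sums (complex_of_real (1 / \<epsilon>) * (exp y - 1))"
    by (simp add: scaleR_conv_of_real divide_inverse mult_ac)
  then have "(\<lambda>k. (if k = 0 then 0 else complex_of_real (1 / \<epsilon>)) / fact k * y ^ k) sums (complex_of_real (1 / \<epsilon>) * (exp y - 1))"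
    by (subst (asm) sums_Suc_iff) simp
  then have "radial_multiplier \<epsilon> (\<lambda>k. if k = 0 then 0 else complex_of_real (1 / \<epsilon>)) x = exp (- y) * (complex_of_real (1 / \<epsilon>) * (exp y - 1))"
    unfolding radial_multiplier_def poisson_mean_def y_def[symmetric] by (simp add: sums_iff)
  also have "\<dots> = complex_of_real (1 / \<epsilon>) * (1 - exp (- y))"
    by (simp add: exp_minus field_simps)
  also have "exp (- y) = complex_of_real (exp (- (\<epsilon> * (norm x)\<^sup>2)))" unfolding y_def by (simp flip: exp_of_real)
  finally have R: "radial_multiplier \<epsilon> (\<lambda>k. if k = 0 then 0 else complex_of_real (1 / \<epsilon>)) x = complex_of_real (1 / \<epsilon>) * (1 - complex_of_real (exp (- (\<epsilon> * (norm x)\<^sup>2))))" .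
  show ?thesis unfolding R gauss_moment_def by (simp add: algebra_simps)
qed

lemma schwartz_radial_family:
  assumes "schwartz \<psi>" shows "schwartz_bounded (radial_family K {\<psi>})"
  using assms unfolding schwartz_iff_bounded by (rule radial_class_schwartz_bounded[OF radial_class.base])

lemma schwartz_gauss_moment:
  assumes "schwartz \<psi>" "0 < \<epsilon>" "\<epsilon> \<le> 1"
  shows "schwartz (gauss_moment \<epsilon> \<psi> n)"
proof -
  have "(\<lambda>x. radial_multiplier \<epsilon> (\<lambda>k. if k = n then 1 else 0) x * \<psi> x) \<in> radial_family 1 {\<psi>}"
    using assms by (intro radial_familyI) auto
  then have "schwartz (\<lambda>x. complex_of_real (\<epsilon> ^ n / fact n) * gauss_moment \<epsilon> \<psi> n x)"
    unfolding radial_multiplier_unit[OF assms(2)]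
    by (rule schwartz_bounded_imp_schwartz[OF schwartz_radial_family[OF assms(1)]])
  then have "schwartz (\<lambda>x. complex_of_real (fact n / \<epsilon> ^ n) * (complex_of_real (\<epsilon> ^ n / fact n) * gauss_moment \<epsilon> \<psi> n x))"
    by (rule schwartz_scale)
  then show ?thesis using assms(2) by (simp add: mult.assoc[symmetric] flip: of_real_mult)
qed

lemma gauss_moment_Suc: "complex_of_real ((norm x)\<^sup>2) * gauss_moment \<epsilon> \<psi> n x = gauss_moment \<epsilon> \<psi> (Suc n) x"
  by (simp add: gauss_moment_def mult_ac)

lemma power_times_exp_le:
  fixes \<epsilon> s :: real
  assumes "\<epsilon> > 0" "s \<ge> 0"
  shows "s ^ n * exp (- (\<epsilon> * s)) \<le> fact n * (1 / \<epsilon>) ^ n"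
proof -
  have "(\<Sum>k\<in>{n}. (\<epsilon> * s) ^ k /\<^sub>R fact k) \<le> (\<Sum>k. (\<epsilon> * s) ^ k /\<^sub>R fact k)"
    by (rule sum_le_suminf[OF sums_summable[OF exp_converges]]) (use assms in auto)
  also have "\<dots> = exp (\<epsilon> * s)" by (rule sums_unique[OF exp_converges, symmetric])
  finally show ?thesis using assms by (simp add: exp_minus field_simps power_mult_distrib)
qed

lemma norm_gauss_moment_le:
  assumes "\<epsilon> > 0"
  shows "norm (gauss_moment \<epsilon> \<psi> n x) \<le> fact n * (1 / \<epsilon>) ^ n * norm (\<psi> x)"
  unfolding gauss_moment_def norm_mult norm_of_real
  using power_times_exp_le[OF assms, of "(norm x)\<^sup>2" n] by (intro mult_right_mono) auto

locale tempered_family =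
  fixes V :: "real \<Rightarrow> distr" and I :: "real set"
  assumes linear: "\<And>t \<phi> \<psi> a b. t \<in> I \<Longrightarrow> schwartz \<phi> \<Longrightarrow> schwartz \<psi> \<Longrightarrow>
      V t (\<lambda>x. a * \<phi> x + b * \<psi> x) = a * V t \<phi> + b * V t \<psi>"
    and bounded_on: "\<And>t S. t \<in> I \<Longrightarrow> schwartz_bounded S \<Longrightarrow> \<exists>C. \<forall>\<phi>\<in>S. norm (V t \<phi>) \<le> C"
begin

lemma scale: "t \<in> I \<Longrightarrow> schwartz \<phi> \<Longrightarrow> V t (\<lambda>x. a * \<phi> x) = a * V t \<phi>"
  using linear[of t \<phi> \<phi> a 0] by simp

lemma add: "t \<in> I \<Longrightarrow> schwartz \<phi> \<Longrightarrow> schwartz \<psi> \<Longrightarrow> V t (\<lambda>x. \<phi> x + \<psi> x) = V t \<phi> + V t \<psi>"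
  using linear[of t \<phi> \<psi> 1 1] by simp

text \<open>For each \<open>t\<close> the map from a bounded sequence \<open>a\<close> to the pairing of \<open>V t\<close> with its Poisson mean times
  \<open>\<psi>\<close> is a bounded functional, and for each \<open>a\<close> the pairings are bounded in \<open>t\<close>. Banach--Steinhaus makes
  the bound uniform in both, and the unit sequences give the moments. Pointwise boundedness on all test
  functions is thus upgraded to a quantitative bound on one sequence of them.\<close>

lemma gauss_moment_bound:
  assumes ptw: "\<And>\<phi>. schwartz \<phi> \<Longrightarrow> bounded ((\<lambda>t. V t \<phi>) ` I)"
    and \<psi>: "schwartz \<psi>" and e: "0 < \<epsilon>" "\<epsilon> \<le> 1"
  obtains C where "C \<ge> 0" "\<And>t n. t \<in> I \<Longrightarrow> norm (V t (gauss_moment \<epsilon> \<psi> n)) \<le> C * fact n * (1 / \<epsilon>) ^ n"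
proof -
  \<comment> \<open>Bounded sequences are bounded continuous functions on the line sampled at the naturals; their space is complete.\<close>
  define f where "f = (\<lambda>(a :: real \<Rightarrow>\<^sub>C complex) x. radial_multiplier \<epsilon> (\<lambda>k. apply_bcontfun a (real k)) x * \<psi> x)"
  have fam: "f a \<in> radial_family (norm a) {\<psi>}" for a
    unfolding f_def
  proof (rule radial_familyI[OF e])
    fix n :: nat
    have "norm (apply_bcontfun a (real n)) \<le> norm a" by (rule norm_bounded)
    also have "\<dots> \<le> norm a * (1 + real n * (1 / \<epsilon>))" using e by (simp add: mult_le_cancel_left1)
    finally show "norm (apply_bcontfun a (real n)) \<le> norm a * (1 + real n * (1 / \<epsilon>))" .
  qed simp
  have fs: "schwartz (f a)" for a
    by (rule schwartz_bounded_imp_schwartz[OF schwartz_radial_family[OF \<psi>] fam])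
  have b: "norm (apply_bcontfun a (real n)) \<le> norm a * (1 + real n * 0)" for a :: "real \<Rightarrow>\<^sub>C complex" and n :: nat
    using norm_bounded[of a "real n"] by simp
  have f_add: "f (a + a') = (\<lambda>x. f a x + f a' x)" for a a'
    unfolding f_def radial_multiplier_def plus_bcontfun.rep_eq
    by (simp add: poisson_mean_add[OF b _ b] distrib_right)
  have f_scale: "f (r *\<^sub>R a) = (\<lambda>x. complex_of_real r * f a x)" for r a
    unfolding f_def radial_multiplier_def scaleR_bcontfun.rep_eq scaleR_conv_of_real
    by (simp add: poisson_mean_scale[OF b] mult.assoc)
  have bl: "bounded_linear (\<lambda>a. V t (f a))" if t: "t \<in> I" for t
  proof -
    obtain C where C: "\<And>\<phi>. \<phi> \<in> radial_family 1 {\<psi>} \<Longrightarrow> norm (V t \<phi>) \<le> C"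
      using bounded_on[OF t schwartz_radial_family[OF \<psi>]] by metis
    show ?thesis
    proof (rule bounded_linear_intro)
      show "V t (f (a + a')) = V t (f a) + V t (f a')" for a a'
        unfolding f_add by (rule add[OF t fs fs])
      show sc: "V t (f (r *\<^sub>R a)) = r *\<^sub>R V t (f a)" for r a
        unfolding f_scale scaleR_conv_of_real by (rule scale[OF t fs])
      show "norm (V t (f a)) \<le> norm a * C" for a
      proof (cases "a = 0")
        case True
        have "f 0 = f (0 *\<^sub>R 0)" by simp
        then have "V t (f 0) = 0" using sc[of 0 0] by simp
        then show ?thesis using True by simp
      next
        case False
        define a' where "a' = inverse (norm a) *\<^sub>R a"
        have "norm a' = 1" using False by (simp add: a'_def)
        then have "norm (V t (f a')) \<le> C" using C fam[of a'] by simp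
        moreover have "a = norm a *\<^sub>R a'" using False by (simp add: a'_def)
        then have "norm (V t (f a)) = norm a * norm (V t (f a'))" using sc[of "norm a" a'] by simp
        ultimately show ?thesis by (simp add: mult_left_mono)
      qed
    qed
  qed
  obtain C where C: "\<And>t a. t \<in> I \<Longrightarrow> norm (V t (f a)) \<le> C * norm a"
    by (rule uniform_boundedness[of I "\<lambda>t a. V t (f a)", OF bl ptw[OF fs]]) (assumption, rule that)
  have "norm (V t (gauss_moment \<epsilon> \<psi> n)) \<le> max 0 C * fact n * (1 / \<epsilon>) ^ n" if t: "t \<in> I" for t n
  proof -
    \<comment> \<open>A tent function realises the \<open>n\<close>-th unit sequence.\<close>
    define u where "u = (\<lambda>x. complex_of_real (max 0 (1 - \<bar>x - real n\<bar>)))"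
    have u1: "norm (u x) \<le> 1" for x by (simp add: u_def)
    have "continuous_on UNIV u" unfolding u_def by (intro continuous_intros)
    then have "u \<in> bcontfun" unfolding bcontfun_def using u1 by (auto intro!: boundedI[where B = 1])
    then obtain U where U: "u = apply_bcontfun U" by (rule bcontfunE)
    have uk: "(\<lambda>k. u (real k)) = (\<lambda>k. if k = n then 1 else 0)"
    proof
      fix k
      have "\<bar>real k - real n\<bar> \<ge> 1" if "k \<noteq> n" using that by linarith
      then show "u (real k) = (if k = n then 1 else 0)" by (simp add: u_def)
    qed
    have "norm U \<le> 1" by (rule norm_bound) (simp add: U[symmetric] u1)
    have "C * norm U \<le> max 0 C * norm U" by (intro mult_right_mono) auto
    also have "\<dots> \<le> max 0 C * 1" using \<open>norm U \<le> 1\<close> by (intro mult_left_mono) auto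
    finally have "C * norm U \<le> max 0 C" by simp
    then have "norm (V t (f U)) \<le> max 0 C" using C[OF t, of U] by linarith
    moreover have fU: "f U = (\<lambda>x. complex_of_real (\<epsilon> ^ n / fact n) * gauss_moment \<epsilon> \<psi> n x)"
      unfolding f_def U[symmetric] uk radial_multiplier_unit[OF e(1)] ..
    have "V t (f U) = complex_of_real (\<epsilon> ^ n / fact n) * V t (gauss_moment \<epsilon> \<psi> n)"
      unfolding fU by (rule scale[OF t schwartz_gauss_moment[OF \<psi> e]])
    then have "norm (V t (f U)) = (\<epsilon> ^ n / fact n) * norm (V t (gauss_moment \<epsilon> \<psi> n))"
      using e by (simp add: norm_mult norm_divide norm_power)
    ultimately have "(\<epsilon> ^ n / fact n) * norm (V t (gauss_moment \<epsilon> \<psi> n)) \<le> max 0 C" by simp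
    then show ?thesis using e by (simp add: field_simps)
  qed
  then show thesis using that[of "max 0 C"] by simp
qed

text \<open>The error is \<open>\<epsilon>\<close> times the pairing with an element of a fixed bounded set.\<close>

lemma gauss_moment_tendsto:
  assumes t: "t \<in> I" and \<psi>: "schwartz \<psi>"
  shows "(\<lambda>j. V t (gauss_moment (1 / real (Suc j)) \<psi> 0)) \<longlonglongrightarrow> V t \<psi>"
proof -
  obtain C where C: "\<And>\<phi>. \<phi> \<in> radial_family 1 {\<psi>} \<Longrightarrow> norm (V t \<phi>) \<le> C"
    using bounded_on[OF t schwartz_radial_family[OF \<psi>]] by metis
  have "norm (V t (gauss_moment \<epsilon> \<psi> 0) - V t \<psi>) \<le> \<epsilon> * C" if e: "0 < \<epsilon>" "\<epsilon> \<le> 1" for \<epsilon>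
  proof -
    let ?g = "\<lambda>x. radial_multiplier \<epsilon> (\<lambda>k. if k = 0 then 0 else complex_of_real (1 / \<epsilon>)) x * \<psi> x"
    have g: "?g \<in> radial_family 1 {\<psi>}"
    proof (rule radial_familyI[OF e])
      fix n :: nat
      show "norm (if n = 0 then 0 else complex_of_real (1 / \<epsilon>)) \<le> 1 * (1 + real n * (1 / \<epsilon>))"
      proof (cases "n = 0")
        case False
        then have "1 * (1 / \<epsilon>) \<le> real n * (1 / \<epsilon>)" using e by (intro mult_right_mono) auto
        moreover have "norm (complex_of_real (1 / \<epsilon>)) = 1 / \<epsilon>" using e by (simp only: norm_of_real) simp
        ultimately show ?thesis using False by (simp only: if_False mult_1)
      qed simp
    qed simp
    have gs: "schwartz ?g" by (rule schwartz_bounded_imp_schwartz[OF schwartz_radial_family[OF \<psi>] g])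
    have "gauss_moment \<epsilon> \<psi> 0 = (\<lambda>x. 1 * \<psi> x + complex_of_real (- \<epsilon>) * ?g x)"
      unfolding radial_multiplier_complement[OF e(1)] using e by (auto simp: fun_eq_iff)
    then have "V t (gauss_moment \<epsilon> \<psi> 0) = V t \<psi> + complex_of_real (- \<epsilon>) * V t ?g"
      using linear[OF t \<psi> gs, of 1 "complex_of_real (- \<epsilon>)"] by simp
    then have "norm (V t (gauss_moment \<epsilon> \<psi> 0) - V t \<psi>) = \<epsilon> * norm (V t ?g)" using e by (simp add: norm_mult)
    then show ?thesis using C[OF g] e by simp
  qed
  note rate = this
  have inv: "(\<lambda>j. 1 / real (Suc j)) \<longlonglongrightarrow> 0"
    using LIMSEQ_inverse_real_of_nat by (simp add: inverse_eq_divide)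
  have "(\<lambda>j. V t (gauss_moment (1 / real (Suc j)) \<psi> 0) - V t \<psi>) \<longlonglongrightarrow> 0"
  proof (rule Lim_null_comparison)
    show "\<forall>\<^sub>F j in sequentially. norm (V t (gauss_moment (1 / real (Suc j)) \<psi> 0) - V t \<psi>) \<le> 1 / real (Suc j) * C"
      by (intro always_eventually allI rate) auto
    show "(\<lambda>j. 1 / real (Suc j) * C) \<longlonglongrightarrow> 0"
      using tendsto_mult_right[OF inv, of C] by simp
  qed
  then show ?thesis by (rule LIM_zero_cancel)
qed

end

section \<open>The Fourier transform of the fundamental solution\<close>

text \<open>Fubini's theorem between frequency and time.\<close>

lemma rl_integral_average:
  fixes H :: "real^3 \<Rightarrow> real \<Rightarrow> real" and \<phi> :: "real^3 \<Rightarrow> complex"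
  assumes \<sigma>: "\<sigma> > 0" and H: "continuous_on UNIV (\<lambda>p. H (fst p) (snd p))"
    and bd: "\<And>\<kappa> s. 0 < s \<Longrightarrow> s < t \<Longrightarrow> \<bar>H \<kappa> s\<bar> \<le> B" and \<phi>: "integrable lborel \<phi>"
  shows "(LINT \<kappa>|lborel. complex_of_real (rl_integral \<sigma> (H \<kappa>) t) * \<phi> \<kappa>) =
    rl_integral \<sigma> (\<lambda>s. LINT \<kappa>|lborel. complex_of_real (H \<kappa> s) * \<phi> \<kappa>) t"
    and "integrable lborel (\<lambda>s. rl_kernel \<sigma> t s *\<^sub>R (LINT \<kappa>|lborel. complex_of_real (H \<kappa> s) * \<phi> \<kappa>))"
    and "integrable lborel (\<lambda>\<kappa>. complex_of_real (rl_integral \<sigma> (H \<kappa>) t) * \<phi> \<kappa>)"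
proof -
  define G where "G = (\<lambda>\<kappa> s. rl_kernel \<sigma> t s *\<^sub>R (complex_of_real (H \<kappa> s) * \<phi> \<kappa>))"
  have Hm: "(\<lambda>p. H (fst p) (snd p)) \<in> borel_measurable (borel \<Otimes>\<^sub>M borel)"
    unfolding borel_prod by (rule borel_measurable_continuous_onI[OF H])
  have \<phi>m [measurable]: "\<phi> \<in> borel_measurable borel" using borel_measurable_integrable[OF \<phi>] by simp
  have I0: "integrable (lborel \<Otimes>\<^sub>M lborel) (\<lambda>(\<kappa>, s). B * (norm (\<phi> \<kappa>) * rl_kernel \<sigma> t s))"
  proof (rule lborel_pair.Fubini_integrable)
    show "(\<lambda>(\<kappa>, s). B * (norm (\<phi> \<kappa>) * rl_kernel \<sigma> t s)) \<in> borel_measurable (lborel \<Otimes>\<^sub>M lborel)" by measurable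
    show "AE \<kappa> in lborel. integrable lborel (\<lambda>s. case (\<kappa>, s) of (\<kappa>, s) \<Rightarrow> B * (norm (\<phi> \<kappa>) * rl_kernel \<sigma> t s))"
      using rl_kernel_integrable[OF \<sigma>] by simp
    have "(LINT s|lborel. norm (case (\<kappa>, s) of (\<kappa>, s) \<Rightarrow> B * (norm (\<phi> \<kappa>) * rl_kernel \<sigma> t s))) = (\<bar>B\<bar> * (LINT s|lborel. \<bar>rl_kernel \<sigma> t s\<bar>)) * norm (\<phi> \<kappa>)" for \<kappa>
      by (simp add: abs_mult mult_ac)
    then show "integrable lborel (\<lambda>\<kappa>. LINT s|lborel. norm (case (\<kappa>, s) of (\<kappa>, s) \<Rightarrow> B * (norm (\<phi> \<kappa>) * rl_kernel \<sigma> t s)))"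
      using integrable_norm[OF \<phi>] by simp
  qed
  have GI: "integrable (lborel \<Otimes>\<^sub>M lborel) (case_prod G)"
  proof (rule Bochner_Integration.integrable_bound[OF I0])
    show "case_prod G \<in> borel_measurable (lborel \<Otimes>\<^sub>M lborel)"
      unfolding G_def case_prod_beta' using Hm by measurable
    show "AE p in lborel \<Otimes>\<^sub>M lborel. norm (case p of (\<kappa>, s) \<Rightarrow> G \<kappa> s) \<le> norm (case p of (\<kappa>, s) \<Rightarrow> B * (norm (\<phi> \<kappa>) * rl_kernel \<sigma> t s))"
    proof (intro AE_I2)
      fix p :: "(real^3) \<times> real"
      obtain \<kappa> s where p: "p = (\<kappa>, s)" by (cases p)
      show "norm (case p of (\<kappa>, s) \<Rightarrow> G \<kappa> s) \<le> norm (case p of (\<kappa>, s) \<Rightarrow> B * (norm (\<phi> \<kappa>) * rl_kernel \<sigma> t s))"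
      proof (cases "0 < s \<and> s < t")
        case True
        then have "\<bar>H \<kappa> s\<bar> \<le> \<bar>B\<bar>" using bd[of s \<kappa>] by linarith
        then have "\<bar>H \<kappa> s\<bar> * (norm (\<phi> \<kappa>) * \<bar>rl_kernel \<sigma> t s\<bar>) \<le> \<bar>B\<bar> * (norm (\<phi> \<kappa>) * \<bar>rl_kernel \<sigma> t s\<bar>)"
          by (rule mult_right_mono) simp
        then show ?thesis by (simp add: p G_def norm_mult abs_mult mult_ac)
      qed (auto simp: p G_def rl_kernel_def)
    qed
  qed
  have inner2: "(LINT \<kappa>|lborel. G \<kappa> s) = rl_kernel \<sigma> t s *\<^sub>R (LINT \<kappa>|lborel. complex_of_real (H \<kappa> s) * \<phi> \<kappa>)" for s
    unfolding G_def by (rule Bochner_Integration.integral_scaleR_right)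
  show "integrable lborel (\<lambda>s. rl_kernel \<sigma> t s *\<^sub>R (LINT \<kappa>|lborel. complex_of_real (H \<kappa> s) * \<phi> \<kappa>))"
    using lborel_pair.integrable_snd[OF GI] unfolding inner2 .
  have inner1: "(LINT s|lborel. G \<kappa> s) = complex_of_real (rl_integral \<sigma> (H \<kappa>) t) * \<phi> \<kappa>" for \<kappa>
  proof -
    have "(LINT s|lborel. G \<kappa> s) = (LINT s|lborel. complex_of_real (rl_kernel \<sigma> t s * H \<kappa> s) * \<phi> \<kappa>)"
      by (simp add: G_def scaleR_conv_of_real mult_ac)
    also have "\<dots> = (LINT s|lborel. complex_of_real (rl_kernel \<sigma> t s * H \<kappa> s)) * \<phi> \<kappa>"
      by (rule Bochner_Integration.integral_mult_left_zero)
    also have "(LINT s|lborel. complex_of_real (rl_kernel \<sigma> t s * H \<kappa> s)) = complex_of_real (LINT s|lborel. rl_kernel \<sigma> t s * H \<kappa> s)"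
      by (rule integral_complex_of_real)
    finally show ?thesis using \<sigma> by (simp add: rl_integral_def)
  qed
  show "integrable lborel (\<lambda>\<kappa>. complex_of_real (rl_integral \<sigma> (H \<kappa>) t) * \<phi> \<kappa>)"
    using lborel_pair.integrable_fst[OF GI] unfolding inner1 .
  have "(LINT s|lborel. (LINT \<kappa>|lborel. G \<kappa> s)) = (LINT \<kappa>|lborel. (LINT s|lborel. G \<kappa> s))"
    by (rule lborel_pair.Fubini_integral[OF GI])
  then show "(LINT \<kappa>|lborel. complex_of_real (rl_integral \<sigma> (H \<kappa>) t) * \<phi> \<kappa>) =
    rl_integral \<sigma> (\<lambda>s. LINT \<kappa>|lborel. complex_of_real (H \<kappa> s) * \<phi> \<kappa>) t"
    unfolding inner1 inner2 using \<sigma> by (simp add: rl_integral_def)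
qed

locale fundamental =
  fixes \<alpha> \<beta> c D :: real and Q :: "real \<Rightarrow> distr"
  assumes \<alpha>: "0 < \<alpha>" "\<alpha> \<le> 1" and \<gamma>: "1 < \<alpha> + \<beta>" "\<alpha> + \<beta> \<le> 2" and c: "c > 0" and D: "D > 0"
    and Q: "fundamental_solution \<alpha> \<beta> c D Q"
begin

lemma \<beta>: "\<beta> > 0" using \<alpha> \<gamma> by simp

sublocale volterra_series \<beta> "\<alpha> + \<beta>" "c\<^sup>2 / D"
  by standard (use \<beta> \<gamma> D in auto)

text \<open>The candidate for the transform of \<open>Q t\<close>.\<close>

definition h :: "real^3 \<Rightarrow> real \<Rightarrow> real" where
  "h \<kappa> t = relaxation (c\<^sup>2 * (norm \<kappa>)\<^sup>2) t"

definition V :: "real \<Rightarrow> distr" where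
  "V t = distr_fourier (Q t)"

lemma V_eq: "V t \<phi> = Q t (fourier \<phi>)"
  by (simp add: V_def distr_fourier_def)

lemma continuous_on_h:
  fixes f :: "'b::topological_space \<Rightarrow> real^3"
  assumes "continuous_on S f" "continuous_on S g"
  shows "continuous_on S (\<lambda>p. h (f p) (g p))"
  unfolding h_def by (intro continuous_on_relaxation continuous_intros assms)

lemma h_bounded: "t \<ge> 0 \<Longrightarrow> \<bar>h \<kappa> t\<bar> \<le> 1"
  unfolding h_def by (rule relaxation_bounded[OF \<alpha> refl \<gamma>]) auto

lemma h_0: "h \<kappa> 0 = 1"
  by (simp add: h_def relaxation_0)

lemma tempered_family_V: "tempered_family V {0..}"
proof
  fix t :: real assume t: "t \<in> {0..}"
  then have temp: "tempered_distribution (Q t)" using Q by (simp add: fundamental_solution_def)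
  show "V t (\<lambda>x. a * \<phi> x + b * \<psi> x) = a * V t \<phi> + b * V t \<psi>" if "schwartz \<phi>" "schwartz \<psi>" for \<phi> \<psi> a b
  proof -
    have "fourier (\<lambda>x. a * \<phi> x + b * \<psi> x) = (\<lambda>x. a * fourier \<phi> x + b * fourier \<psi> x)"
      by (rule ext, subst fourier_add) (auto simp: fourier_scale intro!: schwartz_integrable schwartz_scale that)
    then show ?thesis
      unfolding V_eq using temp schwartz_fourier[OF that(1)] schwartz_fourier[OF that(2)]
      unfolding tempered_distribution_def by simp
  qed
  show "\<exists>C. \<forall>\<phi>\<in>S. norm (V t \<phi>) \<le> C" if "schwartz_bounded S" for S
    using tempered_distribution_bounded[OF temp schwartz_bounded_fourier[OF that]] by (simp add: V_eq)
qed

lemma continuous_on_pairing: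
  assumes "schwartz \<phi>" shows "continuous_on {0..} (\<lambda>t. Q t \<phi>)"
proof (rule continuous_on_eq_continuous_within[THEN iffD2], rule ballI)
  fix x :: real assume x: "x \<in> {0..}"
  have d0: "((\<lambda>t. Q t \<phi>) has_vector_derivative 0) (at 0 within {0..})"
    and d: "caputo_differentiable \<alpha> (\<lambda>t. Q t \<phi>)"
    using Q assms unfolding fundamental_solution_def by blast+
  show "continuous (at x within {0..}) (\<lambda>t. Q t \<phi>)"
  proof (cases "x = 0")
    case True
    then show ?thesis using has_vector_derivative_continuous[OF d0] by simp
  next
    case False
    have "0 < nat \<lceil>\<alpha>\<rceil>" using \<alpha> by simp
    then have "time_deriv 0 (\<lambda>t. Q t \<phi>) differentiable (at x)"
      using d False x unfolding caputo_differentiable_def by auto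
    then have "(\<lambda>t. Q t \<phi>) differentiable (at x)" by (simp add: time_deriv_simps)
    then show ?thesis using differentiable_imp_continuous_within continuous_at_imp_continuous_at_within by blast
  qed
qed

lemma continuous_on_V:
  assumes "schwartz \<phi>" "S \<subseteq> {0..}"
  shows "continuous_on S (\<lambda>t. V t \<phi>)"
  unfolding V_eq by (rule continuous_on_subset[OF continuous_on_pairing[OF schwartz_fourier[OF assms(1)]] assms(2)])

lemma V_0: "schwartz \<phi> \<Longrightarrow> V 0 \<phi> = (LINT \<kappa>|lborel. \<phi> \<kappa>)"
  using Q schwartz_fourier[of \<phi>] unfolding fundamental_solution_def V_eq dirac_def fourier_at_0[symmetric] by blast

lemma V_kernel_integrable:
  assumes "schwartz \<phi>" "\<sigma> > 0" "t \<ge> 0"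
  shows "integrable lborel (\<lambda>s. rl_kernel \<sigma> t s *\<^sub>R V s \<phi>)"
proof -
  have co: "continuous_on {0..t} (\<lambda>s. V s \<phi>)" by (rule continuous_on_V[OF assms(1)]) auto
  have "bounded ((\<lambda>s. V s \<phi>) ` {0..t})" by (intro compact_imp_bounded compact_continuous_image co) auto
  then obtain B where "\<And>s. s \<in> {0..t} \<Longrightarrow> norm (V s \<phi>) \<le> B" unfolding bounded_iff by (metis imageI)
  moreover have "set_borel_measurable borel {0<..<t} (\<lambda>s. V s \<phi>)"
    unfolding set_borel_measurable_def by (intro borel_measurable_continuous_on_indicator continuous_on_V[OF assms(1)]) auto
  ultimately show ?thesis by (intro rl_kernel_scaleR_integrable[OF assms(2), where B = B]) auto
qed

text \<open>The Volterra equation for pairings. Transforming the Laplacian raises the power of \<open>\<parallel>\<kappa>\<parallel>\<^sup>2\<close> in the test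
  function, so the equation is not closed but part of a hierarchy.\<close>

lemma V_equation:
  assumes \<phi>: "schwartz \<phi>" and t: "t \<ge> 0"
  shows "(V t \<phi> - V 0 \<phi>) + (c\<^sup>2 / D) *\<^sub>R rl_integral \<beta> (\<lambda>s. V s \<phi> - V 0 \<phi>) t =
    - (c\<^sup>2 *\<^sub>R rl_integral (\<alpha> + \<beta>) (\<lambda>s. V s (\<lambda>\<kappa>. complex_of_real ((norm \<kappa>)\<^sup>2) * \<phi> \<kappa>)) t)"
proof -
  let ?\<psi> = "\<lambda>\<kappa>. complex_of_real ((norm \<kappa>)\<^sup>2) * \<phi> \<kappa>"
  let ?g = "\<lambda>t. distr_laplacian (Q t) (fourier \<phi>)"
  have \<psi>: "schwartz ?\<psi>" by (rule schwartz_norm_squared[OF \<phi>])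
  have F: "schwartz (fourier \<phi>)" by (rule schwartz_fourier[OF \<phi>])
  have g: "?g s = - V s ?\<psi>" if "s \<ge> 0" for s
  proof -
    have "?g s = V s (\<lambda>\<kappa>. (- 1) * ?\<psi> \<kappa>)" by (simp add: distr_laplacian_def laplacian_fourier[OF \<phi>] V_eq)
    also have "\<dots> = (- 1) * V s ?\<psi>" using tempered_family.scale[OF tempered_family_V _ \<psi>, of s "- 1"] that by simp
    finally show ?thesis by simp
  qed
  have cg: "continuous_on {0..} ?g"
    unfolding distr_laplacian_def by (rule continuous_on_pairing[OF schwartz_laplacian[OF F]])
  have "(1 / c\<^sup>2) *\<^sub>R (V t \<phi> - V 0 \<phi>) + (1 / D) *\<^sub>R rl_integral \<beta> (\<lambda>s. V s \<phi> - V 0 \<phi>) t = rl_integral (\<alpha> + \<beta>) ?g t"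
    unfolding V_eq
  proof (rule caputo_equation_integrated[OF \<alpha> \<gamma> _ _ _ _ cg _ t])
    show "1 / c\<^sup>2 > 0" using c by simp
  qed (use Q F in \<open>auto simp: fundamental_solution_def\<close>)
  also have "rl_integral (\<alpha> + \<beta>) ?g t = rl_integral (\<alpha> + \<beta>) (\<lambda>s. - V s ?\<psi>) t"
    by (rule rl_integral_cong) (use g \<gamma> in auto)
  also have "\<dots> = - rl_integral (\<alpha> + \<beta>) (\<lambda>s. V s ?\<psi>) t"
    using \<gamma> by (simp add: rl_integral_def)
  finally have "c\<^sup>2 *\<^sub>R ((1 / c\<^sup>2) *\<^sub>R (V t \<phi> - V 0 \<phi>) + (1 / D) *\<^sub>R rl_integral \<beta> (\<lambda>s. V s \<phi> - V 0 \<phi>) t) = c\<^sup>2 *\<^sub>R (- rl_integral (\<alpha> + \<beta>) (\<lambda>s. V s ?\<psi>) t)"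
    by simp
  then show ?thesis using c unfolding scaleR_add_right scaleR_scaleR by simp
qed

text \<open>The pairing that \<open>V t \<phi>\<close> is claimed to equal.\<close>

definition Y :: "(real^3 \<Rightarrow> complex) \<Rightarrow> real \<Rightarrow> complex" where
  "Y \<phi> t = (LINT \<kappa>|lborel. complex_of_real (h \<kappa> t) * \<phi> \<kappa>)"

lemma h_integrable:
  assumes "integrable lborel \<phi>" "t \<ge> 0"
  shows "integrable lborel (\<lambda>\<kappa>. complex_of_real (h \<kappa> t) * \<phi> \<kappa>)"
proof (rule Bochner_Integration.integrable_bound[OF assms(1)])
  have "continuous_on UNIV (\<lambda>\<kappa>. complex_of_real (h \<kappa> t))" by (intro continuous_intros continuous_on_h)
  then have [measurable]: "(\<lambda>\<kappa>. complex_of_real (h \<kappa> t)) \<in> borel_measurable borel" by (rule borel_measurable_continuous_onI)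
  have [measurable]: "\<phi> \<in> borel_measurable borel" using borel_measurable_integrable[OF assms(1)] by simp
  show "(\<lambda>\<kappa>. complex_of_real (h \<kappa> t) * \<phi> \<kappa>) \<in> borel_measurable lborel" by measurable
  show "AE \<kappa> in lborel. norm (complex_of_real (h \<kappa> t) * \<phi> \<kappa>) \<le> norm (\<phi> \<kappa>)"
    using h_bounded[OF assms(2)] by (intro AE_I2) (simp add: norm_mult mult_left_le_one_le)
qed

lemma norm_Y_le:
  assumes "integrable lborel \<phi>" "t \<ge> 0"
  shows "norm (Y \<phi> t) \<le> (LINT \<kappa>|lborel. norm (\<phi> \<kappa>))"
proof -
  have "norm (Y \<phi> t) \<le> (LINT \<kappa>|lborel. norm (complex_of_real (h \<kappa> t) * \<phi> \<kappa>))"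
    unfolding Y_def by (rule integral_norm_bound)
  also have "\<dots> \<le> (LINT \<kappa>|lborel. norm (\<phi> \<kappa>))"
    using h_bounded[OF assms(2)]
    by (intro integral_mono integrable_norm h_integrable assms) (simp add: norm_mult mult_left_le_one_le)
  finally show ?thesis .
qed

text \<open>The candidate satisfies the same hierarchy: average the scalar equation over \<open>\<kappa>\<close>.\<close>

lemma Y_equation:
  assumes \<phi>: "schwartz \<phi>" and t: "t \<ge> 0"
  shows "(Y \<phi> t - Y \<phi> 0) + (c\<^sup>2 / D) *\<^sub>R rl_integral \<beta> (\<lambda>s. Y \<phi> s - Y \<phi> 0) t =
    - (c\<^sup>2 *\<^sub>R rl_integral (\<alpha> + \<beta>) (Y (\<lambda>\<kappa>. complex_of_real ((norm \<kappa>)\<^sup>2) * \<phi> \<kappa>)) t)"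
    and "integrable lborel (\<lambda>s. rl_kernel \<beta> t s *\<^sub>R (Y \<phi> s - Y \<phi> 0))"
    and "integrable lborel (\<lambda>s. rl_kernel (\<alpha> + \<beta>) t s *\<^sub>R Y (\<lambda>\<kappa>. complex_of_real ((norm \<kappa>)\<^sup>2) * \<phi> \<kappa>) s)"
proof -
  let ?\<psi> = "\<lambda>\<kappa>. complex_of_real ((norm \<kappa>)\<^sup>2) * \<phi> \<kappa>"
  have \<phi>i: "integrable lborel \<phi>" by (rule schwartz_integrable[OF \<phi>])
  have \<psi>i: "integrable lborel ?\<psi>" by (rule schwartz_integrable[OF schwartz_norm_squared[OF \<phi>]])
  have \<gamma>0: "\<alpha> + \<beta> > 0" using \<gamma> by simp
  have Yd: "Y \<phi> s - Y \<phi> 0 = (LINT \<kappa>|lborel. complex_of_real (h \<kappa> s - 1) * \<phi> \<kappa>)" if "s \<ge> 0" for s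
    unfolding Y_def h_0 using h_integrable[OF \<phi>i that] \<phi>i
    by (subst Bochner_Integration.integral_diff[symmetric]) (auto simp: algebra_simps)
  have c1: "continuous_on UNIV (\<lambda>p. h (fst p) (snd p) - 1)" by (intro continuous_intros continuous_on_h)
  have c2: "continuous_on UNIV (\<lambda>p. h (fst p) (snd p))" by (intro continuous_intros continuous_on_h)
  have b1: "\<bar>h \<kappa> s - 1\<bar> \<le> 2" if "0 < s" "s < t" for \<kappa> s using h_bounded[of s \<kappa>] that by linarith
  have b2: "\<bar>h \<kappa> s\<bar> \<le> 1" if "0 < s" "s < t" for \<kappa> s using h_bounded[of s \<kappa>] that by linarith
  note A1 = rl_integral_average[where H = "\<lambda>\<kappa> s. h \<kappa> s - 1", OF \<beta> c1 b1 \<phi>i]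
  note A2 = rl_integral_average[where H = h, OF \<gamma>0 c2 b2 \<psi>i]
  show "integrable lborel (\<lambda>s. rl_kernel (\<alpha> + \<beta>) t s *\<^sub>R Y ?\<psi> s)" using A2(2) by (simp add: Y_def)
  show "integrable lborel (\<lambda>s. rl_kernel \<beta> t s *\<^sub>R (Y \<phi> s - Y \<phi> 0))"
    by (rule Bochner_Integration.integrable_cong[OF refl, THEN iffD1, OF _ A1(2)]) (auto simp: rl_kernel_def Yd)
  have R1: "rl_integral \<beta> (\<lambda>s. Y \<phi> s - Y \<phi> 0) t = (LINT \<kappa>|lborel. complex_of_real (rl_integral \<beta> (\<lambda>s. h \<kappa> s - 1) t) * \<phi> \<kappa>)"
    by (rule trans[OF rl_integral_cong A1(1)[symmetric]]) (use \<beta> Yd in auto)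
  have R2: "rl_integral (\<alpha> + \<beta>) (Y ?\<psi>) t = (LINT \<kappa>|lborel. complex_of_real (rl_integral (\<alpha> + \<beta>) (h \<kappa>) t) * ?\<psi> \<kappa>)"
    unfolding Y_def[abs_def] by (rule A2(1)[symmetric])
  have E: "complex_of_real (c\<^sup>2 / D) * (complex_of_real (rl_integral \<beta> (\<lambda>s. h \<kappa> s - 1) t) * \<phi> \<kappa>) =
      - (complex_of_real (c\<^sup>2) * (complex_of_real (rl_integral (\<alpha> + \<beta>) (h \<kappa>) t) * ?\<psi> \<kappa>)) - complex_of_real (h \<kappa> t - 1) * \<phi> \<kappa>" for \<kappa>
  proof -
    have "(c\<^sup>2 / D) * rl_integral \<beta> (\<lambda>s. h \<kappa> s - 1) t = - (c\<^sup>2 * (norm \<kappa>)\<^sup>2) * rl_integral (\<alpha> + \<beta>) (h \<kappa>) t - (h \<kappa> t - 1)"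
      using relaxation_equation[OF t, of "c\<^sup>2 * (norm \<kappa>)\<^sup>2"] by (simp add: h_def[abs_def])
    then have "complex_of_real ((c\<^sup>2 / D) * rl_integral \<beta> (\<lambda>s. h \<kappa> s - 1) t) * \<phi> \<kappa> = complex_of_real (- (c\<^sup>2 * (norm \<kappa>)\<^sup>2) * rl_integral (\<alpha> + \<beta>) (h \<kappa>) t - (h \<kappa> t - 1)) * \<phi> \<kappa>"
      by (simp only:)
    then show ?thesis by (simp add: algebra_simps)
  qed
  have i2: "integrable lborel (\<lambda>\<kappa>. complex_of_real (rl_integral (\<alpha> + \<beta>) (h \<kappa>) t) * ?\<psi> \<kappa>)"
    using A2(3) by simp
  have i1: "integrable lborel (\<lambda>\<kappa>. complex_of_real (h \<kappa> t - 1) * \<phi> \<kappa>)"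
    using Bochner_Integration.integrable_diff[OF h_integrable[OF \<phi>i t] \<phi>i] by (simp add: algebra_simps)
  have "(c\<^sup>2 / D) *\<^sub>R rl_integral \<beta> (\<lambda>s. Y \<phi> s - Y \<phi> 0) t = (LINT \<kappa>|lborel. complex_of_real (c\<^sup>2 / D) * (complex_of_real (rl_integral \<beta> (\<lambda>s. h \<kappa> s - 1) t) * \<phi> \<kappa>))"
    unfolding R1 scaleR_conv_of_real by (rule Bochner_Integration.integral_mult_right_zero[symmetric])
  also have "\<dots> = - (complex_of_real (c\<^sup>2) * rl_integral (\<alpha> + \<beta>) (Y ?\<psi>) t) - (Y \<phi> t - Y \<phi> 0)"
    unfolding E R2 Yd[OF t] using i1 i2
    by (subst Bochner_Integration.integral_diff) (auto intro!: integrable_mult_right simp del: of_real_power)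
  finally show "(Y \<phi> t - Y \<phi> 0) + (c\<^sup>2 / D) *\<^sub>R rl_integral \<beta> (\<lambda>s. Y \<phi> s - Y \<phi> 0) t = - (c\<^sup>2 *\<^sub>R rl_integral (\<alpha> + \<beta>) (Y ?\<psi>) t)"
    by (simp add: scaleR_conv_of_real)
qed

lemma Y_0: "Y \<phi> 0 = (LINT \<kappa>|lborel. \<phi> \<kappa>)"
  by (simp add: Y_def h_0)

text \<open>The differences of the two pairings on damped moments start from \<open>0\<close>, satisfy the homogeneous
  hierarchy and obey the moment bound, hence vanish.\<close>

lemma V_gauss_moment:
  assumes \<psi>: "schwartz \<psi>" and e: "0 < \<epsilon>" "\<epsilon> \<le> 1" and T: "T \<ge> 0"
  shows "V T (gauss_moment \<epsilon> \<psi> 0) = Y (gauss_moment \<epsilon> \<psi> 0) T"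
proof -
  let ?g = "gauss_moment \<epsilon> \<psi>"
  have gs: "schwartz (?g n)" for n by (rule schwartz_gauss_moment[OF \<psi> e])
  have gSuc: "(\<lambda>\<kappa>. complex_of_real ((norm \<kappa>)\<^sup>2) * ?g n \<kappa>) = ?g (Suc n)" for n
    by (rule ext) (rule gauss_moment_Suc)
  define w where "w = (\<lambda>n t. V t (?g n) - Y (?g n) t)"
  interpret tempered_family V "{0..T}"
    using tempered_family_V unfolding tempered_family_def by auto
  have ptw: "bounded ((\<lambda>t. V t \<phi>) ` {0..T})" if "schwartz \<phi>" for \<phi>
    by (intro compact_imp_bounded compact_continuous_image continuous_on_V that) auto
  obtain C where C: "C \<ge> 0" "\<And>t n. t \<in> {0..T} \<Longrightarrow> norm (V t (?g n)) \<le> C * fact n * (1 / \<epsilon>) ^ n"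
    by (rule gauss_moment_bound[OF ptw \<psi> e]) (assumption, rule that)
  define N where "N = (LINT \<kappa>|lborel. norm (\<psi> \<kappa>))"
  have N: "N \<ge> 0" unfolding N_def by simp
  have "w 0 T = 0"
  proof (rule rl_hierarchy_zero[where A = "c\<^sup>2 / D" and C = "c\<^sup>2" and K = "1 / \<epsilon>" and M = "C + N" and w = w])
    show "0 < \<beta>" by (rule \<beta>)
    show "1 < \<alpha> + \<beta>" by (rule \<gamma>)
    show "0 \<le> c\<^sup>2 / D" "0 \<le> c\<^sup>2" "0 \<le> 1 / \<epsilon>" "0 \<le> C + N" using D e C N by auto
    show "0 \<le> T" "T \<le> T" using T by auto
    fix n t assume t: "0 \<le> t" "t \<le> T"
    have V0: "V 0 (?g n) = Y (?g n) 0" by (simp add: V_0[OF gs] Y_0)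
    have iV: "integrable lborel (\<lambda>s. rl_kernel \<beta> t s *\<^sub>R (V s (?g n) - V 0 (?g n)))"
      unfolding scaleR_diff_right using V_kernel_integrable[OF gs \<beta> t(1)] rl_kernel_integrable[OF \<beta>]
      by (intro Bochner_Integration.integrable_diff integrable_scaleR_left) auto
    have \<gamma>0: "\<alpha> + \<beta> > 0" using \<gamma> by simp
    note YE = Y_equation[OF gs[of n] t(1), unfolded gSuc] and VE = V_equation[OF gs[of n] t(1), unfolded gSuc]
    have r\<beta>: "rl_integral \<beta> (w n) t = rl_integral \<beta> (\<lambda>s. V s (?g n) - V 0 (?g n)) t - rl_integral \<beta> (\<lambda>s. Y (?g n) s - Y (?g n) 0) t"
    proof -
      have "rl_integral \<beta> (w n) t = (LINT s|lborel. rl_kernel \<beta> t s *\<^sub>R (V s (?g n) - V 0 (?g n)) - rl_kernel \<beta> t s *\<^sub>R (Y (?g n) s - Y (?g n) 0))"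
        using \<beta> V0 by (simp add: rl_integral_def w_def algebra_simps)
      also have "\<dots> = (LINT s|lborel. rl_kernel \<beta> t s *\<^sub>R (V s (?g n) - V 0 (?g n))) - (LINT s|lborel. rl_kernel \<beta> t s *\<^sub>R (Y (?g n) s - Y (?g n) 0))"
        by (rule Bochner_Integration.integral_diff[OF iV YE(2)])
      finally show ?thesis using \<beta> by (simp add: rl_integral_def)
    qed
    have r\<gamma>: "rl_integral (\<alpha> + \<beta>) (w (Suc n)) t = rl_integral (\<alpha> + \<beta>) (\<lambda>s. V s (?g (Suc n))) t - rl_integral (\<alpha> + \<beta>) (Y (?g (Suc n))) t"
    proof -
      have "rl_integral (\<alpha> + \<beta>) (w (Suc n)) t = (LINT s|lborel. rl_kernel (\<alpha> + \<beta>) t s *\<^sub>R V s (?g (Suc n)) - rl_kernel (\<alpha> + \<beta>) t s *\<^sub>R Y (?g (Suc n)) s)"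
        using \<gamma>0 by (simp add: rl_integral_def w_def scaleR_diff_right)
      also have "\<dots> = (LINT s|lborel. rl_kernel (\<alpha> + \<beta>) t s *\<^sub>R V s (?g (Suc n))) - (LINT s|lborel. rl_kernel (\<alpha> + \<beta>) t s *\<^sub>R Y (?g (Suc n)) s)"
        by (rule Bochner_Integration.integral_diff[OF V_kernel_integrable[OF gs \<gamma>0 t(1)] YE(3)])
      finally show ?thesis using \<gamma>0 by (simp add: rl_integral_def)
    qed
    have alg: "p + a = - b \<Longrightarrow> q + a' = - b' \<Longrightarrow> v = p - q \<Longrightarrow> v = - (a - a') - (b - b')" for p q a a' b b' v :: complex
      by algebra
    have "w n t = (V t (?g n) - V 0 (?g n)) - (Y (?g n) t - Y (?g n) 0)" by (simp add: w_def V0)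
    then show "w n t = - ((c\<^sup>2 / D) *\<^sub>R rl_integral \<beta> (w n) t) - c\<^sup>2 *\<^sub>R rl_integral (\<alpha> + \<beta>) (w (Suc n)) t"
      unfolding r\<beta> r\<gamma> scaleR_diff_right[of "c\<^sup>2 / D"] scaleR_diff_right[of "c\<^sup>2"] by (rule alg[OF VE YE(1)])
    show "norm (w n t) \<le> (C + N) * fact n * (1 / \<epsilon>) ^ n"
    proof -
      have gi: "integrable lborel (?g n)" by (rule schwartz_integrable[OF gs])
      have "norm (Y (?g n) t) \<le> (LINT \<kappa>|lborel. norm (?g n \<kappa>))" by (rule norm_Y_le[OF gi t(1)])
      also have "\<dots> \<le> (LINT \<kappa>|lborel. fact n * (1 / \<epsilon>) ^ n * norm (\<psi> \<kappa>))"
        by (intro integral_mono integrable_norm gi integrable_mult_right schwartz_integrable \<psi> norm_gauss_moment_le e)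
      also have "\<dots> = N * fact n * (1 / \<epsilon>) ^ n" by (simp add: N_def)
      finally have "norm (Y (?g n) t) \<le> N * fact n * (1 / \<epsilon>) ^ n" .
      moreover have "norm (V t (?g n)) \<le> C * fact n * (1 / \<epsilon>) ^ n" using C(2) t by simp
      moreover have "norm (w n t) \<le> norm (V t (?g n)) + norm (Y (?g n) t)" unfolding w_def by (rule norm_triangle_ineq4)
      ultimately show ?thesis by (simp add: distrib_right)
    qed
  qed
  then show ?thesis by (simp add: w_def)
qed

text \<open>Remove the damping: the left sides converge by boundedness on bounded sets, the right sides by dominated
  convergence, thanks to \<open>\<bar>h\<bar> \<le> 1\<close>.\<close>

lemma V_eq_integral:
  assumes \<psi>: "schwartz \<psi>" and t: "t \<ge> 0"
  shows "V t \<psi> = Y \<psi> t"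
proof -
  interpret tempered_family V "{0..}" by (rule tempered_family_V)
  have "(\<lambda>j. V t (gauss_moment (1 / real (Suc j)) \<psi> 0)) \<longlonglongrightarrow> V t \<psi>"
    by (rule gauss_moment_tendsto) (use t \<psi> in auto)
  moreover have "V t (gauss_moment (1 / real (Suc j)) \<psi> 0) = Y (gauss_moment (1 / real (Suc j)) \<psi> 0) t" for j
    by (rule V_gauss_moment[OF \<psi> _ _ t]) auto
  ultimately have "(\<lambda>j. Y (gauss_moment (1 / real (Suc j)) \<psi> 0) t) \<longlonglongrightarrow> V t \<psi>" by simp
  moreover have "(\<lambda>j. Y (gauss_moment (1 / real (Suc j)) \<psi> 0) t) \<longlonglongrightarrow> Y \<psi> t"
    unfolding Y_def
  proof (rule integral_dominated_convergence[where w = "\<lambda>\<kappa>. norm (\<psi> \<kappa>)"])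
    show "integrable lborel (\<lambda>\<kappa>. norm (\<psi> \<kappa>))" by (intro integrable_norm schwartz_integrable \<psi>)
    show "(\<lambda>\<kappa>. complex_of_real (h \<kappa> t) * \<psi> \<kappa>) \<in> borel_measurable lborel"
      by (rule borel_measurable_integrable[OF h_integrable[OF schwartz_integrable[OF \<psi>] t]])
    show "(\<lambda>\<kappa>. complex_of_real (h \<kappa> t) * gauss_moment (1 / real (Suc j)) \<psi> 0 \<kappa>) \<in> borel_measurable lborel" for j
      by (rule borel_measurable_integrable[OF h_integrable[OF schwartz_integrable[OF schwartz_gauss_moment[OF \<psi>]] t]]) auto
    show "AE \<kappa> in lborel. (\<lambda>j. complex_of_real (h \<kappa> t) * gauss_moment (1 / real (Suc j)) \<psi> 0 \<kappa>) \<longlonglongrightarrow> complex_of_real (h \<kappa> t) * \<psi> \<kappa>"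
    proof (intro AE_I2 tendsto_mult tendsto_const)
      fix \<kappa>
      have "(\<lambda>j. 1 / real (Suc j)) \<longlonglongrightarrow> 0" using LIMSEQ_inverse_real_of_nat by (simp add: inverse_eq_divide)
      then have "(\<lambda>j. complex_of_real ((norm \<kappa>)\<^sup>2 ^ 0 * exp (- (1 / real (Suc j) * (norm \<kappa>)\<^sup>2))) * \<psi> \<kappa>) \<longlonglongrightarrow> complex_of_real ((norm \<kappa>)\<^sup>2 ^ 0 * exp (- (0 * (norm \<kappa>)\<^sup>2))) * \<psi> \<kappa>"
        by (intro tendsto_intros)
      then show "(\<lambda>j. gauss_moment (1 / real (Suc j)) \<psi> 0 \<kappa>) \<longlonglongrightarrow> \<psi> \<kappa>" by (simp add: gauss_moment_def)
    qed
    show "AE \<kappa> in lborel. norm (complex_of_real (h \<kappa> t) * gauss_moment (1 / real (Suc j)) \<psi> 0 \<kappa>) \<le> norm (\<psi> \<kappa>)" for j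
    proof (intro AE_I2)
      fix \<kappa>
      have "norm (gauss_moment (1 / real (Suc j)) \<psi> 0 \<kappa>) \<le> fact 0 * (1 / (1 / real (Suc j))) ^ 0 * norm (\<psi> \<kappa>)"
        by (rule norm_gauss_moment_le) simp
      then have "\<bar>h \<kappa> t\<bar> * norm (gauss_moment (1 / real (Suc j)) \<psi> 0 \<kappa>) \<le> 1 * norm (\<psi> \<kappa>)"
        using h_bounded[OF t, of \<kappa>] by (intro mult_mono) auto
      then show "norm (complex_of_real (h \<kappa> t) * gauss_moment (1 / real (Suc j)) \<psi> 0 \<kappa>) \<le> norm (\<psi> \<kappa>)"
        by (simp add: norm_mult)
    qed
  qed
  ultimately show ?thesis by (rule LIMSEQ_unique)
qed

lemma h_is_density:
  assumes "t \<ge> 0"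
  shows "is_continuous_density (distr_fourier (Q t)) (\<lambda>\<kappa>. complex_of_real (h \<kappa> t))"
  unfolding is_continuous_density_def
proof (intro conjI allI impI)
  show "continuous_on UNIV (\<lambda>\<kappa>. complex_of_real (h \<kappa> t))" by (intro continuous_intros continuous_on_h)
  fix \<psi> assume "schwartz \<psi>"
  then show "integrable lborel (\<lambda>\<kappa>. complex_of_real (h \<kappa> t) * \<psi> \<kappa>)"
    by (intro h_integrable schwartz_integrable assms)
  show "distr_fourier (Q t) \<psi> = (LINT \<kappa>|lborel. complex_of_real (h \<kappa> t) * \<psi> \<kappa>)"
    using V_eq_integral[OF \<open>schwartz \<psi>\<close> assms] by (simp add: V_def Y_def)
qed

end

lemma continuous_density_unique:
  assumes "is_continuous_density T H" "is_continuous_density T H'"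
  shows "H' = H"
proof
  fix x
  have "H' x - H x = 0"
  proof (rule continuous_eq_0_if_orthogonal_to_gaussians[of "\<lambda>x. H' x - H x"])
    show "continuous_on UNIV (\<lambda>x. H' x - H x)"
      using assms by (intro continuous_intros) (auto simp: is_continuous_density_def)
    fix \<psi> assume \<psi>: "schwartz \<psi>"
    have i: "integrable lborel (\<lambda>x. H x * \<psi> x)" "integrable lborel (\<lambda>x. H' x * \<psi> x)"
      and e: "T \<psi> = (LINT x|lborel. H x * \<psi> x)" "T \<psi> = (LINT x|lborel. H' x * \<psi> x)"
      using assms \<psi> by (auto simp: is_continuous_density_def)
    show "integrable lborel (\<lambda>x. (H' x - H x) * \<psi> x)" unfolding left_diff_distrib by (intro Bochner_Integration.integrable_diff i)
    show "(LINT x|lborel. (H' x - H x) * \<psi> x) = 0"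
      unfolding left_diff_distrib using e by (simp add: Bochner_Integration.integral_diff[OF i(2,1)])
  qed
  then show "H' x = H x" by simp
qed

theorem theorem1:
  fixes \<alpha> \<beta> c D :: real and Q :: "real \<Rightarrow> distr"
  assumes "0 < \<alpha>" "\<alpha> \<le> 1" "1 < \<alpha> + \<beta>" "\<alpha> + \<beta> \<le> 2" "c > 0" "D > 0"
    and "fundamental_solution \<alpha> \<beta> c D Q"
  shows "\<forall>t\<ge>0. \<exists>H. is_continuous_density (distr_fourier (Q t)) H \<and>
           (\<forall>H'. is_continuous_density (distr_fourier (Q t)) H' \<longrightarrow> H' = H) \<and>
           (\<forall>\<kappa> :: real^3.
              (\<lambda>n. complex_of_real (- ((norm \<kappa>)\<^sup>2 * c\<^sup>2 * t powr (\<alpha> + \<beta>))) ^ (n + 1) *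
                   prabhakar (of_real \<beta>) (of_real ((\<alpha> + \<beta>) * (real n + 1) + 1)) (real n + 1)
                     (of_real (- (c\<^sup>2 / D) * t powr \<beta>)))
                sums (H \<kappa> - 1) \<and>
              summable (\<lambda>m. \<Sum>n. real (m choose n) * (- (c\<^sup>2 / D) * t powr \<beta>) ^ m *
                   ((norm \<kappa>)\<^sup>2 * D * t powr \<alpha>) ^ n
                   / Gamma (\<beta> * real m + \<alpha> * real n + \<alpha> + \<beta> + 1)) \<and>
              H \<kappa> = complex_of_real (1 - (norm \<kappa>)\<^sup>2 * c\<^sup>2 * t powr (\<alpha> + \<beta>) *
                (\<Sum>m. \<Sum>n. real (m choose n) * (- (c\<^sup>2 / D) * t powr \<beta>) ^ m *
                   ((norm \<kappa>)\<^sup>2 * D * t powr \<alpha>) ^ n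
                   / Gamma (\<beta> * real m + \<alpha> * real n + \<alpha> + \<beta> + 1))))"
proof (intro allI impI, goal_cases)
  case (1 t)
  note t = \<open>0 \<le> t\<close>
  interpret fundamental \<alpha> \<beta> c D Q by standard (use assms in auto)
  let ?H = "\<lambda>\<kappa>. complex_of_real (h \<kappa> t)"
  show ?case
  proof (rule exI[of _ ?H], intro conjI allI impI)
    show dens: "is_continuous_density (distr_fourier (Q t)) ?H" by (rule h_is_density[OF t])
    show "H' = ?H" if "is_continuous_density (distr_fourier (Q t)) H'" for H'
      by (rule continuous_density_unique[OF dens that])
    fix \<kappa> :: "real^3"
    have z: "(norm \<kappa>)\<^sup>2 * c\<^sup>2 * t powr (\<alpha> + \<beta>) = (c\<^sup>2 * (norm \<kappa>)\<^sup>2) * t powr (\<alpha> + \<beta>)" by simp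
    show "(\<lambda>n. complex_of_real (- ((norm \<kappa>)\<^sup>2 * c\<^sup>2 * t powr (\<alpha> + \<beta>))) ^ (n + 1) *
                   prabhakar (of_real \<beta>) (of_real ((\<alpha> + \<beta>) * (real n + 1) + 1)) (real n + 1)
                     (of_real (- (c\<^sup>2 / D) * t powr \<beta>)))
                sums (?H \<kappa> - 1)"
      unfolding z h_def by (rule relaxation_prabhakar_series) (use \<beta> \<gamma> D t in auto)
    note S = relaxation_binomial_series[OF \<alpha>(1) \<beta> c D t, of "norm \<kappa>"]
    show "summable (\<lambda>m. \<Sum>n. real (m choose n) * (- (c\<^sup>2 / D) * t powr \<beta>) ^ m *
                   ((norm \<kappa>)\<^sup>2 * D * t powr \<alpha>) ^ n
                   / Gamma (\<beta> * real m + \<alpha> * real n + \<alpha> + \<beta> + 1))" by (rule S(1))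
    show "?H \<kappa> = complex_of_real (1 - (norm \<kappa>)\<^sup>2 * c\<^sup>2 * t powr (\<alpha> + \<beta>) *
                (\<Sum>m. \<Sum>n. real (m choose n) * (- (c\<^sup>2 / D) * t powr \<beta>) ^ m *
                   ((norm \<kappa>)\<^sup>2 * D * t powr \<alpha>) ^ n
                   / Gamma (\<beta> * real m + \<alpha> * real n + \<alpha> + \<beta> + 1)))"
      unfolding h_def S(2) ..
  qed
qed

end
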